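(* Let $n\ge 1$ and consider rowmotion on $\mathcal{IC}([2]\times[n])$. Apart from a single orbit of size $2$ and the "quadratic" orbits listed below, every orbit has size dividing $n+3$ or $n+5$. Precisely, the orbits are as follows. For $n=1$: two orbits of size $2$. For $n=2$: one orbit each of sizes $2,5,6$. For $n=3$: two orbits of size $2$ and one orbit each of sizes $3,6,20$. For $n=4$: one orbit of size $2$, three of size $5$, one of size $6$, four of size $7$, two of size $10$. For $n\ge5$: there is exactly one orbit of size $2$, together with the following numbers of orbits of sizes $n+3$, $\frac{n+3}{2}$, $\frac{n+3}{3}$, $n+5$, $\frac{n+5}{3}$ respectively, depending on $n \bmod 6$: - $n\equiv0$: $\frac{n^3-n^2-4n+12}{12}$, $0$, $1$, $\frac{n^2-11n+30}{6}$, $0$; - $n\equiv1$: $\frac{n^3-n^2-7n+19}{12}$, $\frac{n-1}{2}$, $0$, $\frac{n^2-11n+28}{6}$, $1$; - $n\equiv2$: $\frac{n^3-n^2-4n+16}{12}$, $0$, $0$, $\frac{n^2-11n+30}{6}$, $0$; - $n\equiv3$: $\frac{n^3-n^2-7n+15}{12}$, $\frac{n-1}{2}$, $1$, $\frac{n^2-11n+30}{6}$, $0$; - $n\equiv4$: $\frac{n^3-n^2-4n+16}{12}$, $0$, $0$, $\frac{n^2-11n+28}{6}$, $1$; - $n\equiv5$: $\frac{n^3-n^2-7n+19}{12}$, $\frac{n-1}{2}$, $0$, $\frac{n^2-11n+30}{6}$, $0$; and in addition the following quadratic orbits (and no others): if $n\equiv0$, one orbit each of sizes $n^2+3n-5$,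 $n^2+n-12$, $n^2+n-13$; if $n\equiv1$, two orbits of size $n^2+2n-9$ and one each of sizes $\frac{2n^2+n-27}{3}$ and $\frac{n^2+2n-9}{3}$; if $n\equiv2$, one orbit of size $n^2+3n-4$ and two of size $n^2+n-13$; if $n\equiv3$, one orbit each of sizes $2n^2+5n-13$ and $n^2-17$; if $n\equiv4$, two orbits of size $\frac{2n^2+4n-18}{3}$, one of size $\frac{n^2+2n-6}{3}$, three of size $\frac{n^2+2n-9}{3}$, and one of size $\frac{n^2-n-21}{3}$; if $n\equiv5$, one orbit each of sizes $2n^2+3n-21$ and $n^2+2n-9$.
   Context: $[2]\times[n]=\{(i,j): i\in\{1,2\},\ 1\le j\le n\}$ with $(a,b)\le(c,d)$ iff $a\le c$ and $b\le d$. A subset $I$ is interval-closed (an ICS) if $x,y\in I$, $x\le z\le y$ imply $z\in I$; $\mathcal{IC}(P)$ is the set of ICS of $P$. For $x\in P$ the toggle $t_x$ sends an ICS $I$ to $I\triangle\{x\}$ if that is an ICS and to $I$ otherwise. Rowmotion is $\mathrm{Row}=t_{x_1}\circ\cdots\circ t_{x_N}$ for any linear extension $x_1,\dots,x_N$ of $P$ (toggles applied from the top of the poset to the bottom); it is a bijection of $\mathcal{IC}(P)$, and orbits are its cycles.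
   Formalization: The summary sentence that, apart from one orbit of size 2 and the quadratic orbits, every orbit has size dividing n+3 or n+5 is asserted only for n≥5; it fails for n=2,3,4 (for n=2 there is an orbit of size 6), where only the exact list of sizes is stated. *)

theory Defs
  imports Complex_Main "HOL-Library.Product_Order" "HOL-Combinatorics.Orbits"
begin

definition ICS :: "'a::order set \<Rightarrow> 'a set set" where
  "ICS P = {I. I \<subseteq> P \<and> (\<forall>x\<in>I. \<forall>y\<in>I. \<forall>z\<in>P. x \<le> z \<and> z \<le> y \<longrightarrow> z \<in> I)}"

definition toggle :: "'a::order set \<Rightarrow> 'a \<Rightarrow> 'a set \<Rightarrow> 'a set" where
  "toggle P x I =
     (let J = (I - {x}) \<union> ({x} - I) in if J \<in> ICS P then J else I)"

definition linear_extension :: "'a::order set \<Rightarrow> 'a list \<Rightarrow> bool" where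
  "linear_extension P xs \<longleftrightarrow> distinct xs \<and> set xs = P \<and>
     (\<forall>i<length xs. \<forall>j<length xs. xs ! i \<le> xs ! j \<longrightarrow> i \<le> j)"

text \<open>For xs = [x1, ..., xN] this is t_x1 o ... o t_xN, so the last element of xs is
  toggled first.\<close>

definition rowmotion :: "'a::order set \<Rightarrow> 'a list \<Rightarrow> 'a set \<Rightarrow> 'a set" where
  "rowmotion P xs = foldr (\<lambda>x f. toggle P x \<circ> f) xs id"

definition rowmotion_orbits :: "'a::order set \<Rightarrow> 'a list \<Rightarrow> 'a set set set" where
  "rowmotion_orbits P xs = orbit (rowmotion P xs) ` ICS P"

text \<open>The order on pairs is the componentwise one of theory Product_Order.\<close>

definition two_by :: "nat \<Rightarrow> (nat \<times> nat) set" where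
  "two_by n = {1, 2} \<times> {1..n}"

text \<open>A table lists pairs (size, number of orbits of that size); if a size occurs in
  several entries, their numbers are added, and a size that does not occur is not attained.
  Sizes and numbers are compared as rationals, so that no entry is ever rounded or truncated.\<close>

definition has_sizes :: "'b set set \<Rightarrow> (rat \<times> rat) list \<Rightarrow> bool" where
  "has_sizes A T \<longleftrightarrow>
     (\<forall>s::rat. of_nat (card {X \<in> A. of_nat (card X) = s}) =
        (\<Sum>(s', c) \<leftarrow> T. if s' = s then c else 0))"

definition small_table :: "nat \<Rightarrow> (rat \<times> rat) list" where
  "small_table n =
    (if n = 1 then [(2, 2)]
     else if n = 2 then [(2, 1), (5, 1), (6, 1)]
     else if n = 3 then [(2, 2), (3, 1), (6, 1), (20, 1)]
     else [(2, 1), (5, 3), (6, 1), (7, 4), (10, 2)])"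

definition linear_table :: "nat \<Rightarrow> (rat \<times> rat) list" where
  "linear_table n =
    (let N = (of_nat n :: rat) in
     if n mod 6 = 0 then
       [(N+3, (N^3 - N^2 - 4*N + 12) / 12), ((N+3)/2, 0), ((N+3)/3, 1),
        (N+5, (N^2 - 11*N + 30) / 6), ((N+5)/3, 0)]
     else if n mod 6 = 1 then
       [(N+3, (N^3 - N^2 - 7*N + 19) / 12), ((N+3)/2, (N-1)/2), ((N+3)/3, 0),
        (N+5, (N^2 - 11*N + 28) / 6), ((N+5)/3, 1)]
     else if n mod 6 = 2 then
       [(N+3, (N^3 - N^2 - 4*N + 16) / 12), ((N+3)/2, 0), ((N+3)/3, 0),
        (N+5, (N^2 - 11*N + 30) / 6), ((N+5)/3, 0)]
     else if n mod 6 = 3 then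
       [(N+3, (N^3 - N^2 - 7*N + 15) / 12), ((N+3)/2, (N-1)/2), ((N+3)/3, 1),
        (N+5, (N^2 - 11*N + 30) / 6), ((N+5)/3, 0)]
     else if n mod 6 = 4 then
       [(N+3, (N^3 - N^2 - 4*N + 16) / 12), ((N+3)/2, 0), ((N+3)/3, 0),
        (N+5, (N^2 - 11*N + 28) / 6), ((N+5)/3, 1)]
     else
       [(N+3, (N^3 - N^2 - 7*N + 19) / 12), ((N+3)/2, (N-1)/2), ((N+3)/3, 0),
        (N+5, (N^2 - 11*N + 30) / 6), ((N+5)/3, 0)])"

definition quadratic_table :: "nat \<Rightarrow> (rat \<times> rat) list" where
  "quadratic_table n =
    (let N = (of_nat n :: rat) in
     if n mod 6 = 0 then
       [(N^2 + 3*N - 5, 1), (N^2 + N - 12, 1), (N^2 + N - 13, 1)]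
     else if n mod 6 = 1 then
       [(N^2 + 2*N - 9, 2), ((2*N^2 + N - 27) / 3, 1), ((N^2 + 2*N - 9) / 3, 1)]
     else if n mod 6 = 2 then
       [(N^2 + 3*N - 4, 1), (N^2 + N - 13, 2)]
     else if n mod 6 = 3 then
       [(2*N^2 + 5*N - 13, 1), (N^2 - 17, 1)]
     else if n mod 6 = 4 then
       [((2*N^2 + 4*N - 18) / 3, 2), ((N^2 + 2*N - 6) / 3, 1),
        ((N^2 + 2*N - 9) / 3, 3), ((N^2 - N - 21) / 3, 1)]
     else
       [(2*N^2 + 3*N - 21, 1), (N^2 + 2*N - 9, 1)])"

end

theory Submission
  imports Defs
begin

text \<open>
  An interval-closed set of the poset is a pair of intervals, the bottom row \<open>[a, b]\<close> and the top
  row \<open>[c, d]\<close>, with \<open>c \<le> a\<close> and \<open>d \<le> b\<close> when both are nonempty. Rowmotion shifts all four ends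
  by one until \<open>b\<close> hits \<open>n\<close> or two ends meet, and then reshuffles them. Following only the states with
  \<open>c = 1 \<le> d < a\<close>, described by the gaps between \<open>1, d, a, b, n\<close>, the first return map permutes the
  gaps up to a shift; this produces the periods \<open>n + 3\<close>. When \<open>a = d + 1\<close> the orbit passes through states
  with an empty bottom row; there rowmotion rotates a triple of gaps with sum \<open>n + 2\<close>, with period \<open>n + 5\<close>,
  as long as all three gaps are at least 3. The remaining triples form three lines on which the return
  map is a translation, and the orbits that it glues together at the ends of the lines are the
  quadratic ones, which is why they depend on \<open>n mod 6\<close>.

  That the periods found in this way are minimal, and that the orbits are distinct, is not checked
  directly: the claimed sizes are upper bounds, and they add up to the number of all
  interval-closed sets.
\<close>

section \<open>Toggles and rowmotion of a finite poset\<close>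

text \<open>Minimality of a period and distinctness of orbits would both require tracking all states
  on the way. The substitute is a weighted count: a representative gets the weight |orbit| / (number
  of representatives on its orbit). Since every orbit has a representative, the weights add up to
  the number of all interval-closed sets. An exhibited return bounds the numerator from above,
  exhibited further representatives bound the denominator from below; as these bounds add up to the
  same number, every one of them is attained.

  The size of the exceptional orbits can be read off the lines: one translation costs n + 6 steps
  and moves by 3, so descending a whole line costs about n^2/3 steps, and the descents towards the
  nine endpoints account for the leading term of the 3n^2 + 5n - 30 states left over by the linear
  orbits. A translation also exchanges two of the lines, so n mod 3 and a parity together decide
  which endpoint comes next.\<close>

lemma ICS_I:
  assumes "I \<subseteq> P" and "\<And>x y z. x \<in> I \<Longrightarrow> y \<in> I \<Longrightarrow> z \<in> P \<Longrightarrow> x \<le> z \<Longrightarrow> z \<le> y \<Longrightarrow> z \<in> I"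
  shows "I \<in> ICS P"
  unfolding ICS_def using assms by blast

lemma ICS_D: "I \<in> ICS P \<Longrightarrow> x \<in> I \<Longrightarrow> y \<in> I \<Longrightarrow> z \<in> P \<Longrightarrow> x \<le> z \<Longrightarrow> z \<le> y \<Longrightarrow> z \<in> I"
  unfolding ICS_def by blast

lemma toggle_ICS: "I \<in> ICS P \<Longrightarrow> toggle P x I \<in> ICS P"
  by (simp add: toggle_def Let_def)

lemma toggle_toggle: "I \<in> ICS P \<Longrightarrow> toggle P x (toggle P x I) = I"
proof -
  assume I: "I \<in> ICS P"
  let ?J = "(I - {x}) \<union> ({x} - I)"
  have "(?J - {x}) \<union> ({x} - ?J) = I" by auto
  with I show ?thesis by (auto simp: toggle_def Let_def)
qed

lemma toggle_other: "y \<noteq> x \<Longrightarrow> y \<in> toggle P x I \<longleftrightarrow> y \<in> I"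
  by (auto simp: toggle_def Let_def)

lemma rowmotion_Nil: "rowmotion P [] = id"
  and rowmotion_Cons: "rowmotion P (x # xs) = toggle P x \<circ> rowmotion P xs"
  by (simp_all add: rowmotion_def)

lemma rowmotion_append: "rowmotion P (xs @ ys) = rowmotion P xs \<circ> rowmotion P ys"
  by (induction xs) (auto simp: rowmotion_Nil rowmotion_Cons)

lemma rowmotion_other: "y \<notin> set xs \<Longrightarrow> y \<in> rowmotion P xs I \<longleftrightarrow> y \<in> I"
  by (induction xs) (auto simp: rowmotion_Nil rowmotion_Cons toggle_other)

lemma bij_betw_toggle: "bij_betw (toggle P x) (ICS P) (ICS P)"
  by (rule bij_betw_byWitness[where f' = "toggle P x"]) (auto simp: toggle_toggle toggle_ICS)

lemma bij_betw_rowmotion: "bij_betw (rowmotion P xs) (ICS P) (ICS P)"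
proof (induction xs)
  case Nil
  show ?case by (simp add: rowmotion_Nil bij_betw_def)
next
  case (Cons x xs)
  then show ?case
    unfolding rowmotion_Cons by (rule bij_betw_trans) (rule bij_betw_toggle)
qed

text \<open>The rule by which rowmotion decides about \<open>x\<close>: below \<open>x\<close> the old set \<open>I\<close> counts, above \<open>x\<close> the new
  set \<open>J\<close>. It determines \<open>J\<close> and does not mention the linear extension.\<close>

definition toggled_in :: "'a::order set \<Rightarrow> 'a set \<Rightarrow> 'a set \<Rightarrow> 'a \<Rightarrow> bool" where
  "toggled_in P I J x \<longleftrightarrow>
     (if x \<in> I then (\<exists>y\<in>I. y < x) \<and> (\<exists>z\<in>J. x < z)
      else (\<forall>z\<in>J. x < z \<longrightarrow> (\<forall>w\<in>P. x < w \<and> w \<le> z \<longrightarrow> w \<in> J)) \<and>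
           (\<forall>y\<in>I. y < x \<longrightarrow> (\<forall>w\<in>P. y \<le> w \<and> w < x \<longrightarrow> w \<in> I)))"

lemma toggled_in_cong:
  assumes "x \<in> I \<longleftrightarrow> x \<in> I'" and "\<And>y. y \<in> P \<Longrightarrow> y < x \<Longrightarrow> y \<in> I \<longleftrightarrow> y \<in> I'"
    and "\<And>y. y \<in> P \<Longrightarrow> x < y \<Longrightarrow> y \<in> J \<longleftrightarrow> y \<in> J'"
    and "I \<subseteq> P" "I' \<subseteq> P" "J \<subseteq> P" "J' \<subseteq> P"
  shows "toggled_in P I J x \<longleftrightarrow> toggled_in P I' J' x"
proof -
  have dn: "y \<in> I \<longleftrightarrow> y \<in> I'" if "y < x" for y using assms(2,4,5) that by blast
  have up: "y \<in> J \<longleftrightarrow> y \<in> J'" if "x < y" for y using assms(3,6,7) that by blast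
  have 1: "(\<exists>y\<in>I. y < x) \<longleftrightarrow> (\<exists>y\<in>I'. y < x)" using dn by blast
  have 2: "(\<exists>y\<in>J. x < y) \<longleftrightarrow> (\<exists>y\<in>J'. x < y)" using up by blast
  have 3: "(\<forall>z\<in>J. x < z \<longrightarrow> (\<forall>w\<in>P. x < w \<and> w \<le> z \<longrightarrow> w \<in> J)) \<longleftrightarrow>
      (\<forall>z\<in>J'. x < z \<longrightarrow> (\<forall>w\<in>P. x < w \<and> w \<le> z \<longrightarrow> w \<in> J'))"
    using up by blast
  have 4: "(\<forall>y\<in>I. y < x \<longrightarrow> (\<forall>w\<in>P. y \<le> w \<and> w < x \<longrightarrow> w \<in> I)) \<longleftrightarrow>
      (\<forall>y\<in>I'. y < x \<longrightarrow> (\<forall>w\<in>P. y \<le> w \<and> w < x \<longrightarrow> w \<in> I'))"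
    using dn by blast
  show ?thesis unfolding toggled_in_def 1 2 3 4 assms(1) ..
qed

text \<open>At the moment of the toggle one set plays both roles of \<open>toggled_in\<close>.
  Removing \<open>x\<close> fails exactly if \<open>K\<close> has points on both sides of
  \<open>x\<close>. Adding \<open>x\<close> creates only intervals with \<open>x\<close> as an end,
  since intervals between two points of \<open>K\<close> already lie in \<open>K\<close>.\<close>

lemma toggle_mem:
  assumes K: "K \<in> ICS P" and x: "x \<in> P"
  shows "x \<in> toggle P x K \<longleftrightarrow> toggled_in P K K x"
proof (cases "x \<in> K")
  case True
  have sub: "K \<subseteq> P" using K by (simp add: ICS_def)
  have "K - {x} \<in> ICS P \<longleftrightarrow> \<not> ((\<exists>y\<in>K. y < x) \<and> (\<exists>z\<in>K. x < z))"
  proof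
    assume "K - {x} \<in> ICS P"
    from ICS_D[OF this _ _ x] show "\<not> ((\<exists>y\<in>K. y < x) \<and> (\<exists>z\<in>K. x < z))"
      by (auto simp: less_le)
  next
    assume n: "\<not> ((\<exists>y\<in>K. y < x) \<and> (\<exists>z\<in>K. x < z))"
    show "K - {x} \<in> ICS P"
    proof (rule ICS_I)
      show "K - {x} \<subseteq> P" using sub by auto
      fix u v w assume "u \<in> K - {x}" "v \<in> K - {x}" "w \<in> P" "u \<le> w" "w \<le> v"
      with ICS_D[OF K, of u v w] n show "w \<in> K - {x}" by (auto simp: less_le)
    qed
  qed
  moreover have "(K - {x}) \<union> ({x} - K) = K - {x}" using True by auto
  ultimately show ?thesis using True by (auto simp: toggle_def toggled_in_def Let_def)
next
  case False
  have sub: "K \<subseteq> P" using K by (simp add: ICS_def)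
  have "insert x K \<in> ICS P \<longleftrightarrow> toggled_in P K K x"
  proof
    assume i: "insert x K \<in> ICS P"
    have 1: "w \<in> K" if "z \<in> K" "x < w" "w \<le> z" "w \<in> P" for w z
      using ICS_D[OF i, of x z w] that by (auto simp: less_le)
    have 2: "w \<in> K" if "z \<in> K" "w < x" "z \<le> w" "w \<in> P" for w z
      using ICS_D[OF i, of z x w] that by (auto simp: less_le)
    have "(\<forall>z\<in>K. x < z \<longrightarrow> (\<forall>w\<in>P. x < w \<and> w \<le> z \<longrightarrow> w \<in> K)) \<and>
           (\<forall>y\<in>K. y < x \<longrightarrow> (\<forall>w\<in>P. y \<le> w \<and> w < x \<longrightarrow> w \<in> K))"
      by (intro conjI ballI impI; elim conjE) (rule 1, assumption+, rule 2, assumption+)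
    then show "toggled_in P K K x" unfolding toggled_in_def if_not_P[OF False] .
  next
    assume "toggled_in P K K x"
    then have t: "\<And>w z. z \<in> K \<Longrightarrow> x < w \<Longrightarrow> w \<le> z \<Longrightarrow> w \<in> P \<Longrightarrow> w \<in> K"
        "\<And>w z. z \<in> K \<Longrightarrow> w < x \<Longrightarrow> z \<le> w \<Longrightarrow> w \<in> P \<Longrightarrow> w \<in> K"
      unfolding toggled_in_def if_not_P[OF False]
      by (meson order.strict_trans1 order.strict_trans2)+
    show "insert x K \<in> ICS P"
    proof (rule ICS_I)
      show "insert x K \<subseteq> P" using sub x by auto
      fix u v w assume *: "u \<in> insert x K" "v \<in> insert x K" "w \<in> P" "u \<le> w" "w \<le> v"
      show "w \<in> insert x K"
      proof (cases "w = x \<or> (u \<in> K \<and> v \<in> K)")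
        case True
        then show ?thesis using * ICS_D[OF K, of u v w] by auto
      next
        case w: False
        then have c: "u = x \<or> v = x" "w \<noteq> x" using * by auto
        show ?thesis
        proof (cases "u = x")
          case True
          then have "v \<in> K" "x < w" using * c w by (auto simp: less_le)
          then show ?thesis using t(1)[of v w] * by blast
        next
          case u: False
          then have "u \<in> K" "w < x" using * c by (auto simp: less_le)
          then show ?thesis using t(2)[of u w] * by blast
        qed
      qed
    qed
  qed
  moreover have "(K - {x}) \<union> ({x} - K) = insert x K" using False by auto
  ultimately show ?thesis using False by (auto simp: toggle_def Let_def)
qed

lemma rowmotion_ICS: "I \<in> ICS P \<Longrightarrow> rowmotion P xs I \<in> ICS P"
  using bij_betw_rowmotion bij_betwE by blast

text \<open>Split \<open>xs\<close> at \<open>x\<close>. The part \<open>vs\<close> behind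
  \<open>x\<close> is toggled first and contains nothing below \<open>x\<close>, so below
  \<open>x\<close> the intermediate set \<open>K\<close> is still \<open>I\<close>; the part
  \<open>us\<close> is toggled later and contains nothing above \<open>x\<close>, so above
  \<open>x\<close> the set \<open>K\<close> is already final.\<close>

lemma rowmotion_mem:
  assumes le: "linear_extension P xs" and I: "I \<in> ICS P" and x: "x \<in> P"
  shows "x \<in> rowmotion P xs I \<longleftrightarrow> toggled_in P I (rowmotion P xs I) x"
proof -
  have ext: "distinct xs" "set xs = P" "\<And>i j. i < length xs \<Longrightarrow> j < length xs \<Longrightarrow> xs ! i \<le> xs ! j \<Longrightarrow> i \<le> j"
    using le by (auto simp: linear_extension_def)
  obtain us vs where xs: "xs = us @ x # vs" using x ext(2) split_list by metis
  define K where "K = rowmotion P vs I"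
  have J: "rowmotion P xs I = rowmotion P us (toggle P x K)"
    by (simp add: xs rowmotion_append rowmotion_Cons K_def)
  have K: "K \<in> ICS P" by (simp add: K_def rowmotion_ICS I)
  have nth_x: "xs ! length us = x" by (simp add: xs)
  have below: "y \<notin> set vs" if "y < x" for y
  proof
    assume "y \<in> set vs"
    then obtain i where "i < length vs" "vs ! i = y" by (auto simp: in_set_conv_nth)
    with ext(3)[of "length us + Suc i" "length us"] that show False
      by (simp add: xs nth_append less_imp_le)
  qed
  have above: "y \<notin> set us" if "x < y" for y
  proof
    assume "y \<in> set us"
    then obtain i where "i < length us" "us ! i = y" by (auto simp: in_set_conv_nth)
    with ext(3)[of "length us" i] that show False
      by (simp add: xs nth_append less_imp_le)
  qed
  have "x \<in> rowmotion P xs I \<longleftrightarrow> x \<in> toggle P x K"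
    unfolding J using ext(1) xs by (intro rowmotion_other) auto
  also have "\<dots> \<longleftrightarrow> toggled_in P K K x" by (rule toggle_mem[OF K x])
  also have "\<dots> \<longleftrightarrow> toggled_in P I (rowmotion P xs I) x"
  proof (rule toggled_in_cong)
    show "x \<in> K \<longleftrightarrow> x \<in> I"
      unfolding K_def using ext(1) xs by (intro rowmotion_other) auto
    show "y \<in> K \<longleftrightarrow> y \<in> I" if "y < x" for y
      unfolding K_def using below[OF that] by (intro rowmotion_other) auto
    show "y \<in> K \<longleftrightarrow> y \<in> rowmotion P xs I" if "x < y" for y
      unfolding J using above[OF that] that by (simp add: rowmotion_other toggle_other)
  qed (use K I rowmotion_ICS in \<open>auto simp: ICS_def\<close>)
  finally show ?thesis .
qed

text \<open>The rule at \<open>x\<close> consults the new set only above \<open>x\<close>. At a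
  maximal point of the symmetric difference both candidates therefore obey the same rule, a
  contradiction.\<close>

lemma rowmotion_eqI:
  assumes le: "linear_extension P xs" and I: "I \<in> ICS P" and J: "J \<subseteq> P"
    and loc: "\<And>x. x \<in> P \<Longrightarrow> x \<in> J \<longleftrightarrow> toggled_in P I J x"
  shows "rowmotion P xs I = J"
proof (rule ccontr)
  define R where "R = rowmotion P xs I"
  assume "rowmotion P xs I \<noteq> J"
  then have ne: "R - J \<union> (J - R) \<noteq> {}" by (auto simp: R_def)
  have sub: "R \<subseteq> P" "I \<subseteq> P" using rowmotion_ICS[OF I] I by (auto simp: R_def ICS_def)
  have fin: "finite P" using le by (auto simp: linear_extension_def)
  have "finite (R - J \<union> (J - R))" using fin sub J by (meson finite_Diff finite_UnI finite_subset)
  from finite_has_maximal[OF this ne] obtain x where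
    x: "x \<in> R - J \<union> (J - R)" and max: "\<And>y. y \<in> R - J \<union> (J - R) \<Longrightarrow> x \<le> y \<Longrightarrow> x = y" by blast
  have xP: "x \<in> P" using x sub J by auto
  have "toggled_in P I R x \<longleftrightarrow> toggled_in P I J x"
  proof (rule toggled_in_cong)
    show "y \<in> R \<longleftrightarrow> y \<in> J" if "x < y" for y
      using max[of y] that by (auto simp: less_le)
  qed (use sub J in auto)
  then have "x \<in> R \<longleftrightarrow> x \<in> J"
    using rowmotion_mem[OF le I xP] loc[OF xP] by (simp add: R_def)
  with x show False by auto
qed

section \<open>One step of rowmotion on two rows\<close>

definition st :: "nat \<Rightarrow> nat \<Rightarrow> nat \<Rightarrow> nat \<Rightarrow> (nat \<times> nat) set" where
  "st a b c d = {1} \<times> {a..b} \<union> {2} \<times> {c..d}"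

lemma mem_st: "(i, j) \<in> st a b c d \<longleftrightarrow> i = 1 \<and> a \<le> j \<and> j \<le> b \<or> i = 2 \<and> c \<le> j \<and> j \<le> d"
  by (auto simp: st_def)

text \<open>An empty row is any interval \<open>{a..b}\<close> with \<open>b < a\<close>; below it is always written \<open>{1..0}\<close>.\<close>

definition valid :: "nat \<Rightarrow> nat \<Rightarrow> nat \<Rightarrow> nat \<Rightarrow> nat \<Rightarrow> bool" where
  "valid n a b c d \<longleftrightarrow> (a \<le> b \<longrightarrow> 1 \<le> a \<and> b \<le> n) \<and> (c \<le> d \<longrightarrow> 1 \<le> c \<and> d \<le> n) \<and>
     (a \<le> b \<and> c \<le> d \<longrightarrow> c \<le> a \<and> d \<le> b)"

lemma mem_two_by: "(i, j) \<in> two_by n \<longleftrightarrow> (i = 1 \<or> i = 2) \<and> 1 \<le> j \<and> j \<le> n"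
  by (auto simp: two_by_def)

lemma st_ICS:
  assumes "valid n a b c d"
  shows "st a b c d \<in> ICS (two_by n)"
proof (rule ICS_I)
  show "st a b c d \<subseteq> two_by n"
    using assms by (auto simp: mem_st mem_two_by valid_def)
  fix x y z :: "nat \<times> nat"
  assume "x \<in> st a b c d" "y \<in> st a b c d" "z \<in> two_by n" "x \<le> z" "z \<le> y"
  moreover obtain i j i' j' i'' j'' where "x = (i, j)" "y = (i', j')" "z = (i'', j'')"
    by (metis surj_pair)
  ultimately show "z \<in> st a b c d" using assms
    by (simp add: mem_st mem_two_by valid_def) linarith
qed

lemma less_pair_nat: "(i, j) < (i', j') \<longleftrightarrow> (i < i' \<and> j \<le> j') \<or> (i \<le> i' \<and> j < (j'::nat))" for i :: nat
  by (auto simp: less_prod_def)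

text \<open>As both rows are intervals, the quantifiers need testing only at extreme points:
  \<open>z\<close> at the right ends \<open>(1, b')\<close> and \<open>(2, d')\<close>, and
  \<open>w\<close> at the covers \<open>(1, j + 1)\<close> and \<open>(2, j)\<close> of
  \<open>(1, j)\<close> and at \<open>(1, d')\<close>.\<close>

lemma toggled_in_bottom:
  assumes "valid n a b c d" "valid n a' b' c' d'" "1 \<le> j" "j \<le> n"
  shows "toggled_in (two_by n) (st a b c d) (st a' b' c' d') (1, j) \<longleftrightarrow>
    (if a \<le> j \<and> j \<le> b then a < j \<and> ((a' \<le> b' \<and> j < b') \<or> (c' \<le> d' \<and> j \<le> d'))
     else (a' \<le> b' \<and> j < b' \<longrightarrow> a' \<le> j + 1) \<and>
          (c' \<le> d' \<and> j \<le> d' \<longrightarrow> c' \<le> j \<and> (j < d' \<longrightarrow> a' \<le> j + 1 \<and> d' \<le> b')) \<and>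
          (a \<le> b \<and> a < j \<longrightarrow> j \<le> b + 1))"
proof -
  let ?P = "two_by n" and ?I = "st a b c d" and ?J = "st a' b' c' d'"
  have 1: "(\<exists>y\<in>?I. y < (1, j)) \<longleftrightarrow> a \<le> b \<and> a < j"
  proof
    assume "a \<le> b \<and> a < j"
    then have "(1, a) \<in> ?I" "(1::nat, a) < (1, j)" by (auto simp: mem_st less_pair_nat)
    then show "\<exists>y\<in>?I. y < (1, j)" by blast
  qed (auto simp: mem_st less_pair_nat)
  have 2: "(\<exists>z\<in>?J. (1, j) < z) \<longleftrightarrow> (a' \<le> b' \<and> j < b') \<or> (c' \<le> d' \<and> j \<le> d')"
  proof
    assume *: "(a' \<le> b' \<and> j < b') \<or> (c' \<le> d' \<and> j \<le> d')"
    show "\<exists>z\<in>?J. (1, j) < z"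
    proof (cases "a' \<le> b' \<and> j < b'")
      case True
      then have "(1, b') \<in> ?J" "(1::nat, j) < (1, b')" by (auto simp: mem_st less_pair_nat)
      then show ?thesis by blast
    next
      case False
      with * have "(2, d') \<in> ?J" "(1::nat, j) < (2, d')" by (auto simp: mem_st less_pair_nat)
      then show ?thesis by blast
    qed
  qed (auto simp: mem_st less_pair_nat)
  have 3: "(\<forall>z\<in>?J. (1, j) < z \<longrightarrow> (\<forall>w\<in>?P. (1, j) < w \<and> w \<le> z \<longrightarrow> w \<in> ?J)) \<longleftrightarrow>
      (a' \<le> b' \<and> j < b' \<longrightarrow> a' \<le> j + 1) \<and>
      (c' \<le> d' \<and> j \<le> d' \<longrightarrow> c' \<le> j \<and> (j < d' \<longrightarrow> a' \<le> j + 1 \<and> d' \<le> b'))" (is "?L \<longleftrightarrow> ?R")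
  proof
    assume L: ?L
    have "a' \<le> j + 1" if "a' \<le> b'" "j < b'"
      using bspec[OF bspec[OF L, of "(1, b')", THEN mp], of "(1, j + 1)"] that assms
      by (auto simp: mem_st less_pair_nat mem_two_by valid_def)
    moreover have "c' \<le> j" if "c' \<le> d'" "j \<le> d'"
      using bspec[OF bspec[OF L, of "(2, d')", THEN mp], of "(2, j)"] that assms
      by (auto simp: mem_st less_pair_nat mem_two_by valid_def)
    moreover have "a' \<le> j + 1" if "c' \<le> d'" "j < d'"
      using bspec[OF bspec[OF L, of "(2, d')", THEN mp], of "(1, j + 1)"] that assms
      by (auto simp: mem_st less_pair_nat mem_two_by valid_def)
    moreover have "d' \<le> b'" if "c' \<le> d'" "j < d'"
      using bspec[OF bspec[OF L, of "(2, d')", THEN mp], of "(1, d')"] that assms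
      by (auto simp: mem_st less_pair_nat mem_two_by valid_def)
    ultimately show ?R by blast
  next
    assume ?R
    then show ?L by (auto simp: mem_st less_pair_nat mem_two_by)
  qed
  have 4: "(\<forall>y\<in>?I. y < (1, j) \<longrightarrow> (\<forall>w\<in>?P. y \<le> w \<and> w < (1, j) \<longrightarrow> w \<in> ?I)) \<longleftrightarrow>
      (a \<le> b \<and> a < j \<longrightarrow> j \<le> b + 1)" (is "?L \<longleftrightarrow> ?R")
  proof
    assume L: ?L
    show ?R
    proof
      assume "a \<le> b \<and> a < j"
      then have "(1, a) \<in> ?I" "(1, j - 1) \<in> ?P" "(1::nat, a) < (1, j)" "(1::nat, a) \<le> (1, j - 1)"
          "(1::nat, j - 1) < (1, j)"
        using assms by (auto simp: mem_st less_pair_nat mem_two_by valid_def)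
      with L have "(1, j - 1) \<in> ?I" by blast
      then show "j \<le> b + 1" by (auto simp: mem_st)
    qed
  next
    assume ?R
    then show ?L by (auto simp: mem_st less_pair_nat mem_two_by)
  qed
  show ?thesis
    unfolding toggled_in_def 1 2 3 4 by (auto simp: mem_st)
qed

lemma toggled_in_top:
  assumes "valid n a b c d" "valid n a' b' c' d'" "1 \<le> j" "j \<le> n"
  shows "toggled_in (two_by n) (st a b c d) (st a' b' c' d') (2, j) \<longleftrightarrow>
    (if c \<le> j \<and> j \<le> d then (c < j \<or> (a \<le> b \<and> a \<le> j)) \<and> c' \<le> d' \<and> j < d'
     else (c' \<le> d' \<and> j < d' \<longrightarrow> c' \<le> j + 1) \<and>
          (a \<le> b \<and> a \<le> j \<longrightarrow> j \<le> b \<and> (a < j \<longrightarrow> c \<le> a \<and> j \<le> d + 1)) \<and>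
          (c \<le> d \<and> c < j \<longrightarrow> j \<le> d + 1))"
proof -
  let ?P = "two_by n" and ?I = "st a b c d" and ?J = "st a' b' c' d'"
  have 1: "(\<exists>z\<in>?J. (2, j) < z) \<longleftrightarrow> c' \<le> d' \<and> j < d'"
  proof
    assume "c' \<le> d' \<and> j < d'"
    then have "(2, d') \<in> ?J" "(2::nat, j) < (2, d')" by (auto simp: mem_st less_pair_nat)
    then show "\<exists>z\<in>?J. (2, j) < z" by blast
  qed (auto simp: mem_st less_pair_nat)
  have 2: "(\<exists>y\<in>?I. y < (2, j)) \<longleftrightarrow> (c \<le> d \<and> c < j) \<or> (a \<le> b \<and> a \<le> j)"
  proof
    assume *: "(c \<le> d \<and> c < j) \<or> (a \<le> b \<and> a \<le> j)"
    show "\<exists>y\<in>?I. y < (2, j)"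
    proof (cases "c \<le> d \<and> c < j")
      case True
      then have "(2, c) \<in> ?I" "(2::nat, c) < (2, j)" by (auto simp: mem_st less_pair_nat)
      then show ?thesis by blast
    next
      case False
      with * have "(1, a) \<in> ?I" "(1::nat, a) < (2, j)" by (auto simp: mem_st less_pair_nat)
      then show ?thesis by blast
    qed
  qed (auto simp: mem_st less_pair_nat)
  have 3: "(\<forall>z\<in>?J. (2, j) < z \<longrightarrow> (\<forall>w\<in>?P. (2, j) < w \<and> w \<le> z \<longrightarrow> w \<in> ?J)) \<longleftrightarrow>
      (c' \<le> d' \<and> j < d' \<longrightarrow> c' \<le> j + 1)" (is "?L \<longleftrightarrow> ?R")
  proof
    assume L: ?L
    show ?R
      using bspec[OF bspec[OF L, of "(2, d')", THEN mp], of "(2, j + 1)"] assms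
      by (auto simp: mem_st less_pair_nat mem_two_by valid_def)
  next
    assume ?R
    then show ?L by (auto simp: mem_st less_pair_nat mem_two_by)
  qed
  have 4: "(\<forall>y\<in>?I. y < (2, j) \<longrightarrow> (\<forall>w\<in>?P. y \<le> w \<and> w < (2, j) \<longrightarrow> w \<in> ?I)) \<longleftrightarrow>
      (a \<le> b \<and> a \<le> j \<longrightarrow> j \<le> b \<and> (a < j \<longrightarrow> c \<le> a \<and> j \<le> d + 1)) \<and>
      (c \<le> d \<and> c < j \<longrightarrow> j \<le> d + 1)" (is "?L \<longleftrightarrow> ?R")
  proof
    assume L: ?L
    have "j \<le> b" if "a \<le> b" "a \<le> j"
      using bspec[OF bspec[OF L, of "(1, a)", THEN mp], of "(1, j)"] that assms
      by (auto simp: mem_st less_pair_nat mem_two_by valid_def)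
    moreover have "c \<le> a" if "a \<le> b" "a < j"
      using bspec[OF bspec[OF L, of "(1, a)", THEN mp], of "(2, a)"] that assms
      by (auto simp: mem_st less_pair_nat mem_two_by valid_def)
    moreover have "j \<le> d + 1" if "a \<le> b" "a < j"
    proof -
      have "(1, a) \<in> ?I" "(2, j - 1) \<in> ?P" "(1::nat, a) < (2, j)" "(1::nat, a) \<le> (2, j - 1)"
          "(2::nat, j - 1) < (2, j)"
        using that assms by (auto simp: mem_st less_pair_nat mem_two_by valid_def)
      with L have "(2, j - 1) \<in> ?I" by blast
      then show ?thesis by (auto simp: mem_st)
    qed
    moreover have "j \<le> d + 1" if "c \<le> d" "c < j"
    proof -
      have "(2, c) \<in> ?I" "(2, j - 1) \<in> ?P" "(2::nat, c) < (2, j)" "(2::nat, c) \<le> (2, j - 1)"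
          "(2::nat, j - 1) < (2, j)"
        using that assms by (auto simp: mem_st less_pair_nat mem_two_by valid_def)
      with L have "(2, j - 1) \<in> ?I" by blast
      then show ?thesis by (auto simp: mem_st)
    qed
    ultimately show ?R by blast
  next
    assume ?R
    then show ?L by (auto simp: mem_st less_pair_nat mem_two_by)
  qed
  show ?thesis
    unfolding toggled_in_def 1 2 3 4 by (auto simp: mem_st)
qed

locale two_rows =
  fixes n :: nat and xs :: "(nat \<times> nat) list"
  assumes linext: "linear_extension (two_by n) xs"
begin

abbreviation row :: "(nat \<times> nat) set \<Rightarrow> (nat \<times> nat) set" where
  "row \<equiv> rowmotion (two_by n) xs"

text \<open>The local rule for each row, with the new ends on both sides. For concrete ends this is
  linear arithmetic in \<open>j\<close>, so every step below is verified rather than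
  computed.\<close>

lemma row_stI:
  assumes v: "valid n a b c d" and v': "valid n a' b' c' d'"
    and bot: "\<And>j. 1 \<le> j \<Longrightarrow> j \<le> n \<Longrightarrow> a' \<le> j \<and> j \<le> b' \<longleftrightarrow>
    (if a \<le> j \<and> j \<le> b then a < j \<and> ((a' \<le> b' \<and> j < b') \<or> (c' \<le> d' \<and> j \<le> d'))
     else (a' \<le> b' \<and> j < b' \<longrightarrow> a' \<le> j + 1) \<and>
          (c' \<le> d' \<and> j \<le> d' \<longrightarrow> c' \<le> j \<and> (j < d' \<longrightarrow> a' \<le> j + 1 \<and> d' \<le> b')) \<and>
          (a \<le> b \<and> a < j \<longrightarrow> j \<le> b + 1))"
    and top: "\<And>j. 1 \<le> j \<Longrightarrow> j \<le> n \<Longrightarrow> c' \<le> j \<and> j \<le> d' \<longleftrightarrow>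
    (if c \<le> j \<and> j \<le> d then (c < j \<or> (a \<le> b \<and> a \<le> j)) \<and> c' \<le> d' \<and> j < d'
     else (c' \<le> d' \<and> j < d' \<longrightarrow> c' \<le> j + 1) \<and>
          (a \<le> b \<and> a \<le> j \<longrightarrow> j \<le> b \<and> (a < j \<longrightarrow> c \<le> a \<and> j \<le> d + 1)) \<and>
          (c \<le> d \<and> c < j \<longrightarrow> j \<le> d + 1))"
  shows "row (st a b c d) = st a' b' c' d'"
proof (rule rowmotion_eqI[OF linext st_ICS[OF v]])
  show "st a' b' c' d' \<subseteq> two_by n" using st_ICS[OF v'] by (auto simp: ICS_def)
  fix x assume "x \<in> two_by n"
  then obtain i j where x: "x = (i, j)" "i = 1 \<or> i = 2" "1 \<le> j" "j \<le> n"
    by (cases x) (auto simp: mem_two_by)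
  from x(2) show "x \<in> st a' b' c' d' \<longleftrightarrow> toggled_in (two_by n) (st a b c d) (st a' b' c' d') x"
  proof
    assume "i = 1"
    then show ?thesis
      unfolding x(1) using toggled_in_bottom[OF v v' x(3,4)] bot[OF x(3,4)] by (simp only: mem_st) simp
  next
    assume "i = 2"
    then show ?thesis
      unfolding x(1) using toggled_in_top[OF v v' x(3,4)] top[OF x(3,4)] by (simp only: mem_st) simp
  qed
qed

text \<open>The new ends are variables tied by equations, here and in the rules that follow, so that
  a step can be matched against a target in any arithmetic form.\<close>

lemma row_shift:
  assumes "1 \<le> c" "c \<le> d" "c < a" "a \<le> b" "d < b" "b < n" "a' = a + 1" "b' = b + 1" "c' = c + 1" "d' = d + 1"
  shows "row (st a b c d) = st (a') (b') (c') (d')"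
  by (rule row_stI; use assms in \<open>simp add: valid_def\<close>; arith?)

lemma row_top_full_left:
  assumes "1 \<le> c" "c = a" "a \<le> d" "d < b" "b < n" "a' = a + 1" "b' = b + 1" "d' = d + 1"
  shows "row (st a b c d) = st (a') (b') 1 (d')"
  by (rule row_stI; use assms in \<open>simp add: valid_def\<close>; arith?)

lemma row_top_flush_right:
  assumes "1 \<le> c" "c \<le> d" "d = b" "c \<le> a" "a \<le> b" "b < n" "a' = a + 1" "b' = b + 1" "d' = c - 1"
  shows "row (st a b c d) = st (a') (b') 1 (d')"
  by (rule row_stI; use assms in \<open>simp add: valid_def\<close>; arith?)

lemma row_end_overlap:
  assumes "1 \<le> c" "c < a" "a \<le> d" "d < b" "b = n" "a' = a + 1" "b' = d + 1" "c' = c + 1" "d' = d + 1"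
  shows "row (st a b c d) = st (a') (b') (c') (d')"
  by (rule row_stI; use assms in \<open>simp add: valid_def\<close>; arith?)

lemma row_end_adjacent:
  assumes "1 \<le> c" "c \<le> d" "a = d + 1" "a \<le> n" "b = n" "c' = c + 1" "d' = d + 1"
  shows "row (st a b c d) = st 1 0 (c') (d')"
  by (rule row_stI; use assms in \<open>simp add: valid_def\<close>; arith?)

lemma row_end_gap:
  assumes "1 \<le> c" "c \<le> d" "d + 1 < a" "a \<le> n" "b = n" "a' = c + 1" "b' = a - 1" "c' = c + 1" "d' = d + 1"
  shows "row (st a b c d) = st (a') (b') (c') (d')"
  by (rule row_stI; use assms in \<open>simp add: valid_def\<close>; arith?)

lemma row_end_left:
  assumes "1 \<le> c" "c = a" "a \<le> d" "d < n" "b = n" "a' = a + 1" "b' = d + 1" "d' = d + 1"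
  shows "row (st a b c d) = st (a') (b') 1 (d')"
  by (rule row_stI; use assms in \<open>simp add: valid_def\<close>; arith?)

text \<open>If both rows reach \<open>n\<close>, then \<open>c \<le> a\<close> makes the set an
  order filter, and it is sent to its complement.\<close>

lemma row_end_full:
  assumes "1 \<le> c" "c \<le> a" "a \<le> n" "b = n" "d = n" "b' = a - 1" "d' = c - 1"
  shows "row (st a b c d) = st 1 (b') 1 (d')"
  by (rule row_stI; use assms in \<open>simp add: valid_def\<close>; arith?)

lemma row_no_top:
  assumes "1 \<le> a" "a \<le> b" "b < n" "a' = a + 1" "b' = b + 1"
  shows "row (st a b 1 0) = st (a') (b') 1 a"
  by (rule row_stI; use assms in \<open>simp add: valid_def\<close>; arith?)

lemma row_no_top_end:
  assumes "1 \<le> a" "a \<le> n" "b = n" "c' = 1" "d' = a"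
  shows "row (st a b 1 0) = st 1 0 c' d'"
  by (rule row_stI; use assms in \<open>simp add: valid_def\<close>; arith?)

lemma row_no_bottom:
  assumes "1 \<le> c" "c \<le> d" "d < n" "a' = c + 1" "c' = c + 1" "d' = d + 1"
  shows "row (st 1 0 c d) = st (a') n (c') (d')"
  by (rule row_stI; use assms in \<open>simp add: valid_def\<close>; arith?)

lemma row_no_bottom_end:
  assumes "1 \<le> c" "c \<le> d" "d = n" "d' = c - 1"
  shows "row (st 1 0 c d) = st 1 n 1 (d')"
  by (rule row_stI; use assms in \<open>simp add: valid_def\<close>; arith?)

lemma row_empty: "1 \<le> n \<Longrightarrow> row (st 1 0 1 0) = st 1 n 1 n"
  by (rule row_stI; simp add: valid_def; arith?)

lemma row_full: "1 \<le> n \<Longrightarrow> row (st 1 n 1 n) = st 1 0 1 0"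
  by (rule row_stI; simp add: valid_def; arith?)

section \<open>Returns to the special states\<close>

definition steps :: "nat \<Rightarrow> (nat \<times> nat) set \<Rightarrow> (nat \<times> nat) set \<Rightarrow> bool" where
  "steps k I J \<longleftrightarrow> (row ^^ k) I = J"

lemma steps_0: "steps 0 I I"
  by (simp add: steps_def)

lemma steps_trans [trans]: "steps k I J \<Longrightarrow> steps l J K \<Longrightarrow> steps (k + l) I K"
  by (simp add: steps_def add.commute[of k] funpow_add)

lemma steps_1: "row I = J \<Longrightarrow> steps 1 I J"
  by (simp add: steps_def)

lemma steps_cong: "steps k I J \<Longrightarrow> k = l \<Longrightarrow> steps l I J"
  by simp

lemma steps_shift:
  assumes "1 \<le> c" "c \<le> d" "c < a" "a \<le> b" "d < b" "b' \<le> n"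
    and "a' = a + k" "b' = b + k" "c' = c + k" "d' = d + k"
  shows "steps k (st a b c d) (st a' b' c' d')"
  using assms(6-)
proof (induction k arbitrary: a' b' c' d')
  case 0
  then show ?case by (simp add: steps_0)
next
  case (Suc k)
  have "steps k (st a b c d) (st (a + k) (b + k) (c + k) (d + k))"
    using Suc.prems by (intro Suc.IH) auto
  moreover have "row (st (a + k) (b + k) (c + k) (d + k)) = st a' b' c' d'"
    using Suc.prems assms(1-5) by (intro row_shift) auto
  ultimately show ?case by (simp add: steps_def)
qed

text \<open>The gaps \<open>p, q, r\<close> determine the fourth one, \<open>s = n - (p + q + r + 1)\<close>, the distance from \<open>b\<close> to \<open>n\<close>.\<close>

definition gap_state :: "nat \<Rightarrow> nat \<Rightarrow> nat \<Rightarrow> (nat \<times> nat) set" where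
  "gap_state p q r = st (p + q + 1) (p + q + r + 1) 1 (p + 1)"

definition pair_state :: "nat \<Rightarrow> (nat \<times> nat) set" where
  "pair_state x = st 2 (x + 1) 1 x"

definition top_state :: "nat \<Rightarrow> nat \<Rightarrow> (nat \<times> nat) set" where
  "top_state c k = st 1 0 c (c + k)"

text \<open>With the second gap lowered by 4, the return map on the four gaps is
  \<open>(p, q, r, s)\<close> to \<open>(r, s, p, q)\<close>, an involution. The two halves take r +
  s + 4 and p + q + 4 steps, together n + 3.\<close>

lemma gap_big:
  assumes "n = p + q + r + s + 5"
  shows "steps (r + s + 4) (gap_state p (q + 4) r) (gap_state r (s + 4) p)"
proof -
  have "steps s (gap_state p (q + 4) r) (st (p + q + s + 5) n (s + 1) (p + s + 1))"
    unfolding gap_state_def by (rule steps_shift) (use assms  in auto)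
  also have "steps 1 \<dots> (st (s + 2) (p + q + s + 4) (s + 2) (p + s + 2))"
    by (rule steps_1, rule row_end_gap) (use assms  in auto)
  also have "steps 1 \<dots> (st (s + 3) (p + q + s + 5) 1 (p + s + 3))"
    by (rule steps_1, rule row_top_full_left) (use assms  in auto)
  also have "steps r \<dots> (st (r + s + 3) n (r + 1) (p + r + s + 3))"
    by (rule steps_shift) (use assms  in auto)
  also have "steps 1 \<dots> (st (r + s + 4) (p + r + s + 4) (r + 2) (p + r + s + 4))"
    by (rule steps_1, rule row_end_overlap) (use assms  in auto)
  also have "steps 1 \<dots> (gap_state r (s + 4) p)"
    unfolding gap_state_def by (rule steps_1, rule row_top_flush_right) (use assms  in auto)
  finally show ?thesis by (rule steps_cong) (use assms  in auto)
qed

text \<open>This is the previous pattern with q = -1: the image would have fourth gap -1. Instead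
  both rows reach \<open>n\<close> together, the set becomes its complement, and the second half of
  the run leads straight back, so the orbit gets a single representative.\<close>

lemma gap_three:
  assumes "n = p + r + s + 4"
  shows "steps (n + 3) (gap_state p 3 r) (gap_state p 3 r)"
proof -
  have "steps s (gap_state p 3 r) (st (p + s + 4) n (s + 1) (p + s + 1))"
    unfolding gap_state_def by (rule steps_shift) (use assms  in auto)
  also have "steps 1 \<dots> (st (s + 2) (p + s + 3) (s + 2) (p + s + 2))"
    by (rule steps_1, rule row_end_gap) (use assms  in auto)
  also have "steps 1 \<dots> (st (s + 3) (p + s + 4) 1 (p + s + 3))"
    by (rule steps_1, rule row_top_full_left) (use assms  in auto)
  also have "steps r \<dots> (st (r + s + 3) n (r + 1) (p + r + s + 3))"
    by (rule steps_shift) (use assms  in auto)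
  also have "steps 1 \<dots> (st (r + s + 4) n (r + 2) n)"
    by (rule steps_1, rule row_end_overlap) (use assms  in auto)
  also have "steps 1 \<dots> (st 1 (r + s + 3) 1 (r + 1))"
    by (rule steps_1, rule row_end_full) (use assms  in auto)
  also have "steps 1 \<dots> (st 2 (r + s + 4) 1 (r + 2))"
    by (rule steps_1, rule row_top_full_left) (use assms  in auto)
  also have "steps p \<dots> (st (p + 2) n (p + 1) (p + r + 2))"
    by (rule steps_shift) (use assms  in auto)
  also have "steps 1 \<dots> (st (p + 3) (p + r + 3) (p + 2) (p + r + 3))"
    by (rule steps_1, rule row_end_overlap) (use assms  in auto)
  also have "steps 1 \<dots> (gap_state p 3 r)"
    unfolding gap_state_def by (rule steps_1, rule row_top_flush_right) (use assms  in auto)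
  finally show ?thesis by (rule steps_cong) (use assms  in auto)
qed

text \<open>The gap 2 persists and the other three are rotated, \<open>(p, r, s)\<close> to
  \<open>(s, p, r)\<close>. Three rotations take (s + 2) + (r + 2) + (p + 2) = n + 3 steps.\<close>

lemma gap_two:
  assumes "n = p + r + s + 3"
  shows "steps (s + 2) (gap_state p 2 r) (gap_state s 2 p)"
proof -
  have "steps s (gap_state p 2 r) (st (p + s + 3) n (s + 1) (p + s + 1))"
    unfolding gap_state_def by (rule steps_shift) (use assms  in auto)
  also have "steps 1 \<dots> (st (s + 2) (p + s + 2) (s + 2) (p + s + 2))"
    by (rule steps_1, rule row_end_gap) (use assms  in auto)
  also have "steps 1 \<dots> (gap_state s 2 p)"
    unfolding gap_state_def by (rule steps_1, rule row_top_flush_right) (use assms  in auto)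
  finally show ?thesis by (rule steps_cong) (use assms  in auto)
qed

text \<open>The involution \<open>x\<close> to \<open>n + 1 - x\<close>. Its two halves take y + 1
  and x + 1 steps, again n + 3 in all.\<close>

lemma pair_step:
  assumes "n + 1 = x + y" "2 \<le> x" "2 \<le> y"
  shows "steps (y + 1) (pair_state x) (pair_state y)"
proof -
  have "steps (y - 2) (pair_state x) (st y n (y - 1) (n - 1))"
    unfolding pair_state_def by (rule steps_shift) (use assms  in auto)
  also have "steps 1 \<dots> (st (y + 1) n y n)"
    by (rule steps_1, rule row_end_overlap) (use assms  in auto)
  also have "steps 1 \<dots> (st 1 y 1 (y - 1))"
    by (rule steps_1, rule row_end_full) (use assms  in auto)
  also have "steps 1 \<dots> (pair_state y)"
    unfolding pair_state_def by (rule steps_1, rule row_top_full_left) (use assms  in auto)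
  finally show ?thesis by (rule steps_cong) (use assms  in auto)
qed

text \<open>On the triples \<open>(c + 2, k, n - c - k)\<close>, which have sum \<open>n + 2\<close>, this is the rotation
  \<open>(x, y, z) \<mapsto> (z, x, y)\<close>; it is available for \<open>z \<ge> 3\<close>.\<close>

lemma top_rotate:
  assumes "n = c + k + g + 3" "1 \<le> c"
  shows "steps (g + 4) (top_state c k) (top_state (g + 1) (c + 2))"
\<comment> \<open>For \<open>g = 0\<close> the bottom row already ends at \<open>n\<close> when the
  top row is empty, so it vanishes at once and there is no phase of shifting.\<close>
proof (cases "g = 0")
  case True
  have "steps 1 (top_state c k) (st (c + 1) n (c + 1) (c + k + 1))"
    unfolding top_state_def by (rule steps_1, rule row_no_bottom) (use assms True in auto)
  also have "steps 1 \<dots> (st (c + 2) (c + k + 2) 1 (c + k + 2))"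
    by (rule steps_1, rule row_end_left) (use assms True in auto)
  also have "steps 1 \<dots> (st (c + 3) (c + k + 3) 1 0)"
    by (rule steps_1, rule row_top_flush_right) (use assms True in auto)
  also have "steps 1 \<dots> (top_state (g + 1) (c + 2))"
    unfolding top_state_def by (rule steps_1, rule row_no_top_end) (use assms True in auto)
  finally show ?thesis by (rule steps_cong) (use assms True in auto)
next
  case False
  have "steps 1 (top_state c k) (st (c + 1) n (c + 1) (c + k + 1))"
    unfolding top_state_def by (rule steps_1, rule row_no_bottom) (use assms False in auto)
  also have "steps 1 \<dots> (st (c + 2) (c + k + 2) 1 (c + k + 2))"
    by (rule steps_1, rule row_end_left) (use assms False in auto)
  also have "steps 1 \<dots> (st (c + 3) (c + k + 3) 1 0)"
    by (rule steps_1, rule row_top_flush_right) (use assms False in auto)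
  also have "steps 1 \<dots> (st (c + 4) (c + k + 4) 1 (c + 3))"
    by (rule steps_1, rule row_no_top) (use assms False in auto)
  also have "steps (g - 1) \<dots> (st (c + g + 3) n g (c + g + 2))"
    by (rule steps_shift) (use assms False in auto)
  also have "steps 1 \<dots> (top_state (g + 1) (c + 2))"
    unfolding top_state_def by (rule steps_1, rule row_end_adjacent) (use assms False in auto)
  finally show ?thesis by (rule steps_cong) (use assms False in auto)
qed

text \<open>If the last gap \<open>j\<close> is at most 2, the rotation is replaced by an end step:
  in k + j + 3 steps the triple \<open>(c + 2, k, j)\<close> becomes
  \<open>(k + j + 2, 2 - j, c + j - 2)\<close>. The middle gap is then small again, and the values 0
  and 2 of \<open>j\<close> are exchanged. Here j = 2; the next two lemmas treat j = 1 and j =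
  0.\<close>

lemma top_end_2:
  assumes "n = c + k + 2" "1 \<le> c"
  shows "steps (k + 5) (top_state c k) (top_state (k + 2) 0)"
proof -
  have "steps 1 (top_state c k) (st (c + 1) n (c + 1) (c + k + 1))"
    unfolding top_state_def by (rule steps_1, rule row_no_bottom) (use assms  in auto)
  also have "steps 1 \<dots> (st (c + 2) n 1 n)"
    by (rule steps_1, rule row_end_left) (use assms  in auto)
  also have "steps 1 \<dots> (st 1 (c + 1) 1 0)"
    by (rule steps_1, rule row_end_full) (use assms  in auto)
  also have "steps 1 \<dots> (st 2 (c + 2) 1 1)"
    by (rule steps_1, rule row_no_top) (use assms  in auto)
  also have "steps k \<dots> (st (k + 2) n (k + 1) (k + 1))"
    by (rule steps_shift) (use assms  in auto)
  also have "steps 1 \<dots> (top_state (k + 2) 0)"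
    unfolding top_state_def by (rule steps_1, rule row_end_adjacent) (use assms  in auto)
  finally show ?thesis by (rule steps_cong) (use assms  in auto)
qed

lemma top_end_1:
  assumes "n = c + k + 1" "1 \<le> c"
  shows "steps (k + 4) (top_state c k) (top_state (k + 1) 1)"
proof (cases "k = 0")
  case True
  have "steps 1 (top_state c k) (st (c + 1) n (c + 1) n)"
    unfolding top_state_def by (rule steps_1, rule row_no_bottom) (use assms True in auto)
  also have "steps 1 \<dots> (st 1 c 1 c)"
    by (rule steps_1, rule row_end_full) (use assms True in auto)
  also have "steps 1 \<dots> (st 2 (c + 1) 1 0)"
    by (rule steps_1, rule row_top_flush_right) (use assms True in auto)
  also have "steps 1 \<dots> (top_state (k + 1) 1)"
    unfolding top_state_def by (rule steps_1, rule row_no_top_end) (use assms True in auto)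
  finally show ?thesis by (rule steps_cong) (use assms True in auto)
next
  case False
  have "steps 1 (top_state c k) (st (c + 1) n (c + 1) n)"
    unfolding top_state_def by (rule steps_1, rule row_no_bottom) (use assms False in auto)
  also have "steps 1 \<dots> (st 1 c 1 c)"
    by (rule steps_1, rule row_end_full) (use assms False in auto)
  also have "steps 1 \<dots> (st 2 (c + 1) 1 0)"
    by (rule steps_1, rule row_top_flush_right) (use assms False in auto)
  also have "steps 1 \<dots> (st 3 (c + 2) 1 2)"
    by (rule steps_1, rule row_no_top) (use assms False in auto)
  also have "steps (k - 1) \<dots> (st (k + 2) n k (k + 1))"
    by (rule steps_shift) (use assms False in auto)
  also have "steps 1 \<dots> (top_state (k + 1) 1)"
    unfolding top_state_def by (rule steps_1, rule row_end_adjacent) (use assms False in auto)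
  finally show ?thesis by (rule steps_cong) (use assms False in auto)
qed

lemma top_end_0:
  assumes "n = c + k" "2 \<le> c" "1 \<le> k"
  shows "steps (k + 3) (top_state c k) (top_state k 2)"
proof (cases "k = 1")
  case True
  have "steps 1 (top_state c k) (st 1 n 1 (c - 1))"
    unfolding top_state_def by (rule steps_1, rule row_no_bottom_end) (use assms True in auto)
  also have "steps 1 \<dots> (st 2 c 1 c)"
    by (rule steps_1, rule row_end_left) (use assms True in auto)
  also have "steps 1 \<dots> (st 3 (c + 1) 1 0)"
    by (rule steps_1, rule row_top_flush_right) (use assms True in auto)
  also have "steps 1 \<dots> (top_state k 2)"
    unfolding top_state_def by (rule steps_1, rule row_no_top_end) (use assms True in auto)
  finally show ?thesis by (rule steps_cong) (use assms True in auto)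
next
  case False
  have "steps 1 (top_state c k) (st 1 n 1 (c - 1))"
    unfolding top_state_def by (rule steps_1, rule row_no_bottom_end) (use assms False in auto)
  also have "steps 1 \<dots> (st 2 c 1 c)"
    by (rule steps_1, rule row_end_left) (use assms False in auto)
  also have "steps 1 \<dots> (st 3 (c + 1) 1 0)"
    by (rule steps_1, rule row_top_flush_right) (use assms False in auto)
  also have "steps 1 \<dots> (st 4 (c + 2) 1 3)"
    by (rule steps_1, rule row_no_top) (use assms False in auto)
  also have "steps (k - 2) \<dots> (st (k + 2) n (k - 1) (k + 1))"
    by (rule steps_shift) (use assms False in auto)
  also have "steps 1 \<dots> (top_state k 2)"
    unfolding top_state_def by (rule steps_1, rule row_end_adjacent) (use assms False in auto)
  finally show ?thesis by (rule steps_cong) (use assms False in auto)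
qed

text \<open>The triple \<open>(n + 2, 0, 0)\<close>, to which the end step for last gap 0 does not
  apply. Its orbit is of linear size although its gaps are small, so it is kept apart from
  \<open>tops_narrow\<close>.\<close>

lemma top_fixed:
  assumes "2 \<le> n"
  shows "steps (n + 3) (top_state n 0) (top_state n 0)"
proof -
  have "steps 1 (top_state n 0) (st 1 n 1 (n - 1))"
    unfolding top_state_def by (rule steps_1, rule row_no_bottom_end) (use assms  in auto)
  also have "steps 1 \<dots> (st 2 n 1 n)"
    by (rule steps_1, rule row_end_left) (use assms  in auto)
  also have "steps 1 \<dots> (st 1 1 1 0)"
    by (rule steps_1, rule row_end_full) (use assms  in auto)
  also have "steps 1 \<dots> (st 2 2 1 1)"
    by (rule steps_1, rule row_no_top) (use assms  in auto)
  also have "steps (n - 2) \<dots> (st n n (n - 1) (n - 1))"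
    by (rule steps_shift) (use assms  in auto)
  also have "steps 1 \<dots> (top_state n 0)"
    unfolding top_state_def by (rule steps_1, rule row_end_adjacent) (use assms  in auto)
  finally show ?thesis by (rule steps_cong) (use assms  in auto)
qed

text \<open>The triple \<open>(3, n - 1, 0)\<close>: an end step would produce the gap -1. The full
  top row instead turns into the full bottom row and then into a single top element.\<close>

lemma top_full_row:
  assumes "2 \<le> n"
  shows "steps 2 (top_state 1 (n - 1)) (top_state 1 0)"
proof -
  have "steps 1 (top_state 1 (n - 1)) (st 1 n 1 0)"
    unfolding top_state_def by (rule steps_1, rule row_no_bottom_end) (use assms  in auto)
  also have "steps 1 \<dots> (top_state 1 0)"
    unfolding top_state_def by (rule steps_1, rule row_no_top_end) (use assms  in auto)
  finally show ?thesis by (rule steps_cong) (use assms  in auto)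
qed

end

section \<open>Every orbit meets a special state\<close>

lemma convex_nat_interval:
  fixes S :: "nat set"
  assumes sub: "S \<subseteq> {1..n}" and conv: "\<And>i j k. i \<in> S \<Longrightarrow> k \<in> S \<Longrightarrow> i \<le> j \<Longrightarrow> j \<le> k \<Longrightarrow> j \<in> S"
  obtains a b where "S = {a..b}" "(a = 1 \<and> b = 0) \<or> (1 \<le> a \<and> a \<le> b \<and> b \<le> n)"
proof (cases "S = {}")
  case True
  then show ?thesis using that[of 1 0] by simp
next
  case False
  have fin: "finite S" using sub finite_subset by blast
  have mm: "Min S \<in> S" "Max S \<in> S" using fin False by simp_all
  have "S = {Min S..Max S}"
  proof
    show "S \<subseteq> {Min S..Max S}" using fin by auto
    show "{Min S..Max S} \<subseteq> S" using conv[OF mm] by (meson atLeastAtMost_iff subsetI)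
  qed
  moreover have "1 \<le> Min S" "Max S \<le> n" using mm sub by (meson atLeastAtMost_iff subsetD)+
  moreover have "Min S \<le> Max S" using mm fin by simp
  ultimately show ?thesis using that[of "Min S" "Max S"] by blast
qed

lemma ICS_cases:
  assumes I: "I \<in> ICS (two_by n)"
  obtains (both) a b c d where "I = st a b c d" "1 \<le> c" "c \<le> a" "a \<le> b" "c \<le> d" "d \<le> b" "b \<le> n"
  | (no_bottom) c d where "I = st 1 0 c d" "1 \<le> c" "c \<le> d" "d \<le> n"
  | (no_top) a b where "I = st a b 1 0" "1 \<le> a" "a \<le> b" "b \<le> n"
  | (empty) "I = st 1 0 1 0"
proof -
  have sub: "I \<subseteq> two_by n" using I by (simp add: ICS_def)
  have row: "\<exists>a b. {j. (i, j) \<in> I} = {a..b} \<and> ((a = 1 \<and> b = 0) \<or> (1 \<le> a \<and> a \<le> b \<and> b \<le> n))" for i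
  proof -
    have 1: "{j. (i, j) \<in> I} \<subseteq> {1..n}" using sub by (auto simp: mem_two_by)
    have 2: "j \<in> {j. (i, j) \<in> I}" if "k \<in> {j. (i, j) \<in> I}" "l \<in> {j. (i, j) \<in> I}" "k \<le> j" "j \<le> l" for j k l
    proof -
      have "(i, j) \<in> two_by n"
        using that sub mem_two_by[of i k n] mem_two_by[of i l n] mem_two_by[of i j n] by auto
      then show ?thesis using that ICS_D[OF I, of "(i, k)" "(i, l)" "(i, j)"] by simp
    qed
    show ?thesis by (rule convex_nat_interval[OF 1 2]) blast+
  qed
  obtain a b where ab: "{j. (1, j) \<in> I} = {a..b}" "(a = 1 \<and> b = 0) \<or> (1 \<le> a \<and> a \<le> b \<and> b \<le> n)"
    using row by blast
  obtain c d where cd: "{j. (2, j) \<in> I} = {c..d}" "(c = 1 \<and> d = 0) \<or> (1 \<le> c \<and> c \<le> d \<and> d \<le> n)"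
    using row by blast
  have "x \<in> I \<longleftrightarrow> x \<in> st a b c d" for x
  proof (cases x)
    case (Pair i j)
    have "(1, j) \<in> I \<longleftrightarrow> a \<le> j \<and> j \<le> b" "(2, j) \<in> I \<longleftrightarrow> c \<le> j \<and> j \<le> d"
      using ab(1) cd(1) by auto
    moreover have "(i, j) \<in> I \<Longrightarrow> i = 1 \<or> i = 2" using sub by (auto simp: mem_two_by)
    ultimately show ?thesis by (auto simp: Pair mem_st)
  qed
  then have eq: "I = st a b c d" by blast
  show ?thesis
  proof (cases "a \<le> b \<and> c \<le> d")
    case True
    then have *: "1 \<le> a" "a \<le> b" "b \<le> n" "1 \<le> c" "c \<le> d" "d \<le> n" using ab cd by auto
    have mem: "(1, a) \<in> I" "(2, d) \<in> I" using * by (auto simp: eq mem_st)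
    \<comment> \<open>If the rows share columns, \<open>(2, a)\<close> and \<open>(1, d)\<close> lie
      between \<open>(1, a)\<close> and \<open>(2, d)\<close>. If not, d < a already gives both
      inequalities.\<close>
    have "c \<le> a \<and> d \<le> b"
    proof (cases "a \<le> d")
      case True
      have "(2, a) \<in> I" by (rule ICS_D[OF I mem]) (use * True in \<open>auto simp: mem_two_by\<close>)
      moreover have "(1, d) \<in> I" by (rule ICS_D[OF I mem]) (use * True in \<open>auto simp: mem_two_by\<close>)
      ultimately show ?thesis by (auto simp: eq mem_st)
    qed (use * in auto)
    then show ?thesis using both[OF eq] * by blast
  next
    case False
    then consider "a = 1 \<and> b = 0 \<and> c = 1 \<and> d = 0" | "a = 1 \<and> b = 0 \<and> 1 \<le> c \<and> c \<le> d \<and> d \<le> n"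
      | "c = 1 \<and> d = 0 \<and> 1 \<le> a \<and> a \<le> b \<and> b \<le> n"
      using ab(2) cd(2) by force
    then show ?thesis
    proof cases
      case 1
      then show ?thesis using eq by (intro empty) simp
    next
      case 2
      then show ?thesis using eq by (intro no_bottom[of c d]) simp_all
    next
      case 3
      then show ?thesis using eq by (intro no_top[of a b]) simp_all
    qed
  qed
qed

section \<open>The number of interval-closed sets\<close>

lemma sum_squares: "6 * (\<Sum>c = 1..b. (b + 1 - c)\<^sup>2) = b * (b + 1) * (2 * b + 1)" for b :: nat
proof -
  have "(\<Sum>c = 1..b. (b + 1 - c)\<^sup>2) = (\<Sum>i = 1..b. i\<^sup>2)"
    by (rule sum.reindex_bij_witness[where i = "\<lambda>i. b + 1 - i" and j = "\<lambda>i. b + 1 - i"]) auto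
  also have "6 * \<dots> = b * (b + 1) * (2 * b + 1)"
    by (induction b) (auto simp: algebra_simps power2_eq_square)
  finally show ?thesis .
qed

lemma st_eq_iff:
  "st a b c d = st a' b' c' d' \<longleftrightarrow>
     (a = a' \<and> b = b' \<or> b < a \<and> b' < a') \<and> (c = c' \<and> d = d' \<or> d < c \<and> d' < c')"
proof -
  have 1: "{j. (1, j) \<in> st a b c d} = {a..b}" and 2: "{j. (2, j) \<in> st a b c d} = {c..d}" for a b c d
    by (auto simp: mem_st)
  have "st a b c d = st a' b' c' d' \<longleftrightarrow> {a..b} = {a'..b'} \<and> {c..d} = {c'..d'}"
  proof
    assume eq: "st a b c d = st a' b' c' d'"
    show "{a..b} = {a'..b'} \<and> {c..d} = {c'..d'}"
      using 1[of a b c d, unfolded eq 1] 2[of a b c d, unfolded eq 2] by blast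
  qed (simp only: st_def)
  then show ?thesis by (auto simp: Icc_eq_Icc)
qed

text \<open>Once \<open>b\<close> and \<open>c\<close> are fixed, the ends \<open>a\<close> and
  \<open>d\<close> range independently over \<open>{c..b}\<close>; this gives a sum of squares. The
  factor 12 clears all denominators.\<close>

lemma card_ICS: "12 * card (ICS (two_by n)) = n * (n + 1)\<^sup>2 * (n + 2) + 12 * n * (n + 1) + 12"
proof -
  define A where "A = (SIGMA b:{1..n}. SIGMA c:{1..b}. {c..b} \<times> {c..b})"
  define B where "B = (SIGMA b:{1..n}. {1..b})"
  define f where "f = (\<lambda>(b, c, a, d). st a b c d)"
  define g where "g = (\<lambda>(b, a). st a b 1 0)"
  define h where "h = (\<lambda>(d, c). st 1 0 c d)"
  have eq: "ICS (two_by n) = f ` A \<union> g ` B \<union> h ` B \<union> {st 1 0 1 0}" (is "_ = ?R")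
  proof
    show "ICS (two_by n) \<subseteq> ?R"
    proof
      fix I assume "I \<in> ICS (two_by n)"
      then show "I \<in> ?R"
      proof (cases rule: ICS_cases)
        case (both a b c d)
        then have "I = f (b, c, a, d)" "(b, c, a, d) \<in> A" by (auto simp: f_def A_def)
        then show ?thesis by blast
      next
        case (no_bottom c d)
        then have "I = h (d, c)" "(d, c) \<in> B" by (auto simp: h_def B_def)
        then show ?thesis by blast
      next
        case (no_top a b)
        then have "I = g (b, a)" "(b, a) \<in> B" by (auto simp: g_def B_def)
        then show ?thesis by blast
      qed auto
    qed
    show "?R \<subseteq> ICS (two_by n)"
      by (auto simp: f_def g_def h_def A_def B_def valid_def intro!: st_ICS)
  qed
  have disj: "f ` A \<inter> g ` B = {}" "(f ` A \<union> g ` B) \<inter> h ` B = {}" "(f ` A \<union> g ` B \<union> h ` B) \<inter> {st 1 0 1 0} = {}"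
    by (auto simp: f_def g_def h_def A_def B_def st_eq_iff)
  have injs: "inj_on f A" "inj_on g B" "inj_on h B"
    by (rule inj_onI; force simp: f_def g_def h_def A_def B_def st_eq_iff)+
  have fin: "finite A" "finite B" by (auto simp: A_def B_def)
  have "card (ICS (two_by n)) = card A + 2 * card B + 1"
    unfolding eq using disj fin
    by (simp add: card_Un_disjoint card_image injs del: Un_insert_right)
  moreover have "12 * card A = n * (n + 1)\<^sup>2 * (n + 2)"
  proof -
    have "card A = (\<Sum>b = 1..n. \<Sum>c = 1..b. (b + 1 - c)\<^sup>2)"
      by (simp add: A_def power2_eq_square)
    also have "12 * \<dots> = (\<Sum>b = 1..n. 2 * (6 * (\<Sum>c = 1..b. (b + 1 - c)\<^sup>2)))"
      by (simp add: sum_distrib_left)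
    also have "\<dots> = (\<Sum>b = 1..n. 2 * (b * (b + 1) * (2 * b + 1)))"
      by (simp only: sum_squares)
    also have "\<dots> = n * (n + 1)\<^sup>2 * (n + 2)"
      by (induction n) (auto simp: algebra_simps power2_eq_square)
    finally show ?thesis .
  qed
  moreover have "2 * card B = n * (n + 1)"
    unfolding B_def by (induction n) (auto simp: algebra_simps)
  ultimately show ?thesis by (simp add: algebra_simps)
qed

section \<open>Flow of an arbitrary state into the base states\<close>

context two_rows
begin

text \<open>Gap states with q = 1 are absent: their bottom row vanishes on reaching
  \<open>n\<close>, so their orbits are represented by top states. The pair states serve the orbits
  with overlapping rows that meet neither kind.\<close>

definition base_states :: "(nat \<times> nat) set set" where
  "base_states = {gap_state p q r | p q r. 2 \<le> q \<and> p + q + r < n} \<union> {pair_state x | x. 2 \<le> x \<and> x < n} \<union>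
     {top_state c k | c k. 1 \<le> c \<and> c + k \<le> n} \<union> {st 1 0 1 0}"

definition reaches :: "(nat \<times> nat) set \<Rightarrow> (nat \<times> nat) set set \<Rightarrow> bool" where
  "reaches I S \<longleftrightarrow> (\<exists>k. (row ^^ k) I \<in> S)"

lemma reaches_self: "I \<in> S \<Longrightarrow> reaches I S"
  unfolding reaches_def by (rule exI[of _ 0]) simp

lemma reaches_row: "row I = J \<Longrightarrow> reaches J S \<Longrightarrow> reaches I S"
  unfolding reaches_def by (metis comp_apply funpow_Suc_right)

lemma reaches_steps: "steps k I J \<Longrightarrow> reaches J S \<Longrightarrow> reaches I S"
  unfolding reaches_def steps_def by (metis comp_apply funpow_add)

lemma reaches_top: "1 \<le> c \<Longrightarrow> c \<le> d \<Longrightarrow> d \<le> n \<Longrightarrow> reaches (st 1 0 c d) base_states"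
proof (rule reaches_self)
  assume "1 \<le> c" "c \<le> d" "d \<le> n"
  then have "st 1 0 c d = top_state c (d - c)" "1 \<le> c \<and> c + (d - c) \<le> n"
    by (simp_all add: top_state_def)
  then show "st 1 0 c d \<in> base_states" unfolding base_states_def by blast
qed

lemma reaches_gap_left:
  assumes "1 \<le> d" "d + 2 \<le> a" "a \<le> b" "b \<le> n"
  shows "reaches (st a b 1 d) base_states"
proof -
  have "st a b 1 d = gap_state (d - 1) (a - d) (b - a)"
    using assms by (simp add: gap_state_def)
  moreover have "2 \<le> a - d \<and> d - 1 + (a - d) + (b - a) < n" using assms by auto
  ultimately have "st a b 1 d \<in> base_states" unfolding base_states_def by blast
  then show ?thesis by (rule reaches_self)
qed

lemma reaches_adjacent:
  assumes "1 \<le> c" "c \<le> d" "d < b" "b \<le> n"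
  shows "reaches (st (d + 1) b c d) base_states"
proof -
  have "steps (n - b) (st (d + 1) b c d) (st (d + 1 + (n - b)) n (c + (n - b)) (d + (n - b)))"
    by (rule steps_shift) (use assms in auto)
  moreover have "row (st (d + 1 + (n - b)) n (c + (n - b)) (d + (n - b))) = st 1 0 (c + (n - b) + 1) (d + (n - b) + 1)"
    by (rule row_end_adjacent) (use assms in auto)
  moreover have "reaches (st 1 0 (c + (n - b) + 1) (d + (n - b) + 1)) base_states"
    by (rule reaches_top) (use assms in auto)
  ultimately show ?thesis by (elim reaches_steps reaches_row)
qed

text \<open>For d < n - 1 the top row restarts at column 1, clear of the bottom row, after two
  steps. For d = n - 1 the set passes through a filter and its complement; then it is a pair state
  if a = c + 1, and otherwise the next arrival at \<open>n\<close> falls under the first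
  case.\<close>

lemma reaches_overlap_end:
  assumes "1 \<le> c" "c < a" "a \<le> d" "d < n"
  shows "reaches (st a n c d) base_states"
proof -
  have small: "reaches (st a n c d) base_states" if "1 \<le> c" "c < a" "a \<le> d" "d + 1 < n" for a c d
  proof -
    have "row (st a n c d) = st (a + 1) (d + 1) (c + 1) (d + 1)"
      by (rule row_end_overlap) (use that in auto)
    moreover have "row (st (a + 1) (d + 1) (c + 1) (d + 1)) = st (a + 2) (d + 2) 1 c"
      by (rule row_top_flush_right) (use that in auto)
    moreover have "reaches (st (a + 2) (d + 2) 1 c) base_states"
      by (rule reaches_gap_left) (use that in auto)
    ultimately show ?thesis by (elim reaches_row)
  qed
  show ?thesis
  proof (cases "d + 1 < n")
    case True
    then show ?thesis using small assms by blast
  next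
    case False
    have "row (st a n c d) = st (a + 1) n (c + 1) n"
      by (rule row_end_overlap) (use assms False in auto)
    moreover have "row (st (a + 1) n (c + 1) n) = st 1 a 1 c"
      by (rule row_end_full) (use assms False in auto)
    moreover have "row (st 1 a 1 c) = st 2 (a + 1) 1 (c + 1)"
      by (rule row_top_full_left) (use assms False in auto)
    moreover have "reaches (st 2 (a + 1) 1 (c + 1)) base_states"
    proof (cases "c + 1 = a")
      case True
      have "pair_state a \<in> base_states" unfolding base_states_def using assms by auto
      then show ?thesis using True by (simp add: reaches_self pair_state_def)
    next
      case c: False
      have "steps (n - a - 1) (st 2 (a + 1) 1 (c + 1)) (st (n - a + 1) n (n - a) (n - a + c))"
        by (rule steps_shift) (use assms False c in auto)
      moreover have "reaches (st (n - a + 1) n (n - a) (n - a + c)) base_states"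
        by (rule small) (use assms False c in auto)
      ultimately show ?thesis by (rule reaches_steps)
    qed
    ultimately show ?thesis by (elim reaches_row)
  qed
qed

lemma reaches_overlap:
  assumes "1 \<le> c" "c < a" "a \<le> d" "d < b" "b \<le> n"
  shows "reaches (st a b c d) base_states"
proof -
  have "steps (n - b) (st a b c d) (st (a + (n - b)) n (c + (n - b)) (d + (n - b)))"
    by (rule steps_shift) (use assms in auto)
  moreover have "reaches (st (a + (n - b)) n (c + (n - b)) (d + (n - b))) base_states"
    by (rule reaches_overlap_end) (use assms in auto)
  ultimately show ?thesis by (rule reaches_steps)
qed

text \<open>The distance from \<open>d\<close> to \<open>a\<close> decides what happens at
  \<open>n\<close>: distance 1 empties the bottom row, distance 2 makes both rows end in the same
  column, and a larger distance leads to overlapping rows.\<close>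

lemma reaches_gap:
  assumes "1 \<le> c" "c \<le> d" "d < a" "a \<le> b" "b \<le> n"
  shows "reaches (st a b c d) base_states"
proof (cases "a = d + 1")
  case True
  then show ?thesis using reaches_adjacent[of c d b] assms by simp
next
  case False
  define e where "e = n - b"
  have "steps e (st a b c d) (st (a + e) n (c + e) (d + e))"
    by (rule steps_shift) (use assms e_def in auto)
  moreover have "row (st (a + e) n (c + e) (d + e)) = st (c + e + 1) (a + e - 1) (c + e + 1) (d + e + 1)"
    by (rule row_end_gap) (use assms e_def False in auto)
  moreover have "reaches (st (c + e + 1) (a + e - 1) (c + e + 1) (d + e + 1)) base_states"
  proof (cases "a = d + 2")
    case True
    have "row (st (c + e + 1) (a + e - 1) (c + e + 1) (d + e + 1)) = st (c + e + 2) (a + e) 1 (c + e)"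
      by (rule row_top_flush_right) (use assms e_def True in auto)
    moreover have "reaches (st (c + e + 2) (a + e) 1 (c + e)) base_states"
      by (rule reaches_gap_left) (use assms e_def True in auto)
    ultimately show ?thesis by (rule reaches_row)
  next
    case b: False
    have "row (st (c + e + 1) (a + e - 1) (c + e + 1) (d + e + 1)) = st (c + e + 2) (a + e) 1 (d + e + 2)"
      by (rule row_top_full_left) (use assms e_def b False in auto)
    moreover have "reaches (st (c + e + 2) (a + e) 1 (d + e + 2)) base_states"
      by (rule reaches_overlap) (use assms e_def b False in auto)
    ultimately show ?thesis by (rule reaches_row)
  qed
  ultimately show ?thesis by (elim reaches_steps reaches_row)
qed

lemma reaches_no_top:
  assumes "1 \<le> a" "a \<le> b" "b \<le> n"
  shows "reaches (st a b 1 0) base_states"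
proof (cases "b = n")
  case True
  have "row (st a b 1 0) = st 1 0 1 a" by (rule row_no_top_end) (use assms True in auto)
  moreover have "reaches (st 1 0 1 a) base_states" by (rule reaches_top) (use assms in auto)
  ultimately show ?thesis by (rule reaches_row)
next
  case False
  have "row (st a b 1 0) = st (a + 1) (b + 1) 1 a" by (rule row_no_top) (use assms False in auto)
  moreover have "reaches (st (a + 1) (b + 1) 1 a) base_states"
    by (rule reaches_adjacent) (use assms False in auto)
  ultimately show ?thesis by (rule reaches_row)
qed

text \<open>Below \<open>n\<close>, one step separates the rows. At \<open>n\<close> the set is a
  filter and is replaced by its complement, whose right end a - 1 is below \<open>n\<close>, so that
  no circular appeal arises.\<close>

lemma reaches_flush_right:
  assumes "1 \<le> c" "c \<le> a" "a \<le> b" "b \<le> n"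
  shows "reaches (st a b c b) base_states"
proof -
  have small: "reaches (st a b c b) base_states" if "1 \<le> c" "c \<le> a" "a \<le> b" "b < n" for a b c
  proof -
    have "row (st a b c b) = st (a + 1) (b + 1) 1 (c - 1)"
      by (rule row_top_flush_right) (use that in auto)
    moreover have "reaches (st (a + 1) (b + 1) 1 (c - 1)) base_states"
    proof (cases "c = 1")
      case True
      then show ?thesis using reaches_no_top[of "a + 1" "b + 1"] that by simp
    next
      case False
      show ?thesis by (rule reaches_gap) (use that False in auto)
    qed
    ultimately show ?thesis by (rule reaches_row)
  qed
  show ?thesis
  proof (cases "b < n")
    case True
    then show ?thesis using small assms by blast
  next
    case False
    have "row (st a b c b) = st 1 (a - 1) 1 (c - 1)"
      by (rule row_end_full) (use assms False in auto)
    moreover have "reaches (st 1 (a - 1) 1 (c - 1)) base_states"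
    proof -
      consider "c = 1" "a = 1" | "c = 1" "a > 1" | "c > 1" "c = a" | "c > 1" "c < a"
        using assms by linarith
      then show ?thesis
      proof cases
        case 1
        then show ?thesis by (simp add: base_states_def reaches_self)
      next
        case 2
        then show ?thesis using reaches_no_top[of 1 "a - 1"] assms by simp
      next
        case 3
        then show ?thesis using small[of 1 1 "a - 1"] assms by simp
      next
        case 4
        have "row (st 1 (a - 1) 1 (c - 1)) = st 2 a 1 c"
          by (rule row_top_full_left) (use assms 4 in auto)
        moreover have "reaches (st 2 a 1 c) base_states"
          by (rule reaches_overlap) (use assms 4 in auto)
        ultimately show ?thesis by (rule reaches_row)
      qed
    qed
    ultimately show ?thesis by (rule reaches_row)
  qed
qed

lemma reaches_full_left:
  assumes "1 \<le> a" "a \<le> d" "d < b" "b \<le> n"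
  shows "reaches (st a b a d) base_states"
proof (cases "b = n")
  case True
  have "row (st a b a d) = st (a + 1) (d + 1) 1 (d + 1)"
    by (rule row_end_left) (use assms True in auto)
  moreover have "reaches (st (a + 1) (d + 1) 1 (d + 1)) base_states"
    by (rule reaches_flush_right) (use assms in auto)
  ultimately show ?thesis by (rule reaches_row)
next
  case False
  have "row (st a b a d) = st (a + 1) (b + 1) 1 (d + 1)"
    by (rule row_top_full_left) (use assms False in auto)
  moreover have "reaches (st (a + 1) (b + 1) 1 (d + 1)) base_states"
    by (rule reaches_overlap) (use assms False in auto)
  ultimately show ?thesis by (rule reaches_row)
qed

lemma reaches_base:
  assumes "I \<in> ICS (two_by n)"
  shows "reaches I base_states"
  using assms
proof (cases rule: ICS_cases)
  case (both a b c d)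
  then consider "d < a" | "a \<le> d" "d = b" | "a \<le> d" "d < b" "c = a" | "a \<le> d" "d < b" "c < a"
    by linarith
  then show ?thesis
    using both reaches_gap[of c d a b] reaches_flush_right[of c a b] reaches_full_left[of a d b]
      reaches_overlap[of c a d b] by cases auto
next
  case (no_bottom c d)
  then show ?thesis using reaches_top by simp
next
  case (no_top a b)
  then show ?thesis using reaches_no_top by simp
next
  case empty
  then show ?thesis by (simp add: base_states_def reaches_self)
qed

end

section \<open>Counting orbits through representatives\<close>

lemma orbit_eq_range:
  assumes "0 < p" "(f ^^ p) x = x"
  shows "orbit f x = range (\<lambda>k. (f ^^ k) x)"
proof -
  have "(f ^^ k) x \<in> orbit f x" for k
  proof (cases k)
    case 0
    \<comment> \<open>\<open>orbit\<close> collects only positive iterates, so \<open>x\<close>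
      itself enters through its period.\<close>
    have "(f ^^ p) x \<in> orbit f x" using assms(1) by (auto simp: orbit_altdef)
    then show ?thesis using 0 assms(2) by simp
  next
    case (Suc l)
    then show ?thesis unfolding orbit_altdef by blast
  qed
  then show ?thesis by (auto simp: orbit_altdef)
qed

lemma card_orbit_le:
  assumes "0 < p" "(f ^^ p) x = x"
  shows "card (orbit f x) \<le> p"
proof -
  have "orbit f x \<subseteq> (\<lambda>k. (f ^^ k) x) ` {..<p}"
  proof
    fix y assume "y \<in> orbit f x"
    then obtain k where "y = (f ^^ k) x" by (auto simp: orbit_altdef)
    then have "y = (f ^^ (k mod p)) x" by (simp add: funpow_mod_eq[OF assms(2)])
    then show "y \<in> (\<lambda>k. (f ^^ k) x) ` {..<p}" using assms(1) by auto
  qed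
  then show ?thesis by (metis card_image_le card_lessThan card_mono finite_imageI finite_lessThan le_trans)
qed

locale finite_perm =
  fixes f :: "'a \<Rightarrow> 'a" and A :: "'a set"
  assumes fin: "finite A" and bij: "bij_betw f A A"
begin

lemma funpow_bij: "bij_betw (f ^^ k) A A"
proof (induction k)
  case 0
  then show ?case by (simp add: bij_betw_def)
next
  case (Suc k)
  then show ?case unfolding funpow.simps by (rule bij_betw_trans[OF _ bij])
qed

lemma funpow_in: "x \<in> A \<Longrightarrow> (f ^^ k) x \<in> A"
  using funpow_bij[of k] by (auto simp: bij_betw_def)

lemma periodic:
  assumes "x \<in> A"
  obtains p where "0 < p" "(f ^^ p) x = x"
proof -
  have "(\<lambda>k. (f ^^ k) x) ` UNIV \<subseteq> A" using funpow_in[OF assms] by auto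
  then have "finite ((\<lambda>k. (f ^^ k) x) ` UNIV)" using fin finite_subset by blast
  then have "\<not> inj (\<lambda>k. (f ^^ k) x)" using finite_imageD infinite_UNIV_nat by blast
  then obtain i' j' where "i' \<noteq> j'" "(f ^^ i') x = (f ^^ j') x"
    unfolding inj_def by blast
  then obtain i j where "i < j" and ij: "(f ^^ i) x = (f ^^ j) x"
    by (metis linorder_neqE_nat)
  have "(f ^^ j) x = (f ^^ i) ((f ^^ (j - i)) x)"
    using \<open>i < j\<close> funpow_add[of i "j - i" f] by simp
  with ij have "(f ^^ i) ((f ^^ (j - i)) x) = (f ^^ i) x" by simp
  then have "(f ^^ (j - i)) x = x"
    using inj_onD[OF bij_betw_imp_inj_on[OF funpow_bij[of i]]] assms funpow_in[OF assms, of "j - i"] by blast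
  then show ?thesis using that[of "j - i"] \<open>i < j\<close> by simp
qed

lemma orbit_range: "x \<in> A \<Longrightarrow> orbit f x = range (\<lambda>k. (f ^^ k) x)"
  using periodic[of x] orbit_eq_range[of _ f x] by metis

lemma orbit_self: "x \<in> A \<Longrightarrow> x \<in> orbit f x"
  using orbit_range[of x] by (metis funpow_0 rangeI)

lemma orbit_subset: "x \<in> A \<Longrightarrow> orbit f x \<subseteq> A"
  using orbit_range funpow_in by auto

lemma orbit_eq:
  assumes x: "x \<in> A" and y: "y \<in> orbit f x"
  shows "orbit f y = orbit f x"
proof -
  obtain k where k: "y = (f ^^ k) x" using y orbit_range[OF x] by auto
  obtain p where p: "0 < p" "(f ^^ p) x = x" using periodic[OF x] .
  have yA: "y \<in> A" using y orbit_subset[OF x] by auto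
  \<comment> \<open>From \<open>y\<close>, which is \<open>k\<close> steps ahead of
    \<open>x\<close>, another \<open>p * k - k\<close> steps complete \<open>k\<close> full periods
    and lead back to \<open>x\<close>.\<close>
  have "(f ^^ (p * k)) x = x" using funpow_mod_eq[OF p(2), of "p * k"] by simp
  moreover have "p * k = (p * k - k) + k" using p(1) by (cases p) auto
  ultimately have xy: "x = (f ^^ (p * k - k)) y"
    using funpow_add[of "p * k - k" k f] k by simp
  have "(f ^^ l) y = (f ^^ (l + k)) x" for l by (simp add: k funpow_add)
  then have "(f ^^ l) y \<in> orbit f x" for l using orbit_range[OF x] by simp
  moreover have "(f ^^ l) x = (f ^^ (l + (p * k - k))) y" for l
    using xy by (simp add: funpow_add)
  then have "(f ^^ l) x \<in> orbit f y" for l using orbit_range[OF yA] by simp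
  ultimately show ?thesis using orbit_range[OF x] orbit_range[OF yA] by auto
qed

context
  fixes S :: "'a set"
  assumes S: "S \<subseteq> A" and reach: "\<And>x. x \<in> A \<Longrightarrow> \<exists>k. (f ^^ k) x \<in> S"
begin

lemma orbits_from_section: "orbit f ` A = orbit f ` S"
proof
  show "orbit f ` A \<subseteq> orbit f ` S"
  proof
    fix X assume "X \<in> orbit f ` A"
    then obtain x k where x: "x \<in> A" "X = orbit f x" "(f ^^ k) x \<in> S" using reach by blast
    then have "(f ^^ k) x \<in> orbit f x" using orbit_range by auto
    then have "orbit f ((f ^^ k) x) = X" using orbit_eq x by blast
    then show "X \<in> orbit f ` S" using x by blast
  qed
qed (use S in auto)

lemma section_orbit_pos: "x \<in> S \<Longrightarrow> 0 < card (S \<inter> orbit f x)"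
  using orbit_self S fin by (metis Int_iff card_gt_0_iff empty_iff finite_Int finite_subset subsetD)

text \<open>An orbit is hit once for each of its representatives, so each of them receives an equal
  share of the value of \<open>g\<close>.\<close>

lemma sum_over_orbits:
  fixes g :: "'a set \<Rightarrow> rat"
  shows "(\<Sum>X\<in>orbit f ` A. g X) = (\<Sum>x\<in>S. g (orbit f x) / of_nat (card (S \<inter> orbit f x)))"
proof -
  have finS: "finite S" using S fin finite_subset by blast
  have "(\<Sum>x\<in>S. g (orbit f x) / of_nat (card (S \<inter> orbit f x))) =
      (\<Sum>X\<in>orbit f ` S. \<Sum>x | x \<in> S \<and> orbit f x = X. g (orbit f x) / of_nat (card (S \<inter> orbit f x)))"
    by (rule sum.image_gen[OF finS])
  also have "\<dots> = (\<Sum>X\<in>orbit f ` S. g X)"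
  proof (rule sum.cong[OF refl])
    fix X assume "X \<in> orbit f ` S"
    then obtain y where y: "y \<in> S" "X = orbit f y" by auto
    have eq: "{x. x \<in> S \<and> orbit f x = X} = S \<inter> X"
      using orbit_self orbit_eq y S by blast
    have "(\<Sum>x | x \<in> S \<and> orbit f x = X. g (orbit f x) / of_nat (card (S \<inter> orbit f x))) =
        (\<Sum>x | x \<in> S \<and> orbit f x = X. g X / of_nat (card (S \<inter> X)))"
      by (rule sum.cong) auto
    also have "\<dots> = g X"
      unfolding eq using section_orbit_pos[OF y(1)] unfolding y(2)[symmetric] by simp
    finally show "(\<Sum>x | x \<in> S \<and> orbit f x = X. g (orbit f x) / of_nat (card (S \<inter> orbit f x))) = g X" .
  qed
  finally show ?thesis by (simp add: orbits_from_section)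
qed

text \<open>The exact value against which the claimed upper bounds are later balanced.\<close>

lemma card_eq_section_sum:
  "(\<Sum>x\<in>S. of_nat (card (orbit f x)) / of_nat (card (S \<inter> orbit f x)) :: rat) = of_nat (card A)"
proof -
  have "A = \<Union> (orbit f ` A)" using orbit_self orbit_subset by blast
  then have "card A = card (\<Union> (orbit f ` A))" by simp
  also have "\<dots> = (\<Sum>X\<in>orbit f ` A. card X)"
  proof (rule card_Union_disjoint)
    show "pairwise disjnt (orbit f ` A)"
      unfolding pairwise_def disjnt_def using orbit_eq by blast
    show "\<And>X. X \<in> orbit f ` A \<Longrightarrow> finite X" using orbit_subset fin finite_subset by blast
  qed
  finally show ?thesis using sum_over_orbits[of "\<lambda>X. of_nat (card X)"] by simp
qed

lemma card_orbits_section: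
  "of_nat (card {X \<in> orbit f ` A. P X}) =
     (\<Sum>x\<in>S. if P (orbit f x) then 1 / of_nat (card (S \<inter> orbit f x)) else 0 :: rat)"
proof -
  have "of_nat (card {X \<in> orbit f ` A. P X}) = (\<Sum>X\<in>orbit f ` A. if P X then 1 else 0 :: rat)"
    using fin by (simp add: sum.If_cases Int_def)
  also have "\<dots> = (\<Sum>x\<in>S. (if P (orbit f x) then 1 else 0) / of_nat (card (S \<inter> orbit f x)))"
    by (rule sum_over_orbits)
  also have "\<dots> = (\<Sum>x\<in>S. if P (orbit f x) then 1 / of_nat (card (S \<inter> orbit f x)) else 0)"
    by (intro sum.cong) auto
  finally show ?thesis .
qed

end

end

text \<open>A class \<open>(C, F, M, L)\<close> of representatives: orbits contain \<open>M\<close> of them and have size \<open>L\<close>, except that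
  those through the symmetric representatives in \<open>F\<close> contain one and have size \<open>L div M\<close>. Only one
  inequality of each of these claims is assumed.\<close>

definition orbit_class :: "('a \<Rightarrow> 'a) \<Rightarrow> 'a set \<Rightarrow> 'a set \<times> 'a set \<times> nat \<times> nat \<Rightarrow> bool" where
  "orbit_class f S = (\<lambda>(C, F, M, L). F \<subseteq> C \<and> 0 < M \<and> 0 < L \<and>
     (\<forall>x\<in>F. M dvd L \<and> (f ^^ (L div M)) x = x) \<and>
     (\<forall>x\<in>C - F. (f ^^ L) x = x \<and> M \<le> card (S \<inter> orbit f x)))"

lemma rat_of_nat_div: "m dvd l \<Longrightarrow> (of_nat (l div m) :: rat) = of_nat l / of_nat m"
  by (cases "m = 0") (auto elim!: dvdE)

lemma orbit_classD:
  assumes "orbit_class f S (C, F, M, L)"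
  shows "F \<subseteq> C" "0 < M" "0 < L" "x \<in> F \<Longrightarrow> M dvd L" "x \<in> F \<Longrightarrow> (f ^^ (L div M)) x = x"
    "x \<in> C \<Longrightarrow> x \<notin> F \<Longrightarrow> (f ^^ L) x = x" "x \<in> C \<Longrightarrow> x \<notin> F \<Longrightarrow> M \<le> card (S \<inter> orbit f x)"
  using assms unfolding orbit_class_def prod.case by blast+

lemma sum_list_disjoint:
  fixes g :: "'a \<Rightarrow> rat"
  assumes "sorted_wrt (\<lambda>c c'. fst c \<inter> fst c' = {}) cl" "\<And>c. c \<in> set cl \<Longrightarrow> finite (fst c)"
  shows "(\<Sum>x\<in>(\<Union>c\<in>set cl. fst c). g x) = (\<Sum>c\<leftarrow>cl. \<Sum>x\<in>fst c. g x)"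
  using assms
proof (induction cl)
  case (Cons c cl)
  have "(\<Sum>x\<in>(\<Union>c\<in>set (c # cl). fst c). g x) = (\<Sum>x\<in>fst c. g x) + (\<Sum>x\<in>(\<Union>c\<in>set cl. fst c). g x)"
    using Cons.prems by (simp, subst sum.union_disjoint) auto
  then show ?case using Cons by simp
qed simp

text \<open>Each weight |orbit| / (representatives on it) is at most \<open>L / M\<close>: outside
  \<open>F\<close> by bounding numerator and denominator separately, inside \<open>F\<close> because
  the orbit has at most \<open>L div M\<close> elements and at least one representative.
  \<open>total\<close> says that the bounds have the same sum as the weights, so every bound is an
  equality, and both orbit size and number of representatives can be recovered from it.\<close>

lemma (in finite_perm)
  fixes cl :: "('a set \<times> 'a set \<times> nat \<times> nat) list" and s :: rat
  defines "S \<equiv> \<Union>c\<in>set cl. fst c"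
  assumes S: "S \<subseteq> A" and reach: "\<And>x. x \<in> A \<Longrightarrow> \<exists>k. (f ^^ k) x \<in> S"
    and disj: "sorted_wrt (\<lambda>c c'. fst c \<inter> fst c' = {}) cl"
    and cls: "\<And>c. c \<in> set cl \<Longrightarrow> orbit_class f S c"
    and total: "(\<Sum>(C, F, M, L)\<leftarrow>cl. of_nat (card C * L) / of_nat M :: rat) = of_nat (card A)"
  shows orbit_classes_card:
      "\<And>C F M L x. (C, F, M, L) \<in> set cl \<Longrightarrow> x \<in> C \<Longrightarrow>
        card (orbit f x) = (if x \<in> F then L div M else L) \<and>
        card (S \<inter> orbit f x) = (if x \<in> F then 1 else M)"
    and orbit_classes_count:
      "of_nat (card {X \<in> orbit f ` A. of_nat (card X) = s}) =
        (\<Sum>(C, F, M, L)\<leftarrow>cl. (if of_nat L = s then (of_nat (card C) - of_nat (card F)) / of_nat M else 0) +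
          (if of_nat L / of_nat M = s then of_nat (card F) else 0) :: rat)"
proof -
  define w where "w x = (of_nat (card (orbit f x)) / of_nat (card (S \<inter> orbit f x)) :: rat)" for x
  have finS: "finite S" using S fin finite_subset by blast
  have finc: "finite (fst c)" if "c \<in> set cl" for c
    using that finS by (auto simp: S_def)
  have CA: "C \<subseteq> S" "C \<subseteq> A" if "(C, F, M, L) \<in> set cl" for C F M L
    using that S by (force simp: S_def)+
  have mpos: "0 < card (S \<inter> orbit f x)" if "x \<in> S" for x
    using section_orbit_pos[OF S reach that] .
  have bound: "w x \<le> of_nat L / of_nat M" if c: "(C, F, M, L) \<in> set cl" and x: "x \<in> C" for C F M L x
  proof -
    have xA: "x \<in> A" "x \<in> S" using CA[OF c] x by auto
    note oc = orbit_classD[OF cls[OF c]]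
    show ?thesis
    proof (cases "x \<in> F")
      case True
      have "0 < L div M" using oc(2,3) oc(4)[OF True] by (simp add: dvd_imp_le div_greater_zero_iff)
      then have "card (orbit f x) \<le> L div M" by (rule card_orbit_le) (rule oc(5)[OF True])
      then have "of_nat (card (orbit f x)) \<le> (of_nat (L div M) :: rat)" by (rule of_nat_mono)
      also have "\<dots> = of_nat L / of_nat M" using oc(4)[OF True] by (simp add: rat_of_nat_div)
      finally have 1: "of_nat (card (orbit f x)) \<le> (of_nat L / of_nat M :: rat)" .
      have "w x \<le> of_nat (card (orbit f x))"
        unfolding w_def using mpos[OF xA(2)] by (simp add: divide_le_eq mult_le_cancel_left1)
      with 1 show ?thesis by linarith
    next
      case False
      have "card (orbit f x) \<le> L" by (rule card_orbit_le[OF oc(3) oc(6)[OF x False]])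
      moreover have "M \<le> card (S \<inter> orbit f x)" by (rule oc(7)[OF x False])
      ultimately show ?thesis unfolding w_def using oc(2) by (intro frac_le) auto
    qed
  qed
  have "(\<Sum>c\<leftarrow>cl. \<Sum>x\<in>fst c. w x) = of_nat (card A)"
    using card_eq_section_sum[OF S reach] sum_list_disjoint[OF disj finc, of w]
    unfolding w_def S_def by simp
  also have "(of_nat (card A) :: rat) = (\<Sum>c\<leftarrow>cl. \<Sum>x\<in>fst c. of_nat (snd (snd (snd c))) / of_nat (fst (snd (snd c))))"
    unfolding total[symmetric] by (intro arg_cong[of _ _ sum_list] map_cong) auto
  finally have zero: "(\<Sum>c\<leftarrow>cl. \<Sum>x\<in>fst c. of_nat (snd (snd (snd c))) / of_nat (fst (snd (snd c))) - w x) = 0"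
    by (simp add: sum_subtractf sum_list_subtractf)
  \<comment> \<open>The slacks are nonnegative and sum to 0, so each of them is 0.\<close>
  have eq: "w x = of_nat L / of_nat M" if c: "(C, F, M, L) \<in> set cl" and x: "x \<in> C" for C F M L x
  proof -
    have "\<forall>y\<in>set (map (\<lambda>c. \<Sum>x\<in>fst c. of_nat (snd (snd (snd c))) / of_nat (fst (snd (snd c))) - w x) cl). y = 0"
      using zero by (subst (asm) sum_list_nonneg_eq_0_iff) (auto intro!: sum_nonneg bound)
    then have "(\<Sum>x\<in>C. of_nat L / of_nat M - w x) = 0" using c by force
    then show ?thesis using bound[OF c] finc[OF c] x by (subst (asm) sum_nonneg_eq_0_iff) auto
  qed
  show card: "card (orbit f x) = (if x \<in> F then L div M else L) \<and> card (S \<inter> orbit f x) = (if x \<in> F then 1 else M)"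
    if c: "(C, F, M, L) \<in> set cl" and x: "x \<in> C" for C F M L x
  proof -
    have xA: "x \<in> A" "x \<in> S" using CA[OF c] x by auto
    note oc = orbit_classD[OF cls[OF c]]
    define m where "m = card (S \<inter> orbit f x)"
    define k where "k = card (orbit f x)"
    have m: "0 < m" using mpos[OF xA(2)] by (simp add: m_def)
    have "(of_nat k / of_nat m :: rat) = of_nat L / of_nat M"
      using eq[OF c x] by (simp add: w_def m_def k_def)
    then have "(of_nat (k * M) :: rat) = of_nat (L * m)"
      using m oc(2) by (simp add: field_simps)
    \<comment> \<open>Equality of the ratios fixes both quantities: outside \<open>F\<close> through
      k \<le> L and M \<le> m, inside \<open>F\<close> through k = q * m \<le> q.\<close>
    then have kM: "k * M = L * m" by (simp only: of_nat_eq_iff)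
    show ?thesis
    proof (cases "x \<in> F")
      case True
      then obtain q where q: "L = M * q" using oc(4) by blast
      have "0 < q" using q oc(3) by simp
      have "k \<le> q" using card_orbit_le[of q f x] oc(5)[OF True] q oc(2) \<open>0 < q\<close> by (simp add: k_def)
      moreover have "k = q * m" using kM q oc(2) by simp
      ultimately have "m = 1" "k = q" using m \<open>0 < q\<close> by (auto simp: mult_le_cancel_left1)
      then show ?thesis using True q oc(2) by (simp add: k_def m_def)
    next
      case False
      have "k \<le> L" unfolding k_def by (rule card_orbit_le[OF oc(3) oc(6)[OF x False]])
      moreover have "M \<le> m" unfolding m_def by (rule oc(7)[OF x False])
      ultimately have "L * M \<le> L * m" "k * M \<le> L * M" by simp_all
      then have "L * M = L * m" "k * M = L * M" using kM by linarith+
      then show ?thesis using False oc(2,3) by (simp add: k_def m_def)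
    qed
  qed
  have "of_nat (card {X \<in> orbit f ` A. of_nat (card X) = s}) =
      (\<Sum>x\<in>S. if of_nat (card (orbit f x)) = s then 1 / of_nat (card (S \<inter> orbit f x)) else 0 :: rat)"
    by (rule card_orbits_section[OF S reach])
  also have "\<dots> = (\<Sum>c\<leftarrow>cl. \<Sum>x\<in>fst c. if of_nat (card (orbit f x)) = s then 1 / of_nat (card (S \<inter> orbit f x)) else 0)"
    unfolding S_def by (rule sum_list_disjoint[OF disj finc])
  also have "\<dots> = (\<Sum>(C, F, M, L)\<leftarrow>cl. (if of_nat L = s then (of_nat (card C) - of_nat (card F)) / of_nat M else 0) +
          (if of_nat L / of_nat M = s then of_nat (card F) else 0))"
  proof (intro arg_cong[of _ _ sum_list] map_cong refl)
    fix c assume ccl: "c \<in> set cl"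
    obtain C F M L where c1: "c = (C, F, M, L)" by (metis prod_cases4)
    note c = c1 ccl[unfolded c1]
    have finC: "finite C" using finc[OF c(2)] by simp
    note F = orbit_classD(1,4)[OF cls[OF c(2)]]
    let ?g = "\<lambda>x. if of_nat (card (orbit f x)) = s then 1 / of_nat (card (S \<inter> orbit f x)) else 0 :: rat"
    have "(\<Sum>x\<in>C. ?g x) = (\<Sum>x\<in>C - F. ?g x) + (\<Sum>x\<in>F. ?g x)"
      by (rule sum.subset_diff[OF F(1) finC])
    also have "(\<Sum>x\<in>C - F. ?g x) = (\<Sum>x\<in>C - F. if of_nat L = s then 1 / of_nat M else 0)"
      using card[OF c(2)] by (intro sum.cong) auto
    also have "\<dots> = (if of_nat L = s then (of_nat (card C) - of_nat (card F)) / of_nat M else 0)"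
      using F(1) finC by (auto simp: card_Diff_subset[OF finite_subset] of_nat_diff card_mono)
    also have "(\<Sum>x\<in>F. ?g x) = (\<Sum>x\<in>F. if of_nat L / of_nat M = s then 1 else 0)"
    proof (rule sum.cong[OF refl])
      fix x assume x: "x \<in> F"
      with F(1) have "x \<in> C" by blast
      from card[OF c(2) this] x rat_of_nat_div[OF F(2)[OF x]]
      show "?g x = (if of_nat L / of_nat M = s then 1 else 0)" by simp
    qed
    also have "\<dots> = (if of_nat L / of_nat M = s then of_nat (card F) else 0)" by simp
    finally show "(\<Sum>x\<in>fst c. ?g x) = (case c of (C, F, M, L) \<Rightarrow>
        (if of_nat L = s then (of_nat (card C) - of_nat (card F)) / of_nat M else 0) +
        (if of_nat L / of_nat M = s then of_nat (card F) else 0))"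
      by (simp add: c(1))
  qed
  finally show "of_nat (card {X \<in> orbit f ` A. of_nat (card X) = s}) =
        (\<Sum>(C, F, M, L)\<leftarrow>cl. (if of_nat L = s then (of_nat (card C) - of_nat (card F)) / of_nat M else 0) +
          (if of_nat L / of_nat M = s then of_nat (card F) else 0) :: rat)" .
qed

section \<open>The classes of orbits of linear size\<close>

lemma card_pairs_sum_less: "2 * card {(a, b). a + b < m} = m * (m + 1)" for m :: nat
proof -
  have "{(a, b). a + b < m} = (SIGMA a:{..<m}. {..<m - a})" by auto
  then have "card {(a, b). a + b < m} = (\<Sum>a<m. m - a)" by simp
  also have "\<dots> = (\<Sum>i<m. Suc i)"
    by (rule sum.reindex_bij_witness[where i = "\<lambda>i. m - Suc i" and j = "\<lambda>i. m - Suc i"]) auto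
  also have "2 * \<dots> = m * (m + 1)" by (induction m) auto
  finally show ?thesis .
qed

lemma finite_pairs_sum_less: "finite {(a, b). a + b < (m :: nat)}"
  by (rule finite_subset[of _ "{..<m} \<times> {..<m}"]) auto

lemma card_triples_sum_less: "6 * card {(a, b, c). a + b + c < m} = m * (m + 1) * (m + 2)" for m :: nat
proof -
  have "{(a, b, c). a + b + c < m} = (SIGMA a:{..<m}. {(b, c). b + c < m - a})" by auto
  then have "card {(a, b, c). a + b + c < m} = (\<Sum>a<m. card {(b, c). b + c < m - a})"
    using finite_pairs_sum_less by simp
  also have "\<dots> = (\<Sum>i<m. card {(b, c). b + c < Suc i})"
    by (rule sum.reindex_bij_witness[where i = "\<lambda>i. m - Suc i" and j = "\<lambda>i. m - Suc i"])
      (auto simp: Suc_diff_Suc)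
  also have "6 * \<dots> = (\<Sum>i<m. 3 * (2 * card {(b, c). b + c < Suc i}))"
    by (simp add: sum_distrib_left)
  also have "\<dots> = m * (m + 1) * (m + 2)"
    unfolding card_pairs_sum_less by (induction m) (auto simp: algebra_simps)
  finally show ?thesis .
qed

context two_rows
begin

sublocale finite_perm row "ICS (two_by n)"
proof
  have "finite (two_by n)" by (simp add: two_by_def)
  moreover have "ICS (two_by n) \<subseteq> Pow (two_by n)" by (auto simp: ICS_def)
  ultimately show "finite (ICS (two_by n))" using finite_subset by blast
qed (rule bij_betw_rowmotion)

lemma steps_orbit: "steps k I J \<Longrightarrow> 0 < k \<Longrightarrow> J \<in> orbit row I"
  unfolding steps_def orbit_altdef by blast

lemma two_in_orbit:
  assumes "finite S" "I \<in> S" "J \<in> S" "I \<noteq> J"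
    and "steps k I J" "steps l J I" "0 < k" "0 < l"
  shows "2 \<le> card (S \<inter> orbit row I)"
proof -
  have "steps (k + l) I I" using assms(5,6) by (rule steps_trans)
  then have "{I, J} \<subseteq> S \<inter> orbit row I"
    using assms steps_orbit[of "k + l" I I] steps_orbit[of k I J] by auto
  then have "card {I, J} \<le> card (S \<inter> orbit row I)" using assms(1) by (intro card_mono) auto
  then show ?thesis using assms(4) by simp
qed

lemma three_in_orbit:
  assumes "finite S" "I \<in> S" "J \<in> S" "K \<in> S" "I \<noteq> J" "I \<noteq> K" "J \<noteq> K"
    and "steps k I J" "steps l J K" "steps m K I" "0 < k" "0 < l" "0 < m"
  shows "3 \<le> card (S \<inter> orbit row I)"
proof -
  have 1: "steps (k + l) I K" using assms(8,9) by (rule steps_trans)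
  then have 2: "steps (k + l + m) I I" using assms(10) by (rule steps_trans)
  have "{I, J, K} \<subseteq> S \<inter> orbit row I"
    using assms steps_orbit[OF 1] steps_orbit[OF 2] steps_orbit[of k I J] by auto
  then have "card {I, J, K} \<le> card (S \<inter> orbit row I)" using assms(1) by (intro card_mono) auto
  then show ?thesis using assms(5-7) by simp
qed

lemma gap_state_eq_iff:
  "1 \<le> q \<Longrightarrow> 1 \<le> q' \<Longrightarrow> gap_state p q r = gap_state p' q' r' \<longleftrightarrow> p = p' \<and> q = q' \<and> r = r'"
  by (auto simp: gap_state_def st_eq_iff)

lemma gap_state_inj:
  "gap_state p q r = gap_state p' q' r' \<Longrightarrow> 1 \<le> q \<Longrightarrow> 1 \<le> q' \<Longrightarrow> p = p' \<and> q = q' \<and> r = r'"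
  by (simp add: gap_state_eq_iff)

lemma pair_state_eq_iff: "1 \<le> x \<Longrightarrow> 1 \<le> y \<Longrightarrow> pair_state x = pair_state y \<longleftrightarrow> x = y"
  by (auto simp: pair_state_def st_eq_iff)

lemma top_state_eq_iff: "top_state c k = top_state c' k' \<longleftrightarrow> c = c' \<and> k = k'"
  by (auto simp: top_state_def st_eq_iff)

lemma gap_neq_pair: "2 \<le> q \<Longrightarrow> gap_state p q r \<noteq> pair_state x"
  by (auto simp: gap_state_def pair_state_def st_eq_iff)

lemma gap_neq_top: "gap_state p q r \<noteq> top_state c k"
  by (auto simp: gap_state_def top_state_def st_eq_iff)

lemma pair_neq_top: "1 \<le> x \<Longrightarrow> pair_state x \<noteq> top_state c k"
  by (auto simp: pair_state_def top_state_def st_eq_iff)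

lemma neq_empty:
  "gap_state p q r \<noteq> st 1 0 1 0" "1 \<le> x \<Longrightarrow> pair_state x \<noteq> st 1 0 1 0" "top_state c k \<noteq> st 1 0 1 0"
  by (auto simp: gap_state_def pair_state_def top_state_def st_eq_iff)

definition gaps_big :: "(nat \<times> nat) set set" where
  "gaps_big = (\<lambda>(p, q, r). gap_state p (q + 4) r) ` {(p, q, r). p + q + r < n - 4}"

text \<open>The fixed points r = p, s = q of the involution on the gaps; their orbits have half the
  length. The other sets named \<open>sym\<close> likewise hold the fixed points of their return
  maps.\<close>

definition gaps_big_sym :: "(nat \<times> nat) set set" where
  "gaps_big_sym = (\<lambda>(p, q). gap_state p (q + 4) p) ` {(p, q). n = 2 * p + 2 * q + 5}"

definition gaps_three :: "(nat \<times> nat) set set" where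
  "gaps_three = (\<lambda>(p, r). gap_state p 3 r) ` {(p, r). p + r < n - 3}"

definition gaps_two :: "(nat \<times> nat) set set" where
  "gaps_two = (\<lambda>(p, r). gap_state p 2 r) ` {(p, r). p + r < n - 2}"

definition gaps_two_sym :: "(nat \<times> nat) set set" where
  "gaps_two_sym = (\<lambda>p. gap_state p 2 p) ` {p. n = 3 * p + 3}"

definition pairs :: "(nat \<times> nat) set set" where
  "pairs = pair_state ` {2..<n}"

definition pairs_sym :: "(nat \<times> nat) set set" where
  "pairs_sym = pair_state ` {x. 2 \<le> x \<and> n + 1 = 2 * x}"

text \<open>The offsets turn the triple into \<open>(c + 3, k + 3, g + 3)\<close>, so that all gaps
  are at least 3 and the rotation can be applied three times.\<close>

definition tops_wide :: "(nat \<times> nat) set set" where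
  "tops_wide = (\<lambda>(c, k). top_state (c + 1) (k + 3)) ` {(c, k). c + k < n - 6}"

definition tops_wide_sym :: "(nat \<times> nat) set set" where
  "tops_wide_sym = (\<lambda>c. top_state (c + 1) (c + 3)) ` {c. n = 3 * c + 7}"

definition tops_narrow :: "(nat \<times> nat) set set" where
  "tops_narrow = {top_state c k | c k. 1 \<le> c \<and> c + k \<le> n \<and> (k < 3 \<or> n < c + k + 3) \<and> c \<noteq> n}"

text \<open>The argument \<open>rl\<close> pairs representatives of the orbits through
  \<open>tops_narrow\<close> with their periods. It is the only part that varies with the residue of
  \<open>n\<close>.\<close>

definition classes :: "((nat \<times> nat) set \<times> nat) list \<Rightarrow>
    ((nat \<times> nat) set set \<times> (nat \<times> nat) set set \<times> nat \<times> nat) list" where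
  "classes rl = [(gaps_big, gaps_big_sym, 2, n + 3), (gaps_three, {}, 1, n + 3),
     (gaps_two, gaps_two_sym, 3, n + 3), (pairs, pairs_sym, 2, n + 3),
     (tops_wide, tops_wide_sym, 3, n + 5), ({top_state n 0}, {}, 1, n + 3),
     ({st 1 0 1 0}, {}, 1, 2)] @ map (\<lambda>(I, L). ({I}, {}, 1, L)) rl"

lemma gaps_bigI: "p + q + r + 5 \<le> n \<Longrightarrow> gap_state p (q + 4) r \<in> gaps_big"
  unfolding gaps_big_def by (rule image_eqI[of _ _ "(p, q, r)"]) auto

lemma gaps_bigE:
  assumes "I \<in> gaps_big"
  obtains p q r s where "I = gap_state p (q + 4) r" "n = p + q + r + s + 5"
proof -
  obtain p q r where "I = gap_state p (q + 4) r" "p + q + r < n - 4"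
    using assms by (auto simp: gaps_big_def)
  moreover from this have "n = p + q + r + (n - (p + q + r + 5)) + 5" by simp
  ultimately show ?thesis using that by blast
qed

lemma gaps_big_symE:
  assumes "I \<in> gaps_big_sym"
  obtains p q where "I = gap_state p (q + 4) p" "n = 2 * p + 2 * q + 5"
proof -
  obtain p q where "I = gap_state p (q + 4) p" "n = 2 * p + 2 * q + 5"
    using assms by (auto simp: gaps_big_sym_def)
  then show ?thesis by (rule that)
qed

lemma orbit_class_gaps_big:
  assumes "gaps_big \<subseteq> S" "finite S"
  shows "orbit_class row S (gaps_big, gaps_big_sym, 2, n + 3)"
  unfolding orbit_class_def prod.case
proof (intro conjI ballI)
  show "gaps_big_sym \<subseteq> gaps_big"
  proof
    fix I assume "I \<in> gaps_big_sym"
    then obtain p q where pq: "I = gap_state p (q + 4) p" "n = 2 * p + 2 * q + 5"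
      by (rule gaps_big_symE)
    show "I \<in> gaps_big" unfolding pq(1) by (rule gaps_bigI) (use pq(2) in linarith)
  qed
next
  fix I assume "I \<in> gaps_big_sym"
  then obtain p q where pq: "I = gap_state p (q + 4) p" "n = 2 * p + 2 * q + 5"
    by (rule gaps_big_symE)
  show "2 dvd n + 3" using pq(2) by presburger
  have "steps (p + q + 4) I I"
    unfolding pq(1) by (rule gap_big) (use pq in auto)
  moreover have "(n + 3) div 2 = p + q + 4" using pq(2) by simp
  ultimately show "(row ^^ ((n + 3) div 2)) I = I" by (simp only: steps_def)
next
  fix I assume I: "I \<in> gaps_big - gaps_big_sym"
  then have "I \<in> gaps_big" by blast
  then obtain p q r s where s: "I = gap_state p (q + 4) r" "n = p + q + r + s + 5"
    by (rule gaps_bigE)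
  let ?J = "gap_state r (s + 4) p"
  have 1: "steps (r + s + 4) I ?J" unfolding s(1) by (rule gap_big) (use s in auto)
  have 2: "steps (p + q + 4) ?J I" unfolding s(1) by (rule gap_big) (use s in auto)
  have "steps (r + s + 4 + (p + q + 4)) I I" using 1 2 by (rule steps_trans)
  moreover have "r + s + 4 + (p + q + 4) = n + 3" using s(2) by simp
  ultimately show "(row ^^ (n + 3)) I = I" by (simp only: steps_def)
  have "?J \<in> gaps_big" by (rule gaps_bigI) (use s(2) in linarith)
  then have inS: "I \<in> S" "?J \<in> S" using I assms(1) by blast+
  have "I \<noteq> ?J"
  proof
    assume "I = ?J"
    with s(1) have "gap_state p (q + 4) r = gap_state r (s + 4) p" by (rule trans[OF sym])
    then have "p = r \<and> q + 4 = s + 4 \<and> r = p" by (rule gap_state_inj) simp_all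
    then have eq: "r = p" "s = q" by (elim conjE, linarith)+
    have "I \<in> gaps_big_sym"
      unfolding gaps_big_sym_def s(1) eq(1)
      by (rule image_eqI[of _ _ "(p, q)"]) (use s(2) eq in simp_all)
    then show False using I by simp
  qed
  then show "2 \<le> card (S \<inter> orbit row I)"
    by (rule two_in_orbit[OF assms(2) inS _ 1 2]) simp_all
qed simp_all

lemma gaps_threeE:
  assumes "I \<in> gaps_three"
  obtains p r s where "I = gap_state p 3 r" "n = p + r + s + 4"
proof -
  obtain p r where "I = gap_state p 3 r" "p + r < n - 3"
    using assms by (auto simp: gaps_three_def)
  moreover from this have "n = p + r + (n - (p + r + 4)) + 4" by simp
  ultimately show ?thesis using that by blast
qed

lemma orbit_self_pos: "I \<in> ICS (two_by n) \<Longrightarrow> finite S \<Longrightarrow> I \<in> S \<Longrightarrow> 1 \<le> card (S \<inter> orbit row I)"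
  using orbit_self by (simp add: Suc_le_eq card_gt_0_iff) blast

lemma orbit_class_single:
  assumes "C \<subseteq> S" "S \<subseteq> ICS (two_by n)" "finite S" "0 < L" "\<And>I. I \<in> C \<Longrightarrow> steps L I I"
  shows "orbit_class row S (C, {}, 1, L)"
proof -
  have "1 \<le> card (S \<inter> orbit row I)" if "I \<in> C" for I
    by (rule orbit_self_pos) (use that assms in auto)
  then show ?thesis
    unfolding orbit_class_def prod.case using assms(4,5) by (simp add: steps_def)
qed

lemma orbit_class_gaps_three:
  assumes "gaps_three \<subseteq> S" "S \<subseteq> ICS (two_by n)" "finite S"
  shows "orbit_class row S (gaps_three, {}, 1, n + 3)"
proof (rule orbit_class_single[OF assms])
  fix I assume "I \<in> gaps_three"
  then obtain p r s where s: "I = gap_state p 3 r" "n = p + r + s + 4" by (rule gaps_threeE)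
  show "steps (n + 3) I I" unfolding s(1) by (rule gap_three[OF s(2)])
qed simp

lemma gaps_twoI: "p + r + 3 \<le> n \<Longrightarrow> gap_state p 2 r \<in> gaps_two"
  unfolding gaps_two_def by (rule image_eqI[of _ _ "(p, r)"]) auto

lemma gaps_twoE:
  assumes "I \<in> gaps_two"
  obtains p r s where "I = gap_state p 2 r" "n = p + r + s + 3"
proof -
  obtain p r where "I = gap_state p 2 r" "p + r < n - 2"
    using assms by (auto simp: gaps_two_def)
  moreover from this have "n = p + r + (n - (p + r + 3)) + 3" by simp
  ultimately show ?thesis using that by blast
qed

lemma orbit_class_gaps_two:
  assumes "gaps_two \<subseteq> S" "finite S"
  shows "orbit_class row S (gaps_two, gaps_two_sym, 3, n + 3)"
  unfolding orbit_class_def prod.case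
proof (intro conjI ballI)
  show "gaps_two_sym \<subseteq> gaps_two"
  proof
    fix I assume "I \<in> gaps_two_sym"
    then obtain p where p: "I = gap_state p 2 p" "n = 3 * p + 3"
      by (auto simp: gaps_two_sym_def)
    show "I \<in> gaps_two" unfolding p(1) by (rule gaps_twoI) (use p(2) in linarith)
  qed
next
  fix I assume "I \<in> gaps_two_sym"
  then obtain p where p: "I = gap_state p 2 p" "n = 3 * p + 3"
    by (auto simp: gaps_two_sym_def)
  show "3 dvd n + 3" using p(2) by presburger
  have "steps (p + 2) I I" unfolding p(1) by (rule gap_two) (use p in auto)
  moreover have "(n + 3) div 3 = p + 2" using p(2) by simp
  ultimately show "(row ^^ ((n + 3) div 3)) I = I" by (simp only: steps_def)
next
  fix I assume I: "I \<in> gaps_two - gaps_two_sym"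
  then have "I \<in> gaps_two" by blast
  then obtain p r s where s: "I = gap_state p 2 r" "n = p + r + s + 3"
    by (rule gaps_twoE)
  let ?J = "gap_state s 2 p" and ?K = "gap_state r 2 s"
  have 1: "steps (s + 2) I ?J" unfolding s(1) by (rule gap_two) (use s in auto)
  have 2: "steps (r + 2) ?J ?K" by (rule gap_two) (use s in auto)
  have 3: "steps (p + 2) ?K I" unfolding s(1) by (rule gap_two) (use s in auto)
  have "steps (s + 2 + (r + 2) + (p + 2)) I I" by (rule steps_trans[OF steps_trans[OF 1 2] 3])
  moreover have "s + 2 + (r + 2) + (p + 2) = n + 3" using s(2) by simp
  ultimately show "(row ^^ (n + 3)) I = I" by (simp only: steps_def)
  have "?J \<in> gaps_two" by (rule gaps_twoI) (use s(2) in linarith)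
  moreover have "?K \<in> gaps_two" by (rule gaps_twoI) (use s(2) in linarith)
  ultimately have inS: "I \<in> S" "?J \<in> S" "?K \<in> S" using I assms(1) by blast+
  have "\<not> (p = r \<and> r = s)"
  proof
    assume "p = r \<and> r = s"
    then have "I \<in> gaps_two_sym"
      unfolding gaps_two_sym_def using s by (intro image_eqI[of _ _ p]) auto
    then show False using I by simp
  qed
  then have "gap_state p 2 r \<noteq> ?J" "gap_state p 2 r \<noteq> ?K" "?J \<noteq> ?K"
    using gap_state_inj[of p 2 r s 2 p] gap_state_inj[of p 2 r r 2 s] gap_state_inj[of s 2 p r 2 s]
    by fastforce+
  then have "I \<noteq> ?J" "I \<noteq> ?K" "?J \<noteq> ?K" unfolding s(1) by blast+
  then show "3 \<le> card (S \<inter> orbit row I)"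
    by (intro three_in_orbit[OF assms(2) inS _ _ _ 1 2 3]) simp_all
qed simp_all

lemma orbit_class_pairs:
  assumes "pairs \<subseteq> S" "finite S"
  shows "orbit_class row S (pairs, pairs_sym, 2, n + 3)"
  unfolding orbit_class_def prod.case
proof (intro conjI ballI)
  show "pairs_sym \<subseteq> pairs" unfolding pairs_def pairs_sym_def by auto
next
  fix I assume "I \<in> pairs_sym"
  then obtain x where x: "I = pair_state x" "2 \<le> x" "n + 1 = 2 * x"
    unfolding pairs_sym_def by blast
  have nx: "n = 2 * x - 1" using x(2,3) by simp
  show "2 dvd n + 3" using x(2) nx by presburger
  have "steps (x + 1) I I" unfolding x(1) by (rule pair_step) (use x in auto)
  moreover have "(n + 3) div 2 = x + 1" using x(2,3) by simp
  ultimately show "(row ^^ ((n + 3) div 2)) I = I" by (simp only: steps_def)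
next
  fix I assume I: "I \<in> pairs - pairs_sym"
  then obtain x where x: "I = pair_state x" "2 \<le> x" "x < n" by (auto simp: pairs_def)
  define y where "y = n + 1 - x"
  have y: "n + 1 = x + y" "2 \<le> y" "y < n" using x by (auto simp: y_def)
  have 1: "steps (y + 1) I (pair_state y)" unfolding x(1) by (rule pair_step) (use x y in auto)
  have 2: "steps (x + 1) (pair_state y) I" unfolding x(1) by (rule pair_step) (use x y in auto)
  have "steps (y + 1 + (x + 1)) I I" using 1 2 by (rule steps_trans)
  moreover have "y + 1 + (x + 1) = n + 3" using y by simp
  ultimately show "(row ^^ (n + 3)) I = I" by (simp only: steps_def)
  have "pair_state y \<in> pairs" using y by (auto simp: pairs_def)
  then have inS: "I \<in> S" "pair_state y \<in> S" using I assms(1) by blast+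
  have "I \<noteq> pair_state y"
  proof
    assume "I = pair_state y"
    then have "x = y" using x y by (simp add: pair_state_eq_iff)
    then have "I \<in> pairs_sym"
      unfolding pairs_sym_def using x y by (intro image_eqI[of _ _ x]) auto
    then show False using I by simp
  qed
  then show "2 \<le> card (S \<inter> orbit row I)"
    by (rule two_in_orbit[OF assms(2) inS _ 1 2]) simp_all
qed simp_all

lemma tops_wideI: "c + k + 7 \<le> n \<Longrightarrow> top_state (c + 1) (k + 3) \<in> tops_wide"
  unfolding tops_wide_def by (rule image_eqI[of _ _ "(c, k)"]) auto

lemma tops_wideE:
  assumes "I \<in> tops_wide"
  obtains c k g where "I = top_state (c + 1) (k + 3)" "n = c + k + g + 7"
proof -
  obtain c k where "I = top_state (c + 1) (k + 3)" "c + k < n - 6"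
    using assms by (auto simp: tops_wide_def)
  moreover from this have "n = c + k + (n - (c + k + 7)) + 7" by simp
  ultimately show ?thesis using that by blast
qed

lemma tops_wide_rotate:
  assumes "n = c + k + g + 7"
  shows "steps (g + 4) (top_state (c + 1) (k + 3)) (top_state (g + 1) (c + 3))"
  using top_rotate[of "c + 1" "k + 3" g] assms by (simp add: numeral_3_eq_3)

lemma orbit_class_tops_wide:
  assumes "tops_wide \<subseteq> S" "finite S"
  shows "orbit_class row S (tops_wide, tops_wide_sym, 3, n + 5)"
  unfolding orbit_class_def prod.case
proof (intro conjI ballI)
  show "tops_wide_sym \<subseteq> tops_wide"
  proof
    fix I assume "I \<in> tops_wide_sym"
    then obtain c where c: "I = top_state (c + 1) (c + 3)" "n = 3 * c + 7"
      by (auto simp: tops_wide_sym_def)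
    show "I \<in> tops_wide" unfolding c(1) by (rule tops_wideI) (use c(2) in linarith)
  qed
next
  fix I assume "I \<in> tops_wide_sym"
  then obtain c where c: "I = top_state (c + 1) (c + 3)" "n = 3 * c + 7"
    by (auto simp: tops_wide_sym_def)
  show "3 dvd n + 5" using c(2) by presburger
  have "steps (c + 4) I I" unfolding c(1) by (rule tops_wide_rotate) (use c in auto)
  moreover have "(n + 5) div 3 = c + 4" using c(2) by simp
  ultimately show "(row ^^ ((n + 5) div 3)) I = I" by (simp only: steps_def)
next
  fix I assume I: "I \<in> tops_wide - tops_wide_sym"
  then have "I \<in> tops_wide" by blast
  then obtain c k g where g: "I = top_state (c + 1) (k + 3)" "n = c + k + g + 7"
    by (rule tops_wideE)
  let ?J = "top_state (g + 1) (c + 3)" and ?K = "top_state (k + 1) (g + 3)"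
  have 1: "steps (g + 4) I ?J" unfolding g(1) by (rule tops_wide_rotate) (use g in auto)
  have 2: "steps (k + 4) ?J ?K" by (rule tops_wide_rotate) (use g in auto)
  have 3: "steps (c + 4) ?K I" unfolding g(1) by (rule tops_wide_rotate) (use g in auto)
  have "steps (g + 4 + (k + 4) + (c + 4)) I I" by (rule steps_trans[OF steps_trans[OF 1 2] 3])
  moreover have "g + 4 + (k + 4) + (c + 4) = n + 5" using g(2) by simp
  ultimately show "(row ^^ (n + 5)) I = I" by (simp only: steps_def)
  have "?J \<in> tops_wide" by (rule tops_wideI) (use g(2) in linarith)
  moreover have "?K \<in> tops_wide" by (rule tops_wideI) (use g(2) in linarith)
  ultimately have inS: "I \<in> S" "?J \<in> S" "?K \<in> S" using I assms(1) by blast+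
  have "\<not> (c = k \<and> k = g)"
  proof
    assume "c = k \<and> k = g"
    then have "I \<in> tops_wide_sym"
      unfolding tops_wide_sym_def using g by (intro image_eqI[of _ _ c]) auto
    then show False using I by simp
  qed
  then have "I \<noteq> ?J" "I \<noteq> ?K" "?J \<noteq> ?K"
    using g(1) by (auto simp: top_state_eq_iff)
  then show "3 \<le> card (S \<inter> orbit row I)"
    by (intro three_in_orbit[OF assms(2) inS _ _ _ 1 2 3]) simp_all
qed simp_all

section \<open>Cardinalities of the classes and of their symmetric members\<close>

lemma card_gaps_big: "2 \<le> n \<Longrightarrow> (of_nat (card gaps_big) :: rat) = (of_nat n - 2) * (of_nat n - 3) * (of_nat n - 4) / 6"
proof -
  assume n: "2 \<le> n"
  have "inj_on (\<lambda>(p, q, r). gap_state p (q + 4) r) {(p, q, r). p + q + r < n - 4}"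
    by (auto simp: inj_on_def gap_state_eq_iff)
  then have "card gaps_big = card {(p, q, r). p + q + r < n - 4}"
    unfolding gaps_big_def by (rule card_image)
  then have *: "6 * card gaps_big = (n - 4) * (n - 4 + 1) * (n - 4 + 2)"
    by (simp only: card_triples_sum_less)
  have "6 * of_nat (card gaps_big) = (of_nat n - 2) * (of_nat n - 3) * (of_nat n - 4 :: rat)"
  proof (cases "4 \<le> n")
    case True
    then obtain m where "n = m + 4" by (metis le_add_diff_inverse2)
    moreover from this have "of_nat (6 * card gaps_big) = (of_nat (m * (m + 1) * (m + 2)) :: rat)"
      using * by simp
    ultimately show ?thesis by (simp add: algebra_simps)
  next
    \<comment> \<open>The truncated \<open>n - 4\<close> makes the set empty for n = 2 and n = 3,
      and there the polynomial vanishes as well.\<close>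
    case False
    then have "n = 2 \<or> n = 3" using n by auto
    then show ?thesis using * by auto
  qed
  then show ?thesis by simp
qed

lemma card_gaps_big_sym:
  "2 \<le> n \<Longrightarrow> (of_nat (card gaps_big_sym) :: rat) = (if odd n then (of_nat n - 3) / 2 else 0)"
proof -
  assume n: "2 \<le> n"
  have inj: "inj_on (\<lambda>(p, q). gap_state p (q + 4) p) {(p, q). n = 2 * p + 2 * q + 5}"
    by (auto simp: inj_on_def gap_state_eq_iff)
  have card: "card gaps_big_sym = card {(p, q). n = 2 * p + 2 * q + 5}"
    unfolding gaps_big_sym_def by (rule card_image[OF inj])
  show ?thesis
  proof (cases "odd n")
    case True
    then have "n = 2 * ((n - 3) div 2) + 3" using n by presburger
    then obtain j where j: "n = 2 * j + 3" by blast
    have "{(p, q). n = 2 * p + 2 * q + 5} = (\<lambda>p. (p, j - 1 - p)) ` {..<j}"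
      unfolding j by force
    then have "card {(p, q). n = 2 * p + 2 * q + 5} = j"
      by (simp add: card_image inj_on_def)
    then show ?thesis using card j by simp
  next
    case False
    then have "{(p, q). n = 2 * p + 2 * q + 5} = {}" by auto
    then show ?thesis using card False by simp
  qed
qed

lemma two_card_eq: "2 * k = m * (m + 1) \<Longrightarrow> (of_nat k :: rat) = of_nat m * (of_nat m + 1) / 2"
proof -
  assume "2 * k = m * (m + 1)"
  then have "of_nat (2 * k) = (of_nat (m * (m + 1)) :: rat)" by simp
  then show ?thesis by (simp add: field_simps)
qed

lemma card_gaps_three: "2 \<le> n \<Longrightarrow> (of_nat (card gaps_three) :: rat) = (of_nat n - 2) * (of_nat n - 3) / 2"
proof -
  assume n: "2 \<le> n"
  have "inj_on (\<lambda>(p, r). gap_state p 3 r) {(p, r). p + r < n - 3}"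
    by (auto simp: inj_on_def gap_state_eq_iff)
  then have "card gaps_three = card {(p, r). p + r < n - 3}"
    unfolding gaps_three_def by (rule card_image)
  then have "2 * card gaps_three = (n - 3) * (n - 3 + 1)" by (simp only: card_pairs_sum_less)
  from two_card_eq[OF this] show ?thesis
    using n by (cases "n = 2") (auto simp: of_nat_diff algebra_simps)
qed

lemma card_gaps_two: "2 \<le> n \<Longrightarrow> (of_nat (card gaps_two) :: rat) = (of_nat n - 1) * (of_nat n - 2) / 2"
proof -
  assume n: "2 \<le> n"
  have "inj_on (\<lambda>(p, r). gap_state p 2 r) {(p, r). p + r < n - 2}"
    by (auto simp: inj_on_def gap_state_eq_iff)
  then have "card gaps_two = card {(p, r). p + r < n - 2}"
    unfolding gaps_two_def by (rule card_image)
  then have "2 * card gaps_two = (n - 2) * (n - 2 + 1)" by (simp only: card_pairs_sum_less)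
  from two_card_eq[OF this] show ?thesis
    using n by (auto simp: of_nat_diff algebra_simps)
qed

lemma card_gaps_two_sym: "2 \<le> n \<Longrightarrow> card gaps_two_sym = (if 3 dvd n then 1 else 0)"
proof -
  assume n: "2 \<le> n"
  show ?thesis
  proof (cases "3 dvd n")
    case True
    then obtain m where "n = 3 * m" by blast
    then have "{p. n = 3 * p + 3} = {m - 1}" using n by auto
    then show ?thesis using True unfolding gaps_two_sym_def by simp
  next
    case False
    then have "{p. n = 3 * p + 3} = {}" by auto
    then show ?thesis using False unfolding gaps_two_sym_def by simp
  qed
qed

lemma card_pairs: "2 \<le> n \<Longrightarrow> (of_nat (card pairs) :: rat) = of_nat n - 2"
proof -
  assume n: "2 \<le> n"
  have "inj_on pair_state {2..<n}" by (auto simp: inj_on_def pair_state_eq_iff)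
  then show ?thesis using n unfolding pairs_def by (simp add: card_image of_nat_diff)
qed

lemma card_pairs_sym: "2 \<le> n \<Longrightarrow> card pairs_sym = (if odd n then 1 else 0)"
proof -
  assume n: "2 \<le> n"
  show ?thesis
  proof (cases "odd n")
    case True
    then have "{x. 2 \<le> x \<and> n + 1 = 2 * x} = {(n + 1) div 2}" using n by (auto elim!: oddE)
    then show ?thesis using True unfolding pairs_sym_def by simp
  next
    case False
    then have "n + 1 \<noteq> 2 * x" for x by presburger
    then have "pairs_sym = {}" unfolding pairs_sym_def by blast
    then show ?thesis using False by simp
  qed
qed

lemma card_tops_wide_eq: "2 * card tops_wide = (n - 6) * (n - 6 + 1)"
proof -
  have "inj_on (\<lambda>(c, k). top_state (c + 1) (k + 3)) {(c, k). c + k < n - 6}"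
    by (auto simp: inj_on_def top_state_eq_iff)
  then have "card tops_wide = card {(c, k). c + k < n - 6}"
    unfolding tops_wide_def by (rule card_image)
  then show ?thesis by (simp only: card_pairs_sum_less)
qed

text \<open>At n = 5 the polynomial and the set both give 0, but at n = 4 the polynomial would be 1
  while the set is empty. This is one reason why the general tables start at 5.\<close>

lemma card_tops_wide: "5 \<le> n \<Longrightarrow> (of_nat (card tops_wide) :: rat) = (of_nat n - 5) * (of_nat n - 6) / 2"
  using two_card_eq[OF card_tops_wide_eq] by (cases "n = 5") (auto simp: of_nat_diff algebra_simps)

lemma card_tops_wide_sym: "card tops_wide_sym = (if n mod 3 = 1 \<and> 7 \<le> n then 1 else 0)"
proof (cases "n mod 3 = 1 \<and> 7 \<le> n")
  case True
  then have "n = 3 * ((n - 7) div 3) + 7" by presburger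
  then have "{c. n = 3 * c + 7} = {(n - 7) div 3}" by auto
  then show ?thesis using True unfolding tops_wide_sym_def by simp
next
  case False
  have "n \<noteq> 3 * c + 7" for c using False by presburger
  then have "{c. n = 3 * c + 7} = {}" by blast
  then show ?thesis using False unfolding tops_wide_sym_def by simp
qed

section \<open>Decomposition of the base states into disjoint classes\<close>

lemma reaches_trans:
  assumes "reaches I S" "\<And>J. J \<in> S \<Longrightarrow> reaches J T"
  shows "reaches I T"
proof -
  obtain k where "(row ^^ k) I \<in> S" using assms(1) unfolding reaches_def by blast
  then show ?thesis using reaches_steps[of k I "(row ^^ k) I" T] assms(2) unfolding steps_def by blast
qed

lemma base_states_ICS: "base_states \<subseteq> ICS (two_by n)"
proof
  fix I assume "I \<in> base_states"
  then consider p q r where "I = gap_state p q r" "2 \<le> q" "p + q + r < n" | x where "I = pair_state x" "2 \<le> x" "x < n"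
    | c k where "I = top_state c k" "1 \<le> c" "c + k \<le> n" | "I = st 1 0 1 0"
    unfolding base_states_def by blast
  then show "I \<in> ICS (two_by n)"
    by cases (simp_all add: gap_state_def pair_state_def top_state_def st_ICS valid_def)
qed

lemma tops_cases:
  assumes "1 \<le> c" "c + k \<le> n"
  shows "top_state c k \<in> tops_wide \<or> top_state c k \<in> tops_narrow \<or> top_state c k = top_state n 0"
proof (cases "k < 3 \<or> n < c + k + 3")
  case True
  then show ?thesis using assms unfolding tops_narrow_def by (cases "c = n") auto
next
  case False
  then have "top_state (c - 1 + 1) (k - 3 + 3) \<in> tops_wide" by (intro tops_wideI) (use assms in linarith)
  then show ?thesis using False assms by simp
qed

lemma base_states_split:
  assumes "1 \<le> n"
  shows "base_states = gaps_big \<union> gaps_three \<union> gaps_two \<union> pairs \<union> tops_wide \<union> tops_narrow \<union> {top_state n 0} \<union> {st 1 0 1 0}"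
    (is "_ = ?R")
proof
  show "base_states \<subseteq> ?R"
  proof
    fix I assume "I \<in> base_states"
    then consider p q r where "I = gap_state p q r" "2 \<le> q" "p + q + r < n" | x where "I = pair_state x" "2 \<le> x" "x < n"
      | c k where "I = top_state c k" "1 \<le> c" "c + k \<le> n" | "I = st 1 0 1 0"
      unfolding base_states_def by blast
    then show "I \<in> ?R"
    proof cases
      case (1 p q r)
      consider "q = 2" | "q = 3" | "4 \<le> q" using 1 by linarith
      then show ?thesis
      proof cases
        assume "q = 2"
        then show ?thesis using 1 gaps_twoI[of p r] by simp
      next
        assume "q = 3"
        then have "I \<in> gaps_three"
          unfolding gaps_three_def 1(1) using 1(3) by (intro image_eqI[of _ _ "(p, r)"]) auto
        then show ?thesis by simp
      next
        assume q: "4 \<le> q"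
        have "gap_state p (q - 4 + 4) r \<in> gaps_big" by (rule gaps_bigI) (use 1 q in linarith)
        then show ?thesis using 1 q by simp
      qed
    next
      case (2 x)
      then show ?thesis by (simp add: pairs_def)
    next
      case (3 c k)
      then show ?thesis using tops_cases[of c k] by blast
    next
      case 4
      then show ?thesis by simp
    qed
  qed
  have "gaps_big \<subseteq> base_states"
  proof
    fix I assume "I \<in> gaps_big"
    then obtain p q r s where s: "I = gap_state p (q + 4) r" "n = p + q + r + s + 5" by (rule gaps_bigE)
    have "2 \<le> q + 4 \<and> p + (q + 4) + r < n" using s(2) by simp
    then show "I \<in> base_states" unfolding s(1) base_states_def by blast
  qed
  moreover have "gaps_three \<subseteq> base_states"
  proof
    fix I assume "I \<in> gaps_three"
    then obtain p r s where s: "I = gap_state p 3 r" "n = p + r + s + 4" by (rule gaps_threeE)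
    have "2 \<le> (3::nat) \<and> p + 3 + r < n" using s(2) by simp
    then show "I \<in> base_states" unfolding s(1) base_states_def by blast
  qed
  moreover have "gaps_two \<subseteq> base_states"
  proof
    fix I assume "I \<in> gaps_two"
    then obtain p r s where s: "I = gap_state p 2 r" "n = p + r + s + 3" by (rule gaps_twoE)
    have "2 \<le> (2::nat) \<and> p + 2 + r < n" using s(2) by simp
    then show "I \<in> base_states" unfolding s(1) base_states_def by blast
  qed
  moreover have "pairs \<subseteq> base_states" by (auto simp: pairs_def base_states_def)
  moreover have "tops_wide \<subseteq> base_states"
  proof
    fix I assume "I \<in> tops_wide"
    then obtain c k g where s: "I = top_state (c + 1) (k + 3)" "n = c + k + g + 7" by (rule tops_wideE)
    have "1 \<le> c + 1 \<and> (c + 1) + (k + 3) \<le> n" using s(2) by simp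
    then show "I \<in> base_states" unfolding s(1) base_states_def by blast
  qed
  moreover have "tops_narrow \<subseteq> base_states" unfolding tops_narrow_def base_states_def by blast
  moreover have "top_state n 0 \<in> base_states"
  proof -
    have "1 \<le> n \<and> n + 0 \<le> n" using assms by simp
    then show ?thesis unfolding base_states_def by blast
  qed
  moreover have "st 1 0 1 0 \<in> base_states" unfolding base_states_def by blast
  ultimately show "?R \<subseteq> base_states" by blast
qed

lemma classes_disjoint:
  "gaps_big \<inter> gaps_three = {}" "gaps_big \<inter> gaps_two = {}" "gaps_three \<inter> gaps_two = {}"
  "(gaps_big \<union> gaps_three \<union> gaps_two) \<inter> pairs = {}"
  "(gaps_big \<union> gaps_three \<union> gaps_two \<union> pairs) \<inter> (tops_wide \<union> tops_narrow \<union> {top_state n 0}) = {}"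
  "st 1 0 1 0 \<notin> gaps_big \<union> gaps_three \<union> gaps_two \<union> pairs \<union> tops_wide \<union> tops_narrow \<union> {top_state n 0}"
  "tops_wide \<inter> (tops_narrow \<union> {top_state n 0}) = {}" "top_state n 0 \<notin> tops_narrow"
proof -
  have gb: "\<exists>p q r. 2 \<le> q \<and> I = gap_state p q r" if I: "I \<in> gaps_big \<union> gaps_three \<union> gaps_two" for I
  proof -
    from I show ?thesis
    proof (elim UnE)
      assume "I \<in> gaps_big"
      then obtain p q r s where "I = gap_state p (q + 4) r" "n = p + q + r + s + 5" by (rule gaps_bigE)
      then show ?thesis by (intro exI[of _ p] exI[of _ "q + 4"] exI[of _ r]) simp
    next
      assume "I \<in> gaps_three"
      then obtain p r s where "I = gap_state p 3 r" "n = p + r + s + 4" by (rule gaps_threeE)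
      then show ?thesis by (intro exI[of _ p] exI[of _ 3] exI[of _ r]) simp
    next
      assume "I \<in> gaps_two"
      then obtain p r s where "I = gap_state p 2 r" "n = p + r + s + 3" by (rule gaps_twoE)
      then show ?thesis by (intro exI[of _ p] exI[of _ 2] exI[of _ r]) simp
    qed
  qed
  have pa: "\<exists>x. 1 \<le> x \<and> I = pair_state x" if I: "I \<in> pairs" for I
  proof -
    obtain x where "I = pair_state x" "2 \<le> x" using I by (auto simp: pairs_def)
    then show ?thesis by (intro exI[of _ x]) simp
  qed
  have to: "\<exists>c k. I = top_state c k" if "I \<in> tops_wide \<union> tops_narrow \<union> {top_state n 0}" for I
    using that by (auto simp: tops_wide_def tops_narrow_def)
  show "gaps_big \<inter> gaps_three = {}" "gaps_big \<inter> gaps_two = {}" "gaps_three \<inter> gaps_two = {}"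
    by (auto simp: gaps_big_def gaps_three_def gaps_two_def gap_state_eq_iff)
  have gp: False if I: "I \<in> gaps_big \<union> gaps_three \<union> gaps_two" "I \<in> pairs" for I
  proof -
    obtain p q r x where "2 \<le> q" "I = gap_state p q r" "I = pair_state x" using gb[OF I(1)] pa[OF I(2)] by blast
    then show False using gap_neq_pair[of q p r x] by simp
  qed
  then show "(gaps_big \<union> gaps_three \<union> gaps_two) \<inter> pairs = {}" by blast
  have gt: False if I: "I \<in> gaps_big \<union> gaps_three \<union> gaps_two" "I \<in> tops_wide \<union> tops_narrow \<union> {top_state n 0}" for I
  proof -
    obtain p q r c k where "I = gap_state p q r" "I = top_state c k" using gb[OF I(1)] to[OF I(2)] by blast
    then show False using gap_neq_top[of p q r c k] by simp
  qed
  have pt: False if I: "I \<in> pairs" "I \<in> tops_wide \<union> tops_narrow \<union> {top_state n 0}" for I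
  proof -
    obtain x c k where "1 \<le> x" "I = pair_state x" "I = top_state c k" using pa[OF I(1)] to[OF I(2)] by blast
    then show False using pair_neq_top[of x c k] by simp
  qed
  show "(gaps_big \<union> gaps_three \<union> gaps_two \<union> pairs) \<inter> (tops_wide \<union> tops_narrow \<union> {top_state n 0}) = {}"
    using gt pt by blast
  have "I \<noteq> st 1 0 1 0" if I: "I \<in> gaps_big \<union> gaps_three \<union> gaps_two" for I
    using gb[OF I] neq_empty(1) by blast
  moreover have "I \<noteq> st 1 0 1 0" if I: "I \<in> pairs" for I
    using pa[OF I] neq_empty(2) by blast
  moreover have "I \<noteq> st 1 0 1 0" if I: "I \<in> tops_wide \<union> tops_narrow \<union> {top_state n 0}" for I
    using to[OF I] neq_empty(3) by blast
  ultimately show "st 1 0 1 0 \<notin> gaps_big \<union> gaps_three \<union> gaps_two \<union> pairs \<union> tops_wide \<union> tops_narrow \<union> {top_state n 0}"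
    by blast
  show "tops_wide \<inter> (tops_narrow \<union> {top_state n 0}) = {}"
    by (auto simp: tops_wide_def tops_narrow_def top_state_eq_iff)
  show "top_state n 0 \<notin> tops_narrow"
    by (auto simp: tops_narrow_def top_state_eq_iff)
qed

text \<open>What the classes above leave for the orbits through \<open>tops_narrow\<close>.\<close>

definition rest_size :: rat where
  "rest_size = of_nat (card (ICS (two_by n))) - (of_nat n + 3) * (of_nat (card gaps_big) / 2 +
     of_nat (card gaps_three) + of_nat (card gaps_two) / 3 + of_nat (card pairs) / 2 + 1) -
     (of_nat n + 5) * of_nat (card tops_wide) / 3 - 2"

lemma steps_empty: "1 \<le> n \<Longrightarrow> steps 2 (st 1 0 1 0) (st 1 0 1 0)"
  using row_empty row_full by (simp add: steps_def numeral_2_eq_2)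

lemma sorted_wrt_singletons:
  "distinct (map fst rl) \<Longrightarrow>
     sorted_wrt (\<lambda>c c'. fst c \<inter> fst c' = {}) (map (\<lambda>(I, L). ({I}, {}, 1, L)) rl)"
proof (induction rl)
  case (Cons c rl)
  have "fst c \<noteq> fst d" if "d \<in> set rl" for d
    using Cons.prems that by (metis distinct.simps(2) image_eqI list.simps(9) set_map)
  then show ?case using Cons by (auto simp: split_beta)
qed simp

section \<open>Orbit counts from a list of periods for the narrow top states\<close>

context
  fixes rl :: "((nat \<times> nat) set \<times> nat) list"
  assumes n2: "2 \<le> n" and dist: "distinct (map fst rl)" and narrow: "fst ` set rl \<subseteq> tops_narrow"
    and period: "\<And>I L. (I, L) \<in> set rl \<Longrightarrow> 0 < L \<and> steps L I I"
    and cover: "\<And>I. I \<in> tops_narrow \<Longrightarrow> reaches I (fst ` set rl)"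
    and total: "of_nat (\<Sum>(I, L)\<leftarrow>rl. L) = rest_size"
begin

definition "all_states = (\<Union>c\<in>set (classes rl). fst c)"

lemma all_states_eq:
  "all_states = gaps_big \<union> gaps_three \<union> gaps_two \<union> pairs \<union> tops_wide \<union> {top_state n 0} \<union> {st 1 0 1 0} \<union> fst ` set rl"
  unfolding all_states_def classes_def by (auto simp: split_beta)

lemma all_states_ICS: "all_states \<subseteq> ICS (two_by n)"
proof -
  have "1 \<le> n" using n2 by simp
  then have "all_states \<subseteq> base_states"
    unfolding all_states_eq using base_states_split narrow by blast
  then show ?thesis using base_states_ICS by blast
qed

lemma finite_all_states: "finite all_states"
  using all_states_ICS fin finite_subset by blast

lemma reaches_all_states:
  assumes "I \<in> ICS (two_by n)"
  shows "\<exists>k. (row ^^ k) I \<in> all_states"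
proof -
  have "reaches J all_states" if J: "J \<in> base_states" for J
  proof (cases "J \<in> tops_narrow")
    case True
    show ?thesis
      by (rule reaches_trans[OF cover[OF True]], rule reaches_self) (simp add: all_states_eq)
  next
    case False
    have "1 \<le> n" using n2 by simp
    from J False have "J \<in> all_states"
      unfolding base_states_split[OF \<open>1 \<le> n\<close>] all_states_eq by blast
    then show ?thesis by (rule reaches_self)
  qed
  then have "reaches I all_states" by (rule reaches_trans[OF reaches_base[OF assms]])
  then show ?thesis by (simp add: reaches_def)
qed

lemma classes_sorted: "sorted_wrt (\<lambda>c c'. fst c \<inter> fst c' = {}) (classes rl)"
proof -
  have d4: "gaps_big \<inter> pairs = {}" "gaps_three \<inter> pairs = {}" "gaps_two \<inter> pairs = {}"
    using classes_disjoint(4) by blast+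
  have d5: "gaps_big \<inter> tops_wide = {}" "gaps_big \<inter> tops_narrow = {}"
    "gaps_three \<inter> tops_wide = {}" "gaps_three \<inter> tops_narrow = {}"
    "gaps_two \<inter> tops_wide = {}" "gaps_two \<inter> tops_narrow = {}"
    "pairs \<inter> tops_wide = {}" "pairs \<inter> tops_narrow = {}"
    using classes_disjoint(5) by blast+
  have e5: "top_state n 0 \<notin> gaps_big" "top_state n 0 \<notin> gaps_three"
    "top_state n 0 \<notin> gaps_two" "top_state n 0 \<notin> pairs"
    using classes_disjoint(5) by blast+
  have d6: "st 1 0 1 0 \<notin> gaps_big" "st 1 0 1 0 \<notin> gaps_three" "st 1 0 1 0 \<notin> gaps_two"
    "st 1 0 1 0 \<notin> pairs" "st 1 0 1 0 \<notin> tops_wide" "st 1 0 1 0 \<notin> tops_narrow"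
    "st 1 0 1 0 \<noteq> top_state n 0" "top_state n 0 \<noteq> st 1 0 1 0"
    using classes_disjoint(6) by blast+
  have d7: "tops_wide \<inter> tops_narrow = {}" "top_state n 0 \<notin> tops_wide"
    using classes_disjoint(7) by blast+
  note disj = classes_disjoint(1-3) d4 d5 e5 d6 d7 classes_disjoint(8)
  let ?base = "[(gaps_big, gaps_big_sym, 2, n + 3), (gaps_three, {}, 1, n + 3),
     (gaps_two, gaps_two_sym, 3, n + 3), (pairs, pairs_sym, 2, n + 3),
     (tops_wide, tops_wide_sym, 3, n + 5), ({top_state n 0}, {}, 1, n + 3),
     ({st 1 0 1 0}, {}, 1, 2)]"
  have 1: "sorted_wrt (\<lambda>c c'. fst c \<inter> fst c' = {}) ?base"
    by (simp add: disj del: One_nat_def)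
  have 2: "sorted_wrt (\<lambda>c c'. fst c \<inter> fst c' = {}) (map (\<lambda>(I, L). ({I}, {}, 1, L)) rl)"
    using dist by (rule sorted_wrt_singletons)
  have 3: "\<forall>c\<in>set ?base. fst c \<inter> tops_narrow = {}"
    by (simp add: disj del: One_nat_def)
  let ?rest = "map (\<lambda>(I, L). ({I}, {} :: (nat \<times> nat) set set, 1 :: nat, L)) rl"
  have 4: "fst c \<subseteq> tops_narrow" if c: "c \<in> set ?rest" for c
  proof -
    from c obtain d where d: "d \<in> set rl" "c = (case d of (I, L) \<Rightarrow> ({I}, {}, 1, L))"
      unfolding set_map by (rule imageE)
    have "fst c = {fst d}" unfolding d(2) by (simp add: split_beta)
    moreover have "fst d \<in> tops_narrow" using narrow d(1) by blast
    ultimately show ?thesis by simp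
  qed
  show ?thesis
    unfolding classes_def sorted_wrt_append
  proof (intro conjI ballI)
    show "sorted_wrt (\<lambda>c c'. fst c \<inter> fst c' = {}) ?base" by (rule 1)
    show "sorted_wrt (\<lambda>c c'. fst c \<inter> fst c' = {}) ?rest" by (rule 2)
    fix c c' assume "c \<in> set ?base" "c' \<in> set ?rest"
    from bspec[OF 3 this(1)] 4[OF this(2)] show "fst c \<inter> fst c' = {}" by blast
  qed
qed

lemma classes_orbit_class:
  assumes "c \<in> set (classes rl)"
  shows "orbit_class row all_states c"
proof -
  have sub: "gaps_big \<subseteq> all_states" "gaps_three \<subseteq> all_states" "gaps_two \<subseteq> all_states" "pairs \<subseteq> all_states"
    "tops_wide \<subseteq> all_states" "{top_state n 0} \<subseteq> all_states" "{st 1 0 1 0} \<subseteq> all_states"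
    unfolding all_states_eq by blast+
  note single = orbit_class_single[OF _ all_states_ICS finite_all_states]
  have rl_single: "orbit_class row all_states ({I}, {}, 1, L)" if "(I, L) \<in> set rl" for I L
  proof (rule single)
    have "I \<in> fst ` set rl" using that by (rule image_eqI[rotated]) simp
    then show "{I} \<subseteq> all_states" unfolding all_states_eq by blast
  qed (use period[OF that] in auto)
  have top_single: "orbit_class row all_states ({top_state n 0}, {}, 1, n + 3)"
    by (rule single[OF sub(6)]) (use top_fixed n2 in auto)
  have empty_single: "orbit_class row all_states ({st 1 0 1 0}, {}, 1, 2)"
    by (rule single[OF sub(7)]) (use steps_empty n2 in auto)
  have "c \<in> {(gaps_big, gaps_big_sym, 2, n + 3), (gaps_three, {}, 1, n + 3),
     (gaps_two, gaps_two_sym, 3, n + 3), (pairs, pairs_sym, 2, n + 3),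
     (tops_wide, tops_wide_sym, 3, n + 5), ({top_state n 0}, {}, 1, n + 3),
     ({st 1 0 1 0}, {}, 1, 2)} \<union> (\<lambda>(I, L). ({I}, {}, 1, L)) ` set rl"
    using assms unfolding classes_def set_append set_map list.set by simp
  then consider "c = (gaps_big, gaps_big_sym, 2, n + 3)" | "c = (gaps_three, {}, 1, n + 3)"
    | "c = (gaps_two, gaps_two_sym, 3, n + 3)" | "c = (pairs, pairs_sym, 2, n + 3)"
    | "c = (tops_wide, tops_wide_sym, 3, n + 5)" | "c = ({top_state n 0}, {}, 1, n + 3)"
    | "c = ({st 1 0 1 0}, {}, 1, 2)" | d where "d \<in> set rl" "c = (case d of (I, L) \<Rightarrow> ({I}, {}, 1, L))"
    by (elim UnE imageE insertE emptyE) (rule that; assumption)+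
  then show ?thesis
  proof cases
    case 1
    then show ?thesis by (simp only: orbit_class_gaps_big[OF sub(1) finite_all_states])
  next
    case 2
    then show ?thesis by (simp only: orbit_class_gaps_three[OF sub(2) all_states_ICS finite_all_states])
  next
    case 3
    then show ?thesis by (simp only: orbit_class_gaps_two[OF sub(3) finite_all_states])
  next
    case 4
    then show ?thesis by (simp only: orbit_class_pairs[OF sub(4) finite_all_states])
  next
    case 5
    then show ?thesis by (simp only: orbit_class_tops_wide[OF sub(5) finite_all_states])
  next
    case 6
    then show ?thesis by (simp only: top_single)
  next
    case 7
    then show ?thesis by (simp only: empty_single)
  next
    case (8 d)
    then show ?thesis using rl_single[of "fst d" "snd d"] by (simp add: split_beta)
  qed
qed

text \<open>\<open>rest_size\<close> is what the other classes leave over, so the balance required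
  by the counting lemma amounts to the assumption that the periods in \<open>rl\<close> sum to
  it.\<close>

lemma classes_total:
  "(\<Sum>(C, F, M, L)\<leftarrow>classes rl. of_nat (card C * L) / of_nat M :: rat) = of_nat (card (ICS (two_by n)))"
proof -
  have "(\<Sum>(C, F, M, L)\<leftarrow>map (\<lambda>(I, L). ({I}, {} :: (nat \<times> nat) set set, 1::nat, L)) rl. of_nat (card C * L) / of_nat M :: rat) =
      of_nat (\<Sum>(I, L)\<leftarrow>rl. L)"
    by (induction rl) (auto split: prod.splits)
  also have "\<dots> = rest_size" by (rule total)
  finally have "(\<Sum>(C, F, M, L)\<leftarrow>classes rl. of_nat (card C * L) / of_nat M :: rat) =
      of_nat (card gaps_big * (n + 3)) / 2 + of_nat (card gaps_three * (n + 3)) + of_nat (card gaps_two * (n + 3)) / 3 +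
      of_nat (card pairs * (n + 3)) / 2 + of_nat (card tops_wide * (n + 5)) / 3 + (of_nat n + 3) + 2 + rest_size"
    unfolding classes_def by simp
  also have "\<dots> = of_nat (card (ICS (two_by n)))"
    unfolding rest_size_def by (simp add: field_simps)
  finally show ?thesis .
qed

lemma card_orbit_class:
  assumes "(C, F, M, L) \<in> set (classes rl)" "x \<in> C"
  shows "card (orbit row x) = (if x \<in> F then L div M else L) \<and>
    card (all_states \<inter> orbit row x) = (if x \<in> F then 1 else M)"
  by (rule orbit_classes_card[where cl = "classes rl", folded all_states_def])
    (use assms all_states_ICS reaches_all_states classes_sorted classes_orbit_class classes_total in \<open>blast+\<close>)

lemma orbit_count_classes:
  fixes s :: rat
  shows "of_nat (card {X \<in> rowmotion_orbits (two_by n) xs. of_nat (card X) = s}) =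
        (\<Sum>(C, F, M, L)\<leftarrow>classes rl. (if of_nat L = s then (of_nat (card C) - of_nat (card F)) / of_nat M else 0) +
          (if of_nat L / of_nat M = s then of_nat (card F) else 0) :: rat)"
  unfolding rowmotion_orbits_def
  by (rule orbit_classes_count[where cl = "classes rl", folded all_states_def])
    (use all_states_ICS reaches_all_states classes_sorted classes_orbit_class classes_total in \<open>blast+\<close>)

lemma orbit_count:
  fixes s :: rat
  shows "of_nat (card {X \<in> rowmotion_orbits (two_by n) xs. of_nat (card X) = s}) =
    (if of_nat n + 3 = s then (of_nat (card gaps_big) - of_nat (card gaps_big_sym)) / 2 + of_nat (card gaps_three) +
      (of_nat (card gaps_two) - of_nat (card gaps_two_sym)) / 3 + (of_nat (card pairs) - of_nat (card pairs_sym)) / 2 + 1 else 0) +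
    (if (of_nat n + 3) / 2 = s then of_nat (card gaps_big_sym) + of_nat (card pairs_sym) else 0) +
    (if (of_nat n + 3) / 3 = s then of_nat (card gaps_two_sym) else 0) +
    (if of_nat n + 5 = s then (of_nat (card tops_wide) - of_nat (card tops_wide_sym)) / 3 else 0) +
    (if (of_nat n + 5) / 3 = s then of_nat (card tops_wide_sym) else 0) +
    (if 2 = s then 1 else 0) + (\<Sum>(I, L)\<leftarrow>rl. if of_nat L = s then 1 else 0 :: rat)"
proof -
  \<comment> \<open>Written as products with indicators, the contributions of classes with the same
    period can be collected by ring arithmetic.\<close>
  have if_bool: "(if P then a else 0) = a * of_bool P" for P and a :: rat by simp
  have rl: "(\<Sum>(C, F, M, L)\<leftarrow>map (\<lambda>(I, L). ({I}, {} :: (nat \<times> nat) set set, 1::nat, L)) rl.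
      (if of_nat L = s then (of_nat (card C) - of_nat (card F)) / of_nat M else 0) +
      (if of_nat L / of_nat M = s then of_nat (card F) else 0) :: rat) =
      (\<Sum>(I, L)\<leftarrow>rl. if of_nat L = s then 1 else 0)"
    by (induction rl) (auto split: prod.splits)
  show ?thesis
    unfolding orbit_count_classes classes_def map_append sum_list_append rl
    by (simp add: if_bool algebra_simps)
qed

text \<open>The orbits in \<open>Q\<close> and the orbit \<open>Z\<close> are told apart from each
  other by their representatives and not by their sizes: each of them contains exactly one element
  of \<open>all_states\<close>.\<close>

lemma orbit_kinds:
  "\<exists>Z Q. Z \<in> rowmotion_orbits (two_by n) xs \<and> card Z = 2 \<and> Q \<subseteq> rowmotion_orbits (two_by n) xs - {Z} \<and>
     (\<forall>s :: rat. of_nat (card {X \<in> Q. of_nat (card X) = s}) = (\<Sum>(I, L)\<leftarrow>rl. if of_nat L = s then 1 else 0 :: rat)) \<and>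
     (\<forall>X \<in> rowmotion_orbits (two_by n) xs - {Z} - Q. card X dvd n + 3 \<or> card X dvd n + 5)"
proof -
  have rlc: "({I}, {}, 1, L) \<in> set (classes rl)" if "(I, L) \<in> set rl" for I L
    using that unfolding classes_def by force
  have rlo: "card (orbit row I) = L" "card (all_states \<inter> orbit row I) = 1" if "(I, L) \<in> set rl" for I L
    using card_orbit_class[OF rlc[OF that]] by simp_all
  have ec: "({st 1 0 1 0}, {}, 1, 2) \<in> set (classes rl)" unfolding classes_def by simp
  have eo: "card (orbit row (st 1 0 1 0)) = 2" "card (all_states \<inter> orbit row (st 1 0 1 0)) = 1"
    using card_orbit_class[OF ec] by simp_all
  have rlS: "I \<in> all_states" if "(I, L) \<in> set rl" for I L
    using that unfolding all_states_eq by force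
  have eS: "st 1 0 1 0 \<in> all_states" unfolding all_states_eq by simp
  have unique: "I = J" if "card (all_states \<inter> orbit row I) = 1" "I \<in> all_states" "J \<in> all_states"
      "orbit row I = orbit row J" for I J
  proof -
    have "I \<in> all_states \<inter> orbit row I" "J \<in> all_states \<inter> orbit row I"
      using that orbit_self[of I] orbit_self[of J] all_states_ICS by auto
    then show ?thesis using that(1) by (metis card_1_singletonE singletonD)
  qed
  define Z where "Z = orbit row (st 1 0 1 0)"
  define Q where "Q = (\<lambda>(I, L). orbit row I) ` set rl"
  have "Z \<in> rowmotion_orbits (two_by n) xs"
    unfolding Z_def rowmotion_orbits_def using eS all_states_ICS by blast
  moreover have "card Z = 2" using eo by (simp add: Z_def)
  moreover have "Q \<subseteq> rowmotion_orbits (two_by n) xs - {Z}"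
  proof
    fix X assume "X \<in> Q"
    then obtain I L where IL: "(I, L) \<in> set rl" "X = orbit row I" by (auto simp: Q_def)
    have "I \<in> tops_narrow" using IL(1) narrow by force
    then have "I \<noteq> st 1 0 1 0" using classes_disjoint(6) by blast
    then have "X \<noteq> Z" using unique[OF eo(2) eS rlS[OF IL(1)]] IL(2) unfolding Z_def by metis
    then show "X \<in> rowmotion_orbits (two_by n) xs - {Z}"
      using IL rlS[OF IL(1)] all_states_ICS unfolding rowmotion_orbits_def by blast
  qed
  moreover have "of_nat (card {X \<in> Q. of_nat (card X) = s}) = (\<Sum>(I, L)\<leftarrow>rl. if of_nat L = s then 1 else 0 :: rat)" for s :: rat
  proof -
    have dist_rl: "distinct rl" using dist by (simp add: distinct_map)
    have inj: "inj_on (\<lambda>(I, L). orbit row I) (set rl)"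
    proof (rule inj_onI)
      fix c d assume cd: "c \<in> set rl" "d \<in> set rl" "(case c of (I, L) \<Rightarrow> orbit row I) = (case d of (I, L) \<Rightarrow> orbit row I)"
      obtain I L J K where IL: "c = (I, L)" "d = (J, K)" by (metis surj_pair)
      have mem: "(I, L) \<in> set rl" "(J, K) \<in> set rl" and eq: "orbit row I = orbit row J"
        using cd IL by simp_all
      have "I = J" by (rule unique[OF rlo(2)[OF mem(1)] rlS[OF mem(1)] rlS[OF mem(2)] eq])
      moreover have "L = K" using rlo(1)[OF mem(1)] rlo(1)[OF mem(2)] eq by simp
      ultimately show "c = d" using IL by simp
    qed
    have "{X \<in> Q. of_nat (card X) = s} = (\<lambda>(I, L). orbit row I) ` {(I, L) \<in> set rl. of_nat L = s}"
      using rlo(1) unfolding Q_def by force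
    then have "card {X \<in> Q. of_nat (card X) = s} = card {(I, L) \<in> set rl. of_nat L = s}"
      by (simp add: card_image inj_on_subset[OF inj] subset_iff)
    also have "{(I, L) \<in> set rl. of_nat L = s} = set (filter (\<lambda>(I, L). of_nat L = s) rl)" by auto
    also have "card \<dots> = length (filter (\<lambda>(I, L). of_nat L = s) rl)"
      by (rule distinct_card, rule distinct_filter[OF dist_rl])
    also have "of_nat \<dots> = (\<Sum>(I, L)\<leftarrow>rl. if of_nat L = s then 1 else 0 :: rat)"
      by (induction rl) (auto split: prod.splits)
    finally show ?thesis .
  qed
  moreover have "card X dvd n + 3 \<or> card X dvd n + 5" if X: "X \<in> rowmotion_orbits (two_by n) xs - {Z} - Q" for X
  proof -
    have "X \<in> orbit row ` all_states"
      using X orbits_from_section[OF all_states_ICS reaches_all_states] unfolding rowmotion_orbits_def by simp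
    then obtain I where I: "I \<in> all_states" "X = orbit row I" by blast
    then obtain c where c: "c \<in> set (classes rl)" "I \<in> fst c" unfolding all_states_def by blast
    obtain C F M L where cc: "c = (C, F, M, L)" by (metis prod_cases4)
    have card: "card X = (if I \<in> F then L div M else L)"
      using card_orbit_class[of C F M L I] c cc I by simp
    have "card X dvd L"
      using orbit_classD(4)[OF classes_orbit_class[OF c(1)[unfolded cc]], of I] card
      by (metis dvd_div_mult_self dvd_refl dvd_triv_left)
    \<comment> \<open>Excluding \<open>Z\<close> and \<open>Q\<close> removes the class of the empty
      set and the entries from \<open>rl\<close>; the six classes that remain have these two
      periods.\<close>
    moreover have "L = n + 3 \<or> L = n + 5"
      using c X I unfolding cc classes_def Z_def Q_def by force
    ultimately show ?thesis by auto
  qed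
  ultimately show ?thesis by blast
qed

end

section \<open>The orbits of quadratic size\<close>

text \<open>In the triples \<open>(c + 2, l, g)\<close> with middle gap \<open>l \<le> 2\<close>, the coordinate \<open>u\<close> is \<open>g\<close> for \<open>l = 0\<close> and \<open>g + 1\<close>
  otherwise. With this shift every return lowers \<open>u\<close> by 3 and exchanges the lines 0 and 2, and all
  three lines end at \<open>u \<in> {1, 2, 3}\<close>.\<close>

definition line :: "nat \<Rightarrow> nat \<Rightarrow> (nat \<times> nat) set" where
  "line l u = (if l = 2 then top_state (n - 1 - u) 2 else top_state (n - u) l)"

definition line_ends :: "(nat \<times> nat) set set" where
  "line_ends = {line l u | l u. l \<le> 2 \<and> 1 \<le> u \<and> u \<le> 3}"

lemma steps_eq: "steps k I J \<Longrightarrow> k = l \<Longrightarrow> I = I' \<Longrightarrow> J = J' \<Longrightarrow> steps l I' J'"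
  by simp

text \<open>The rotation takes \<open>(x, l, z)\<close> to \<open>(z, x, l)\<close> in z + 1 steps,
  and the end step for last gap \<open>l\<close> takes x + l + 3 more. As x + l + z = n + 2, the sum
  is n + 6 on every line. Here l = 0; the two lemmas below do l = 1 and l = 2.\<close>

lemma line_step_0:
  assumes "4 \<le> u" "u < n"
  shows "steps (n + 6) (line 0 u) (line 2 (u - 3))"
proof -
  have "steps (u - 3 + 4) (top_state (n - u) 0) (top_state (u - 3 + 1) (n - u + 2))"
    by (rule top_rotate) (use assms in auto)
  also have "steps (n - u + 2 + 3) \<dots> (top_state (n - u + 2) 2)"
    by (rule top_end_0) (use assms in auto)
  finally show ?thesis unfolding line_def by (rule steps_eq) (use assms in \<open>auto simp: top_state_eq_iff\<close>)
qed

lemma line_step_1: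
  assumes "4 \<le> u" "u < n"
  shows "steps (n + 6) (line 1 u) (line 1 (u - 3))"
proof -
  have "steps (u - 4 + 4) (top_state (n - u) 1) (top_state (u - 4 + 1) (n - u + 2))"
    by (rule top_rotate) (use assms in auto)
  also have "steps (n - u + 2 + 4) \<dots> (top_state (n - u + 2 + 1) 1)"
    by (rule top_end_1) (use assms in auto)
  finally show ?thesis unfolding line_def by (rule steps_eq) (use assms in \<open>auto simp: top_state_eq_iff\<close>)
qed

lemma line_step_2:
  assumes "4 \<le> u" "u < n - 1"
  shows "steps (n + 6) (line 2 u) (line 0 (u - 3))"
proof -
  have "steps (u - 4 + 4) (top_state (n - 1 - u) 2) (top_state (u - 4 + 1) (n - 1 - u + 2))"
    by (rule top_rotate) (use assms in auto)
  also have "steps (n - 1 - u + 2 + 5) \<dots> (top_state (n - 1 - u + 2 + 2) 0)"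
    by (rule top_end_2) (use assms in auto)
  finally show ?thesis unfolding line_def by (rule steps_eq) (use assms in \<open>auto simp: top_state_eq_iff\<close>)
qed

lemma line_step:
  assumes "l \<le> 2" "4 \<le> u" "u + (if l = 2 then 2 else 1) \<le> n"
  shows "steps (n + 6) (line l u) (line (2 - l) (u - 3))"
proof -
  consider "l = 0" | "l = 1" | "l = 2" using assms(1) by linarith
  then show ?thesis
    using assms line_step_0[of u] line_step_1[of u] line_step_2[of u] by cases auto
qed

lemma line_descend:
  assumes "l \<le> 2" "1 \<le> u" "u + 3 * v + (if l = 2 then 2 else 1) \<le> n"
  shows "steps (v * (n + 6)) (line l (u + 3 * v)) (line (if even v then l else 2 - l) u)"
  using assms
proof (induction v arbitrary: l)
  case 0
  then show ?case by (simp add: steps_0)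
next
  case (Suc v)
  have "steps (n + 6) (line l (u + 3 * Suc v)) (line (2 - l) (u + 3 * Suc v - 3))"
    by (rule line_step) (use Suc.prems in auto)
  moreover have "u + 3 * Suc v - 3 = u + 3 * v" by simp
  ultimately have "steps (n + 6) (line l (u + 3 * Suc v)) (line (2 - l) (u + 3 * v))" by simp
  also have "steps (v * (n + 6)) \<dots> (line (if even v then 2 - l else 2 - (2 - l)) u)"
    by (rule Suc.IH) (use Suc.prems in \<open>auto split: if_splits\<close>)
  finally show ?case using Suc.prems(1) by (rule_tac steps_cong) auto
qed

text \<open>An exit of \<open>t\<close> steps to height \<open>m\<close> followed by
  \<open>v\<close> translations. Each stop of a tour is one instance, with \<open>v\<close> and the
  parity of \<open>v\<close> as its only data.\<close>

lemma line_return: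
  assumes "steps t I (line l m)" "m = u + 3 * v" "1 \<le> u" "l \<le> 2" "m + (if l = 2 then 2 else 1) \<le> n"
    "l' = (if even v then l else 2 - l)"
  shows "steps (t + v * (n + 6)) I (line l' u)"
proof -
  have "steps (v * (n + 6)) (line l m) (line l' u)"
    unfolding assms(2,6) by (rule line_descend) (use assms in auto)
  with assms(1) show ?thesis by (rule steps_trans)
qed

lemma line_exits:
  assumes "5 \<le> n"
  shows "steps 4 (line 0 1) (line 1 (n - 1))"
    and "steps 5 (line 0 2) (line 0 (n - 2))"
    and "steps 6 (line 0 3) (line 0 (n - 1))"
    and "steps 4 (line 1 1) (line 2 (n - 2))"
    and "steps 5 (line 1 2) (line 1 (n - 2))"
    and "steps 6 (line 1 3) (line 0 (n - 3))"
    and "steps 5 (line 2 1) (line 2 (n - 3))"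
    and "steps 6 (line 2 2) (line 1 (n - 3))"
    and "steps 7 (line 2 3) (line 0 (n - 4))"
proof -
  show "steps 4 (line 0 1) (line 1 (n - 1))"
    unfolding line_def by (rule steps_eq[OF top_end_1[of "n - 1" 0]]) (use assms in \<open>auto simp: top_state_eq_iff\<close>)
  show "steps 5 (line 0 2) (line 0 (n - 2))"
    unfolding line_def by (rule steps_eq[OF top_end_2[of "n - 2" 0]]) (use assms in \<open>auto simp: top_state_eq_iff\<close>)
  have "steps (0 + 4) (top_state (n - 3) 0) (top_state (0 + 1) (n - 3 + 2))"
    by (rule top_rotate) (use assms in auto)
  also have "\<dots> = top_state 1 (n - 1)" using assms by (simp add: top_state_eq_iff)
  also have "steps 2 \<dots> (top_state 1 0)" by (rule top_full_row) (use assms in auto)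
  finally show "steps 6 (line 0 3) (line 0 (n - 1))"
    unfolding line_def by (rule steps_eq) (use assms in \<open>auto simp: top_state_eq_iff\<close>)
  show "steps 4 (line 1 1) (line 2 (n - 2))"
    unfolding line_def by (rule steps_eq[OF top_end_0[of "n - 1" 1]]) (use assms in \<open>auto simp: top_state_eq_iff\<close>)
  show "steps 5 (line 1 2) (line 1 (n - 2))"
    unfolding line_def by (rule steps_eq[OF top_end_1[of "n - 2" 1]]) (use assms in \<open>auto simp: top_state_eq_iff\<close>)
  show "steps 6 (line 1 3) (line 0 (n - 3))"
    unfolding line_def by (rule steps_eq[OF top_end_2[of "n - 3" 1]]) (use assms in \<open>auto simp: top_state_eq_iff\<close>)
  show "steps 5 (line 2 1) (line 2 (n - 3))"
    unfolding line_def by (rule steps_eq[OF top_end_0[of "n - 2" 2]]) (use assms in \<open>auto simp: top_state_eq_iff\<close>)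
  show "steps 6 (line 2 2) (line 1 (n - 3))"
    unfolding line_def by (rule steps_eq[OF top_end_1[of "n - 3" 2]]) (use assms in \<open>auto simp: top_state_eq_iff\<close>)
  show "steps 7 (line 2 3) (line 0 (n - 4))"
    unfolding line_def by (rule steps_eq[OF top_end_2[of "n - 4" 2]]) (use assms in \<open>auto simp: top_state_eq_iff\<close>)
qed

lemmas line_returns = line_exits[THEN line_return]

lemma reaches_line_ends:
  assumes "l \<le> 2" "1 \<le> u" "u + (if l = 2 then 2 else 1) \<le> n"
  shows "reaches (line l u) line_ends"
proof -
  \<comment> \<open>The residue of \<open>u\<close> mod 3 is taken in {1, 2, 3}, the heights at
    which the lines end.\<close>
  define w v where "w = (u - 1) mod 3 + 1" and "v = (u - 1) div 3"
  have "(u - 1) mod 3 + 3 * ((u - 1) div 3) = u - 1" "(u - 1) mod 3 < 3"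
    by simp_all
  then have u: "u = w + 3 * v" "1 \<le> w" "w \<le> 3"
    using assms(2) unfolding w_def v_def by linarith+
  have "steps (v * (n + 6)) (line l u) (line (if even v then l else 2 - l) w)"
    unfolding u(1) by (rule line_descend) (use assms u in \<open>simp_all only:\<close>)
  moreover have "line (if even v then l else 2 - l) w \<in> line_ends"
  proof -
    have "(if even v then l else 2 - l) \<le> 2 \<and> 1 \<le> w \<and> w \<le> 3" using assms(1) u(2,3) by simp
    then show ?thesis unfolding line_ends_def by blast
  qed
  ultimately show ?thesis by (rule reaches_steps[OF _ reaches_self])
qed

text \<open>A small middle gap means that the state lies on a line. Otherwise the last gap is at
  most 2, and one end step, or the passage through the full top row, leads onto a line.\<close>

lemma tops_narrow_reach:
  assumes "5 \<le> n" "I \<in> tops_narrow"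
  shows "reaches I line_ends"
proof -
  obtain c k where I: "I = top_state c k" and ck: "1 \<le> c" "c + k \<le> n" "k < 3 \<or> n < c + k + 3" "c \<noteq> n"
    using assms(2) unfolding tops_narrow_def by blast
  consider "k < 2" | "k = 2" | "3 \<le> k" "n = c + k + 2" | "3 \<le> k" "n = c + k + 1"
    | "3 \<le> k" "n = c + k" "2 \<le> c" | "3 \<le> k" "n = c + k" "c = 1"
    using ck by linarith
  then show ?thesis
  proof cases
    case 1
    have eq: "I = line k (n - c)" unfolding I line_def using ck 1 by (simp add: top_state_eq_iff)
    show ?thesis unfolding eq by (rule reaches_line_ends) (use ck 1 in auto)
  next
    case 2
    have eq: "I = line 2 (n - 1 - c)" unfolding I line_def using ck 2 by (simp add: top_state_eq_iff)
    show ?thesis unfolding eq by (rule reaches_line_ends) (use ck 2 in auto)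
  next
    case 3
    have "steps (k + 5) I (line 0 (c))" unfolding I line_def
      by (rule steps_eq[OF top_end_2[of c k]]) (use ck 3 assms in \<open>auto simp: top_state_eq_iff\<close>)
    then show ?thesis by (rule reaches_steps) (rule reaches_line_ends, use ck 3 assms in auto)
  next
    case 4
    have "steps (k + 4) I (line 1 (c))" unfolding I line_def
      by (rule steps_eq[OF top_end_1[of c k]]) (use ck 4 assms in \<open>auto simp: top_state_eq_iff\<close>)
    then show ?thesis by (rule reaches_steps) (rule reaches_line_ends, use ck 4 assms in auto)
  next
    case 5
    have "steps (k + 3) I (line 2 (c - 1))" unfolding I line_def
      by (rule steps_eq[OF top_end_0[of c k]]) (use ck 5 assms in \<open>auto simp: top_state_eq_iff\<close>)
    then show ?thesis by (rule reaches_steps) (rule reaches_line_ends, use ck 5 assms in auto)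
  next
    case 6
    have "steps (2) I (line 0 (n - 1))" unfolding I line_def
      by (rule steps_eq[OF top_full_row]) (use ck 6 assms in \<open>auto simp: top_state_eq_iff\<close>)
    then show ?thesis by (rule reaches_steps) (rule reaches_line_ends, use ck 6 assms in auto)
  qed
qed

lemma line_ends_narrow: "5 \<le> n \<Longrightarrow> line_ends \<subseteq> tops_narrow"
proof
  fix I assume n: "5 \<le> n" and "I \<in> line_ends"
  then obtain l u where I: "I = line l u" "l \<le> 2" "1 \<le> u" "u \<le> 3" unfolding line_ends_def by blast
  show "I \<in> tops_narrow"
  proof (cases "l = 2")
    case True
    have "1 \<le> n - 1 - u \<and> (n - 1 - u) + 2 \<le> n \<and> (2 < (3::nat) \<or> n < (n - 1 - u) + 2 + 3) \<and> n - 1 - u \<noteq> n"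
      using n I by auto
    then show ?thesis unfolding I(1) line_def tops_narrow_def if_P[OF True] by blast
  next
    case False
    have "1 \<le> n - u \<and> (n - u) + l \<le> n \<and> (l < 3 \<or> n < (n - u) + l + 3) \<and> n - u \<noteq> n"
      using n I False by auto
    then show ?thesis unfolding I(1) line_def tops_narrow_def if_not_P[OF False] by blast
  qed
qed

lemma card_ICS_rat: "(of_nat (card (ICS (two_by n))) :: rat) =
    of_nat n * (of_nat n + 1)\<^sup>2 * (of_nat n + 2) / 12 + of_nat n * (of_nat n + 1) + 1"
proof -
  have "of_nat (12 * card (ICS (two_by n))) =
      (of_nat (n * (n + 1)\<^sup>2 * (n + 2) + 12 * n * (n + 1) + 12) :: rat)"
    by (simp only: card_ICS)
  then show ?thesis by (simp add: field_simps)
qed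

text \<open>The leading term agrees with nine descents of about n/3 translations of n + 6 steps
  each.\<close>

lemma rest_size_large: "5 \<le> n \<Longrightarrow> rest_size = 3 * (of_nat n)\<^sup>2 + 5 * of_nat n - 30"
  by (simp add: rest_size_def card_ICS_rat card_gaps_big card_gaps_three card_gaps_two card_pairs card_tops_wide
      field_simps power2_eq_square)

text \<open>The residue mod 6 enters only through the symmetric members: parity decides
  \<open>gaps_big_sym\<close> and \<open>pairs_sym\<close>, the residue mod 3 decides
  \<open>gaps_two_sym\<close> and \<open>tops_wide_sym\<close>.\<close>

lemma linear_table_sum:
  fixes s :: rat
  assumes "5 \<le> n"
  shows "(\<Sum>(s', c) \<leftarrow> linear_table n. if s' = s then c else 0) =
    (if of_nat n + 3 = s then (of_nat (card gaps_big) - of_nat (card gaps_big_sym)) / 2 + of_nat (card gaps_three) +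
      (of_nat (card gaps_two) - of_nat (card gaps_two_sym)) / 3 + (of_nat (card pairs) - of_nat (card pairs_sym)) / 2 + 1 else 0) +
    (if (of_nat n + 3) / 2 = s then of_nat (card gaps_big_sym) + of_nat (card pairs_sym) else 0) +
    (if (of_nat n + 3) / 3 = s then of_nat (card gaps_two_sym) else 0) +
    (if of_nat n + 5 = s then (of_nat (card tops_wide) - of_nat (card tops_wide_sym)) / 3 else 0) +
    (if (of_nat n + 5) / 3 = s then of_nat (card tops_wide_sym) else 0)"
proof -
  define N where "N = (of_nat n :: rat)"
  have expand: "(\<Sum>(s', c) \<leftarrow> [(N + 3, a1), ((N + 3) / 2, a2), ((N + 3) / 3, a3), (N + 5, a4), ((N + 5) / 3, a5)]. if s' = s then c else 0) =
      (if N + 3 = s then a1 else 0) + (if (N + 3) / 2 = s then a2 else 0) + (if (N + 3) / 3 = s then a3 else 0) +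
      (if N + 5 = s then a4 else 0) + (if (N + 5) / 3 = s then a5 else 0)" for a1 a2 a3 a4 a5 :: rat
    by (simp only: list.map sum_list.Cons sum_list.Nil prod.case add_0_right add.assoc)
  have n2: "2 \<le> n" using assms by simp
  note cards = card_gaps_big[OF n2] card_gaps_big_sym[OF n2] card_gaps_three[OF n2] card_gaps_two[OF n2]
    card_gaps_two_sym[OF n2] card_pairs[OF n2] card_pairs_sym[OF n2] card_tops_wide[OF assms]
  let ?x1 = "(of_nat (card gaps_big) - of_nat (card gaps_big_sym)) / 2 + of_nat (card gaps_three) +
      (of_nat (card gaps_two) - of_nat (card gaps_two_sym)) / 3 + (of_nat (card pairs) - of_nat (card pairs_sym)) / 2 + 1 :: rat"
  let ?x2 = "of_nat (card gaps_big_sym) + of_nat (card pairs_sym) :: rat"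
  let ?x3 = "of_nat (card gaps_two_sym) :: rat"
  let ?x4 = "(of_nat (card tops_wide) - of_nat (card tops_wide_sym)) / 3 :: rat"
  let ?x5 = "of_nat (card tops_wide_sym) :: rat"
  consider "n mod 6 = 0" | "n mod 6 = 1" | "n mod 6 = 2" | "n mod 6 = 3" | "n mod 6 = 4" | "n mod 6 = 5"
    by linarith
  then show ?thesis
  proof cases
    case 1
    have n: "even n" "3 dvd n" "n mod 3 \<noteq> 1"
      using 1 assms by presburger+
    have sym: "card tops_wide_sym = 0"
      unfolding card_tops_wide_sym using n by (simp only: if_True if_False simp_thms)
    have table: "linear_table n = [(N+3, (N^3 - N^2 - 4*N + 12) / 12), ((N+3)/2, 0), ((N+3)/3, 1), (N+5, (N^2 - 11*N + 30) / 6), ((N+5)/3, 0)]"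
      by (simp add: linear_table_def Let_def 1 N_def)
    have coeffs:
      "?x1 = ((N^3 - N^2 - 4*N + 12) / 12 :: rat)"
      "?x2 = (0 :: rat)"
      "?x3 = (1 :: rat)"
      "?x4 = ((N^2 - 11*N + 30) / 6 :: rat)"
      "?x5 = (0 :: rat)"
      by (simp_all add: cards sym n N_def[symmetric] field_simps power2_eq_square power3_eq_cube)
    show ?thesis
      unfolding table expand N_def[symmetric]
      by (intro arg_cong2[of _ _ _ _ "(+)"] if_cong refl coeffs[symmetric])
  next
    case 2
    have n: "odd n" "\<not> 3 dvd n" "n mod 3 = 1" "7 \<le> n"
      using 2 assms by presburger+
    have sym: "card tops_wide_sym = 1"
      unfolding card_tops_wide_sym using n by (simp only: if_True if_False simp_thms)
    have table: "linear_table n = [(N+3, (N^3 - N^2 - 7*N + 19) / 12), ((N+3)/2, (N-1)/2), ((N+3)/3, 0), (N+5, (N^2 - 11*N + 28) / 6), ((N+5)/3, 1)]"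
      by (simp add: linear_table_def Let_def 2 N_def)
    have coeffs:
      "?x1 = ((N^3 - N^2 - 7*N + 19) / 12 :: rat)"
      "?x2 = ((N-1)/2 :: rat)"
      "?x3 = (0 :: rat)"
      "?x4 = ((N^2 - 11*N + 28) / 6 :: rat)"
      "?x5 = (1 :: rat)"
      by (simp_all add: cards sym n N_def[symmetric] field_simps power2_eq_square power3_eq_cube)
    show ?thesis
      unfolding table expand N_def[symmetric]
      by (intro arg_cong2[of _ _ _ _ "(+)"] if_cong refl coeffs[symmetric])
  next
    case 3
    have n: "even n" "\<not> 3 dvd n" "n mod 3 \<noteq> 1"
      using 3 assms by presburger+
    have sym: "card tops_wide_sym = 0"
      unfolding card_tops_wide_sym using n by (simp only: if_True if_False simp_thms)
    have table: "linear_table n = [(N+3, (N^3 - N^2 - 4*N + 16) / 12), ((N+3)/2, 0), ((N+3)/3, 0), (N+5, (N^2 - 11*N + 30) / 6), ((N+5)/3, 0)]"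
      by (simp add: linear_table_def Let_def 3 N_def)
    have coeffs:
      "?x1 = ((N^3 - N^2 - 4*N + 16) / 12 :: rat)"
      "?x2 = (0 :: rat)"
      "?x3 = (0 :: rat)"
      "?x4 = ((N^2 - 11*N + 30) / 6 :: rat)"
      "?x5 = (0 :: rat)"
      by (simp_all add: cards sym n N_def[symmetric] field_simps power2_eq_square power3_eq_cube)
    show ?thesis
      unfolding table expand N_def[symmetric]
      by (intro arg_cong2[of _ _ _ _ "(+)"] if_cong refl coeffs[symmetric])
  next
    case 4
    have n: "odd n" "3 dvd n" "n mod 3 \<noteq> 1"
      using 4 assms by presburger+
    have sym: "card tops_wide_sym = 0"
      unfolding card_tops_wide_sym using n by (simp only: if_True if_False simp_thms)
    have table: "linear_table n = [(N+3, (N^3 - N^2 - 7*N + 15) / 12), ((N+3)/2, (N-1)/2), ((N+3)/3, 1), (N+5, (N^2 - 11*N + 30) / 6), ((N+5)/3, 0)]"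
      by (simp add: linear_table_def Let_def 4 N_def)
    have coeffs:
      "?x1 = ((N^3 - N^2 - 7*N + 15) / 12 :: rat)"
      "?x2 = ((N-1)/2 :: rat)"
      "?x3 = (1 :: rat)"
      "?x4 = ((N^2 - 11*N + 30) / 6 :: rat)"
      "?x5 = (0 :: rat)"
      by (simp_all add: cards sym n N_def[symmetric] field_simps power2_eq_square power3_eq_cube)
    show ?thesis
      unfolding table expand N_def[symmetric]
      by (intro arg_cong2[of _ _ _ _ "(+)"] if_cong refl coeffs[symmetric])
  next
    case 5
    have n: "even n" "\<not> 3 dvd n" "n mod 3 = 1" "7 \<le> n"
      using 5 assms by presburger+
    have sym: "card tops_wide_sym = 1"
      unfolding card_tops_wide_sym using n by (simp only: if_True if_False simp_thms)
    have table: "linear_table n = [(N+3, (N^3 - N^2 - 4*N + 16) / 12), ((N+3)/2, 0), ((N+3)/3, 0), (N+5, (N^2 - 11*N + 28) / 6), ((N+5)/3, 1)]"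
      by (simp add: linear_table_def Let_def 5 N_def)
    have coeffs:
      "?x1 = ((N^3 - N^2 - 4*N + 16) / 12 :: rat)"
      "?x2 = (0 :: rat)"
      "?x3 = (0 :: rat)"
      "?x4 = ((N^2 - 11*N + 28) / 6 :: rat)"
      "?x5 = (1 :: rat)"
      by (simp_all add: cards sym n N_def[symmetric] field_simps power2_eq_square power3_eq_cube)
    show ?thesis
      unfolding table expand N_def[symmetric]
      by (intro arg_cong2[of _ _ _ _ "(+)"] if_cong refl coeffs[symmetric])
  next
    case 6
    have n: "odd n" "\<not> 3 dvd n" "n mod 3 \<noteq> 1"
      using 6 assms by presburger+
    have sym: "card tops_wide_sym = 0"
      unfolding card_tops_wide_sym using n by (simp only: if_True if_False simp_thms)
    have table: "linear_table n = [(N+3, (N^3 - N^2 - 7*N + 19) / 12), ((N+3)/2, (N-1)/2), ((N+3)/3, 0), (N+5, (N^2 - 11*N + 30) / 6), ((N+5)/3, 0)]"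
      by (simp add: linear_table_def Let_def 6 N_def)
    have coeffs:
      "?x1 = ((N^3 - N^2 - 7*N + 19) / 12 :: rat)"
      "?x2 = ((N-1)/2 :: rat)"
      "?x3 = (0 :: rat)"
      "?x4 = ((N^2 - 11*N + 30) / 6 :: rat)"
      "?x5 = (0 :: rat)"
      by (simp_all add: cards sym n N_def[symmetric] field_simps power2_eq_square power3_eq_cube)
    show ?thesis
      unfolding table expand N_def[symmetric]
      by (intro arg_cong2[of _ _ _ _ "(+)"] if_cong refl coeffs[symmetric])
  qed
qed

section \<open>Closed tours through the line ends\<close>

primrec tour :: "(nat \<times> nat) set \<Rightarrow> (nat \<times> (nat \<times> nat) set) list \<Rightarrow> (nat \<times> nat) set \<Rightarrow> bool" where
  "tour I [] J \<longleftrightarrow> I = J"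
| "tour I (p # ps) J \<longleftrightarrow> 0 < fst p \<and> steps (fst p) I (snd p) \<and> tour (snd p) ps J"

lemma tour_steps: "tour I ps J \<Longrightarrow> steps (\<Sum>p\<leftarrow>ps. fst p) I J"
  by (induction ps arbitrary: I) (auto simp: steps_0 intro: steps_trans)

lemma tour_pos: "tour I ps J \<Longrightarrow> ps \<noteq> [] \<Longrightarrow> 0 < (\<Sum>p\<leftarrow>ps. fst p)"
  by (cases ps) auto

lemma tour_reaches: "tour I ps J \<Longrightarrow> K \<in> snd ` set ps \<Longrightarrow> J \<in> S \<Longrightarrow> reaches K S"
proof (induction ps arbitrary: I)
  case (Cons p ps)
  then have p: "tour (snd p) ps J" by simp
  show ?case
  proof (cases "K = snd p")
    case True
    show ?thesis unfolding True by (rule reaches_steps[OF tour_steps[OF p] reaches_self[OF Cons.prems(3)]])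
  next
    case False
    then show ?thesis using Cons.IH[OF p] Cons.prems by simp
  qed
qed simp

text \<open>An entry \<open>(I, L, ps)\<close> describes the orbit of \<open>I\<close>, of size \<open>L\<close>: \<open>ps\<close> lists states that it
  meets, each with the time since the previous one, the last one being \<open>I\<close> again.\<close>

definition tours :: "((nat \<times> nat) set \<times> nat \<times> (nat \<times> (nat \<times> nat) set) list) list \<Rightarrow> bool" where
  "tours cl \<longleftrightarrow> list_all (\<lambda>(I, L, ps). ps \<noteq> [] \<and> L = (\<Sum>p\<leftarrow>ps. fst p) \<and> tour I ps I) cl"

lemma toursD:
  assumes "tours cl" "(I, L, ps) \<in> set cl"
  shows "ps \<noteq> []" "L = (\<Sum>p\<leftarrow>ps. fst p)" "tour I ps I"
proof -
  have "ps \<noteq> [] \<and> L = (\<Sum>p\<leftarrow>ps. fst p) \<and> tour I ps I"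
    using bspec[OF assms(1)[unfolded tours_def list_all_iff] assms(2)] unfolding prod.case .
  then show "ps \<noteq> []" "L = (\<Sum>p\<leftarrow>ps. fst p)" "tour I ps I" by simp_all
qed

lemma tours_period:
  assumes "tours cl" "(I, L) \<in> set (map (\<lambda>(I, L, ps). (I, L)) cl)"
  shows "0 < L \<and> steps L I I"
proof -
  obtain ps where "(I, L, ps) \<in> set cl" using assms(2) by auto
  note t = toursD[OF assms(1) this]
  show ?thesis unfolding t(2) using tour_pos[OF t(3,1)] tour_steps[OF t(3)] by simp
qed

lemma tours_cover:
  assumes "tours cl" "J \<in> (\<Union>(I, L, ps)\<in>set cl. snd ` set ps)"
  shows "reaches J (fst ` set (map (\<lambda>(I, L, ps). (I, L)) cl))"
proof -
  obtain I L ps where c: "(I, L, ps) \<in> set cl" and J: "J \<in> snd ` set ps" using assms(2) by blast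
  have "I \<in> fst ` set (map (\<lambda>(I, L, ps). (I, L)) cl)" using c by force
  then show ?thesis by (rule tour_reaches[OF toursD(3)[OF assms(1) c] J])
qed

definition large_table :: bool where
  "large_table \<longleftrightarrow>
     has_sizes (rowmotion_orbits (two_by n) xs) ((2, 1) # linear_table n @ quadratic_table n) \<and>
      (\<exists>Z Q. Z \<in> rowmotion_orbits (two_by n) xs \<and> card Z = 2 \<and>
        Q \<subseteq> rowmotion_orbits (two_by n) xs - {Z} \<and> has_sizes Q (quadratic_table n) \<and>
        (\<forall>X \<in> rowmotion_orbits (two_by n) xs - {Z} - Q. card X dvd n + 3 \<or> card X dvd n + 5))"

text \<open>Reduces a residue class to a finite check. All narrow states flow to the nine line ends,
  so tours that visit these ends cover the rest; a total length equal to \<open>rest_size\<close>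
  leaves no room for a shorter period or for two tours on one orbit. The 30 stands on the left to
  avoid subtraction of naturals.\<close>

lemma large_case:
  fixes cl :: "((nat \<times> nat) set \<times> nat \<times> (nat \<times> (nat \<times> nat) set) list) list"
  assumes n: "5 \<le> n" and dist: "distinct (map fst cl)" and ends: "fst ` set cl \<subseteq> line_ends"
    and tours: "tours cl" and cover: "line_ends \<subseteq> (\<Union>(I, L, ps)\<in>set cl. snd ` set ps)"
    and total: "(\<Sum>(I, L, ps)\<leftarrow>cl. L) + 30 = 3 * n\<^sup>2 + 5 * n"
    and quad: "\<And>s. (\<Sum>(s', c) \<leftarrow> quadratic_table n. if s' = s then c else 0) =
      (\<Sum>(I, L, ps)\<leftarrow>cl. if of_nat L = s then 1 else 0)"
  shows large_table
  unfolding large_table_def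
proof
  let ?rl = "map (\<lambda>(I, L, ps). (I, L)) cl"
  have n2: "2 \<le> n" using n by simp
  have fst_rl: "map fst ?rl = map fst cl" by (induction cl) auto
  have dist': "distinct (map fst ?rl)" unfolding fst_rl by (rule dist)
  have eq: "fst ` set ?rl = fst ` set cl" by (simp only: set_map[symmetric] fst_rl)
  have narrow: "fst ` set ?rl \<subseteq> tops_narrow"
    unfolding eq by (rule subset_trans[OF ends line_ends_narrow[OF n]])
  have cover': "reaches I (fst ` set ?rl)" if "I \<in> tops_narrow" for I
    by (rule reaches_trans[OF tops_narrow_reach[OF n that]], rule tours_cover[OF tours], rule subsetD[OF cover])
  have sums: "(\<Sum>(I, L)\<leftarrow>?rl. L) = (\<Sum>(I, L, ps)\<leftarrow>cl. L)"
    "(\<Sum>(I, L)\<leftarrow>?rl. if of_nat L = s then 1 else 0) = (\<Sum>(I, L, ps)\<leftarrow>cl. if of_nat L = s then 1 else 0 :: rat)" for s :: rat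
    by (simp_all add: comp_def case_prod_unfold)
  have total': "of_nat (\<Sum>(I, L)\<leftarrow>?rl. L) = rest_size"
  proof -
    have "(of_nat ((\<Sum>(I, L, ps)\<leftarrow>cl. L) + 30) :: rat) = of_nat (3 * n\<^sup>2 + 5 * n)" by (simp only: total)
    then show ?thesis unfolding rest_size_large[OF n] sums by simp
  qed
  note count = orbit_count[OF n2 dist' narrow tours_period[OF tours] cover' total', unfolded sums]
  note kinds = orbit_kinds[OF n2 dist' narrow tours_period[OF tours] cover' total', unfolded sums]
  show "has_sizes (rowmotion_orbits (two_by n) xs) ((2, 1) # linear_table n @ quadratic_table n)"
    unfolding has_sizes_def
  proof (intro allI)
    fix s :: rat
    have "(\<Sum>(s', c) \<leftarrow> (2, 1) # linear_table n @ quadratic_table n. if s' = s then c else 0) =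
        (if 2 = s then 1 else 0) + (\<Sum>(s', c) \<leftarrow> linear_table n. if s' = s then c else 0) +
        (\<Sum>(I, L, ps)\<leftarrow>cl. if of_nat L = s then 1 else 0)"
      by (simp add: quad)
    then show "of_nat (card {X \<in> rowmotion_orbits (two_by n) xs. of_nat (card X) = s}) =
        (\<Sum>(s', c) \<leftarrow> (2, 1) # linear_table n @ quadratic_table n. if s' = s then c else 0)"
      unfolding linear_table_sum[OF n] by (simp only: count add_ac)
  qed
  show "\<exists>Z Q. Z \<in> rowmotion_orbits (two_by n) xs \<and> card Z = 2 \<and>
        Q \<subseteq> rowmotion_orbits (two_by n) xs - {Z} \<and> has_sizes Q (quadratic_table n) \<and>
        (\<forall>X \<in> rowmotion_orbits (two_by n) xs - {Z} - Q. card X dvd n + 3 \<or> card X dvd n + 5)"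
    unfolding has_sizes_def quad by (rule kinds)
qed

lemma line_ends_eq:
  "line_ends = {line 0 1, line 0 2, line 0 3, line 1 1, line 1 2, line 1 3, line 2 1, line 2 2, line 2 3}"
proof
  show "line_ends \<subseteq> {line 0 1, line 0 2, line 0 3, line 1 1, line 1 2, line 1 3, line 2 1, line 2 2, line 2 3}"
  proof
    fix I assume "I \<in> line_ends"
    then obtain l u where I: "I = line l u" "l \<le> 2" "1 \<le> u" "u \<le> 3" unfolding line_ends_def by blast
    then have "l = 0 \<or> l = 1 \<or> l = 2" "u = 1 \<or> u = 2 \<or> u = 3" by linarith+
    then show "I \<in> {line 0 1, line 0 2, line 0 3, line 1 1, line 1 2, line 1 3, line 2 1, line 2 2, line 2 3}"
      unfolding I(1) by (elim disjE) (simp_all only: insert_iff simp_thms)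
  qed
  have "line l u \<in> line_ends" if "l \<le> 2 \<and> 1 \<le> u \<and> u \<le> 3" for l u
    using that unfolding line_ends_def by blast
  then show "{line 0 1, line 0 2, line 0 3, line 1 1, line 1 2, line 1 3, line 2 1, line 2 2, line 2 3} \<subseteq> line_ends"
    by (simp only: insert_subset empty_subsetI) simp
qed

lemma line_eq_iff:
  assumes "5 \<le> n" "1 \<le> u" "u \<le> 3" "1 \<le> u'" "u' \<le> 3"
  shows "line l u = line l' u' \<longleftrightarrow> l = l' \<and> u = u'"
  using assms unfolding line_def by (auto simp: top_state_eq_iff)

lemma quadratic_orbits_5:
  assumes n: "n = 6 * k + 5"
  shows large_table
proof -
  have n5: "5 \<le> n" and m: "n mod 6 = 5" using n by simp_all
  define N where "N = (of_nat n :: rat)"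
  have N: "N = 6 * of_nat k + 5" by (simp add: N_def n)
  have sizes: "of_nat (15 + (6 * k + 1) * (n + 6)) = N^2 + 2*N - 9"
    "of_nat (33 + (12 * k + 1) * (n + 6)) = 2*N^2 + 3*N - 21"
    by (simp_all add: N n field_simps power2_eq_square)
  let ?cl = "[(line 0 1, 15 + (6 * k + 1) * (n + 6),
        [(4 + (2 * k + 1) * (n + 6), line 1 1),
         (4 + 2 * k * (n + 6), line 2 3),
         (7 + 2 * k * (n + 6), line 0 1)]),
      (line 0 2, 33 + (12 * k + 1) * (n + 6),
        [(5 + 2 * k * (n + 6), line 0 3),
         (6 + (2 * k + 1) * (n + 6), line 2 1),
         (5 + 2 * k * (n + 6), line 2 2),
         (6 + 2 * k * (n + 6), line 1 2),
         (5 + 2 * k * (n + 6), line 1 3),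
         (6 + 2 * k * (n + 6), line 0 2)])]"
  have table: "quadratic_table n = [(2*N^2 + 3*N - 21, 1), (N^2 + 2*N - 9, 1)]"
    by (simp add: quadratic_table_def Let_def m N_def)
  show ?thesis
  proof (rule large_case[OF n5, where cl = ?cl])
    show "distinct (map fst ?cl)" by (simp add: line_eq_iff[OF n5] del: One_nat_def)
    show "fst ` set ?cl \<subseteq> line_ends" unfolding line_ends_eq by simp
    show "tours ?cl"
      by (simp only: tours_def list.pred_inject prod.case tour.simps fst_conv snd_conv simp_thms list.distinct,
          intro conjI line_returns[OF n5]) (use n in \<open>auto simp: algebra_simps\<close>)
    show "line_ends \<subseteq> (\<Union>(I, L, ps)\<in>set ?cl. snd ` set ps)" unfolding line_ends_eq by simp
    show "(\<Sum>(I, L, ps)\<leftarrow>?cl. L) + 30 = 3 * n\<^sup>2 + 5 * n"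
      unfolding n by (simp add: algebra_simps power2_eq_square)
    show "(\<Sum>(s', c) \<leftarrow> quadratic_table n. if s' = s then c else 0) =
      (\<Sum>(I, L, ps)\<leftarrow>?cl. if of_nat L = s then 1 else 0)" for s
      unfolding table by (simp only: list.map sum_list.Cons sum_list.Nil prod.case sizes; simp)
  qed
qed

text \<open>The exit heights now have other residues mod 3, and the ends form three cycles of three.
  The coefficient of n + 6 in each size is the number of translations on the whole cycle.\<close>

lemma quadratic_orbits_0:
  assumes n: "n = 6 * k + 6"
  shows large_table
proof -
  have n5: "5 \<le> n" and m: "n mod 6 = 0" using n by simp_all
  define N where "N = (of_nat n :: rat)"
  have N: "N = 6 * of_nat k + 6" by (simp add: N_def n)
  have sizes: "of_nat (13 + (6 * k + 3) * (n + 6)) = N^2 + 3*N - 5"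
    "of_nat (17 + (6 * k + 1) * (n + 6)) = N^2 + N - 13"
    "of_nat (18 + (6 * k + 1) * (n + 6)) = N^2 + N - 12"
    by (simp_all add: N n field_simps power2_eq_square)
  let ?cl = "[(line 0 1, 13 + (6 * k + 3) * (n + 6),
        [(4 + (2 * k + 1) * (n + 6), line 1 2),
         (5 + (2 * k + 1) * (n + 6), line 1 1),
         (4 + (2 * k + 1) * (n + 6), line 0 1)]),
      (line 0 2, 17 + (6 * k + 1) * (n + 6),
        [(5 + (2 * k + 1) * (n + 6), line 2 1),
         (5 + 2 * k * (n + 6), line 2 3),
         (7 + 2 * k * (n + 6), line 0 2)]),
      (line 0 3, 18 + (6 * k + 1) * (n + 6),
        [(6 + (2 * k + 1) * (n + 6), line 2 2),
         (6 + 2 * k * (n + 6), line 1 3),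
         (6 + 2 * k * (n + 6), line 0 3)])]"
  have table: "quadratic_table n = [(N^2 + 3*N - 5, 1), (N^2 + N - 12, 1), (N^2 + N - 13, 1)]"
    by (simp add: quadratic_table_def Let_def m N_def)
  show ?thesis
  proof (rule large_case[OF n5, where cl = ?cl])
    show "distinct (map fst ?cl)" by (simp add: line_eq_iff[OF n5] del: One_nat_def)
    show "fst ` set ?cl \<subseteq> line_ends" unfolding line_ends_eq by simp
    show "tours ?cl"
      by (simp only: tours_def list.pred_inject prod.case tour.simps fst_conv snd_conv simp_thms list.distinct,
          intro conjI line_returns[OF n5]) (use n in \<open>auto simp: algebra_simps\<close>)
    show "line_ends \<subseteq> (\<Union>(I, L, ps)\<in>set ?cl. snd ` set ps)" unfolding line_ends_eq by simp
    show "(\<Sum>(I, L, ps)\<leftarrow>?cl. L) + 30 = 3 * n\<^sup>2 + 5 * n"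
      unfolding n by (simp add: algebra_simps power2_eq_square)
    show "(\<Sum>(s', c) \<leftarrow> quadratic_table n. if s' = s then c else 0) =
      (\<Sum>(I, L, ps)\<leftarrow>?cl. if of_nat L = s then 1 else 0)" for s
      unfolding table by (simp only: list.map sum_list.Cons sum_list.Nil prod.case sizes; simp)
  qed
qed

lemma quadratic_orbits_1:
  assumes n: "n = 6 * k + 7"
  shows large_table
proof -
  have n5: "5 \<le> n" and m: "n mod 6 = 1" using n by simp_all
  define N where "N = (of_nat n :: rat)"
  have N: "N = 6 * of_nat k + 7" by (simp add: N_def n)
  have sizes: "of_nat (15 + (6 * k + 3) * (n + 6)) = N^2 + 2*N - 9"
    "of_nat (15 + (6 * k + 3) * (n + 6)) = N^2 + 2*N - 9"
    "of_nat (13 + (4 * k + 1) * (n + 6)) = (2*N^2 + N - 27) / 3"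
    "of_nat (5 + (2 * k + 1) * (n + 6)) = (N^2 + 2*N - 9) / 3"
    by (simp_all add: N n field_simps power2_eq_square)
  let ?cl = "[(line 0 1, 15 + (6 * k + 3) * (n + 6),
        [(4 + (2 * k + 1) * (n + 6), line 1 3),
         (6 + (2 * k + 1) * (n + 6), line 2 1),
         (5 + (2 * k + 1) * (n + 6), line 0 1)]),
      (line 0 2, 15 + (6 * k + 3) * (n + 6),
        [(5 + (2 * k + 1) * (n + 6), line 2 2),
         (6 + (2 * k + 1) * (n + 6), line 1 1),
         (4 + (2 * k + 1) * (n + 6), line 0 2)]),
      (line 0 3, 13 + (4 * k + 1) * (n + 6),
        [(6 + (2 * k + 1) * (n + 6), line 2 3),
         (7 + 2 * k * (n + 6), line 0 3)]),
      (line 1 2, 5 + (2 * k + 1) * (n + 6),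
        [(5 + (2 * k + 1) * (n + 6), line 1 2)])]"
  have table: "quadratic_table n = [(N^2 + 2*N - 9, 2), ((2*N^2 + N - 27) / 3, 1), ((N^2 + 2*N - 9) / 3, 1)]"
    by (simp add: quadratic_table_def Let_def m N_def)
  show ?thesis
  proof (rule large_case[OF n5, where cl = ?cl])
    show "distinct (map fst ?cl)" by (simp add: line_eq_iff[OF n5] del: One_nat_def)
    show "fst ` set ?cl \<subseteq> line_ends" unfolding line_ends_eq by simp
    show "tours ?cl"
      by (simp only: tours_def list.pred_inject prod.case tour.simps fst_conv snd_conv simp_thms list.distinct,
          intro conjI line_returns[OF n5]) (use n in \<open>auto simp: algebra_simps\<close>)
    show "line_ends \<subseteq> (\<Union>(I, L, ps)\<in>set ?cl. snd ` set ps)" unfolding line_ends_eq by simp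
    show "(\<Sum>(I, L, ps)\<leftarrow>?cl. L) + 30 = 3 * n\<^sup>2 + 5 * n"
      unfolding n by (simp add: algebra_simps power2_eq_square)
    show "(\<Sum>(s', c) \<leftarrow> quadratic_table n. if s' = s then c else 0) =
      (\<Sum>(I, L, ps)\<leftarrow>?cl. if of_nat L = s then 1 else 0)" for s
      unfolding table by (simp only: list.map sum_list.Cons sum_list.Nil prod.case sizes; simp)
  qed
qed

lemma quadratic_orbits_2:
  assumes n: "n = 6 * k + 8"
  shows large_table
proof -
  have n5: "5 \<le> n" and m: "n mod 6 = 2" using n by simp_all
  define N where "N = (of_nat n :: rat)"
  have N: "N = 6 * of_nat k + 8" by (simp add: N_def n)
  have sizes: "of_nat (14 + (6 * k + 5) * (n + 6)) = N^2 + 3*N - 4"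
    "of_nat (17 + (6 * k + 3) * (n + 6)) = N^2 + N - 13"
    "of_nat (17 + (6 * k + 3) * (n + 6)) = N^2 + N - 13"
    by (simp_all add: N n field_simps power2_eq_square)
  let ?cl = "[(line 0 1, 14 + (6 * k + 5) * (n + 6),
        [(4 + (2 * k + 2) * (n + 6), line 1 1),
         (4 + (2 * k + 1) * (n + 6), line 0 3),
         (6 + (2 * k + 2) * (n + 6), line 0 1)]),
      (line 0 2, 17 + (6 * k + 3) * (n + 6),
        [(5 + (2 * k + 1) * (n + 6), line 2 3),
         (7 + (2 * k + 1) * (n + 6), line 2 1),
         (5 + (2 * k + 1) * (n + 6), line 0 2)]),
      (line 1 2, 17 + (6 * k + 3) * (n + 6),
        [(5 + (2 * k + 1) * (n + 6), line 1 3),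
         (6 + (2 * k + 1) * (n + 6), line 2 2),
         (6 + (2 * k + 1) * (n + 6), line 1 2)])]"
  have table: "quadratic_table n = [(N^2 + 3*N - 4, 1), (N^2 + N - 13, 2)]"
    by (simp add: quadratic_table_def Let_def m N_def)
  show ?thesis
  proof (rule large_case[OF n5, where cl = ?cl])
    show "distinct (map fst ?cl)" by (simp add: line_eq_iff[OF n5] del: One_nat_def)
    show "fst ` set ?cl \<subseteq> line_ends" unfolding line_ends_eq by simp
    show "tours ?cl"
      by (simp only: tours_def list.pred_inject prod.case tour.simps fst_conv snd_conv simp_thms list.distinct,
          intro conjI line_returns[OF n5]) (use n in \<open>auto simp: algebra_simps\<close>)
    show "line_ends \<subseteq> (\<Union>(I, L, ps)\<in>set ?cl. snd ` set ps)" unfolding line_ends_eq by simp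
    show "(\<Sum>(I, L, ps)\<leftarrow>?cl. L) + 30 = 3 * n\<^sup>2 + 5 * n"
      unfolding n by (simp add: algebra_simps power2_eq_square)
    show "(\<Sum>(s', c) \<leftarrow> quadratic_table n. if s' = s then c else 0) =
      (\<Sum>(I, L, ps)\<leftarrow>?cl. if of_nat L = s then 1 else 0)" for s
      unfolding table by (simp only: list.map sum_list.Cons sum_list.Nil prod.case sizes; simp)
  qed
qed

text \<open>Related to n = 6k + 6 by the same change of parity, which here joins two of the three
  cycles into one of length six.\<close>

lemma quadratic_orbits_3:
  assumes n: "n = 6 * k + 9"
  shows large_table
proof -
  have n5: "5 \<le> n" and m: "n mod 6 = 3" using n by simp_all
  define N where "N = (of_nat n :: rat)"
  have N: "N = 6 * of_nat k + 9" by (simp add: N_def n)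
  have sizes: "of_nat (29 + (12 * k + 11) * (n + 6)) = 2*N^2 + 5*N - 13"
    "of_nat (19 + (6 * k + 3) * (n + 6)) = N^2 - 17"
    by (simp_all add: N n field_simps power2_eq_square)
  let ?cl = "[(line 0 1, 29 + (12 * k + 11) * (n + 6),
        [(4 + (2 * k + 2) * (n + 6), line 1 2),
         (5 + (2 * k + 2) * (n + 6), line 1 1),
         (4 + (2 * k + 2) * (n + 6), line 2 1),
         (5 + (2 * k + 1) * (n + 6), line 0 3),
         (6 + (2 * k + 2) * (n + 6), line 0 2),
         (5 + (2 * k + 2) * (n + 6), line 0 1)]),
      (line 1 3, 19 + (6 * k + 3) * (n + 6),
        [(6 + (2 * k + 1) * (n + 6), line 2 3),
         (7 + (2 * k + 1) * (n + 6), line 2 2),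
         (6 + (2 * k + 1) * (n + 6), line 1 3)])]"
  have table: "quadratic_table n = [(2*N^2 + 5*N - 13, 1), (N^2 - 17, 1)]"
    by (simp add: quadratic_table_def Let_def m N_def)
  show ?thesis
  proof (rule large_case[OF n5, where cl = ?cl])
    show "distinct (map fst ?cl)" by (simp add: line_eq_iff[OF n5] del: One_nat_def)
    show "fst ` set ?cl \<subseteq> line_ends" unfolding line_ends_eq by simp
    show "tours ?cl"
      by (simp only: tours_def list.pred_inject prod.case tour.simps fst_conv snd_conv simp_thms list.distinct,
          intro conjI line_returns[OF n5]) (use n in \<open>auto simp: algebra_simps\<close>)
    show "line_ends \<subseteq> (\<Union>(I, L, ps)\<in>set ?cl. snd ` set ps)" unfolding line_ends_eq by simp
    show "(\<Sum>(I, L, ps)\<leftarrow>?cl. L) + 30 = 3 * n\<^sup>2 + 5 * n"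
      unfolding n by (simp add: algebra_simps power2_eq_square)
    show "(\<Sum>(s', c) \<leftarrow> quadratic_table n. if s' = s then c else 0) =
      (\<Sum>(I, L, ps)\<leftarrow>?cl. if of_nat L = s then 1 else 0)" for s
      unfolding table by (simp only: list.map sum_list.Cons sum_list.Nil prod.case sizes; simp)
  qed
qed

text \<open>The five ends that keep their height for n mod 3 = 1 now also keep their line, since
  \<open>v\<close> has the other parity. They become orbits of their own, which explains the large
  number of quadratic orbits.\<close>

lemma quadratic_orbits_4:
  assumes n: "n = 6 * k + 10"
  shows large_table
proof -
  have n5: "5 \<le> n" and m: "n mod 6 = 4" using n by simp_all
  define N where "N = (of_nat n :: rat)"
  have N: "N = 6 * of_nat k + 10" by (simp add: N_def n)
  have sizes: "of_nat (10 + (4 * k + 4) * (n + 6)) = (2*N^2 + 4*N - 18) / 3"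
    "of_nat (5 + (2 * k + 2) * (n + 6)) = (N^2 + 2*N - 9) / 3"
    "of_nat (6 + (2 * k + 2) * (n + 6)) = (N^2 + 2*N - 6) / 3"
    "of_nat (10 + (4 * k + 4) * (n + 6)) = (2*N^2 + 4*N - 18) / 3"
    "of_nat (5 + (2 * k + 2) * (n + 6)) = (N^2 + 2*N - 9) / 3"
    "of_nat (5 + (2 * k + 2) * (n + 6)) = (N^2 + 2*N - 9) / 3"
    "of_nat (7 + (2 * k + 1) * (n + 6)) = (N^2 - N - 21) / 3"
    by (simp_all add: N n field_simps power2_eq_square)
  let ?cl = "[(line 0 1, 10 + (4 * k + 4) * (n + 6),
        [(4 + (2 * k + 2) * (n + 6), line 1 3),
         (6 + (2 * k + 2) * (n + 6), line 0 1)]),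
      (line 0 2, 5 + (2 * k + 2) * (n + 6),
        [(5 + (2 * k + 2) * (n + 6), line 0 2)]),
      (line 0 3, 6 + (2 * k + 2) * (n + 6),
        [(6 + (2 * k + 2) * (n + 6), line 0 3)]),
      (line 1 1, 10 + (4 * k + 4) * (n + 6),
        [(4 + (2 * k + 2) * (n + 6), line 2 2),
         (6 + (2 * k + 2) * (n + 6), line 1 1)]),
      (line 1 2, 5 + (2 * k + 2) * (n + 6),
        [(5 + (2 * k + 2) * (n + 6), line 1 2)]),
      (line 2 1, 5 + (2 * k + 2) * (n + 6),
        [(5 + (2 * k + 2) * (n + 6), line 2 1)]),
      (line 2 3, 7 + (2 * k + 1) * (n + 6),
        [(7 + (2 * k + 1) * (n + 6), line 2 3)])]"
  have table: "quadratic_table n = [((2*N^2 + 4*N - 18) / 3, 2), ((N^2 + 2*N - 6) / 3, 1), ((N^2 + 2*N - 9) / 3, 3), ((N^2 - N - 21) / 3, 1)]"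
    by (simp add: quadratic_table_def Let_def m N_def)
  show ?thesis
  proof (rule large_case[OF n5, where cl = ?cl])
    show "distinct (map fst ?cl)" by (simp add: line_eq_iff[OF n5] del: One_nat_def)
    show "fst ` set ?cl \<subseteq> line_ends" unfolding line_ends_eq by simp
    show "tours ?cl"
      by (simp only: tours_def list.pred_inject prod.case tour.simps fst_conv snd_conv simp_thms list.distinct,
          intro conjI line_returns[OF n5]) (use n in \<open>auto simp: algebra_simps\<close>)
    show "line_ends \<subseteq> (\<Union>(I, L, ps)\<in>set ?cl. snd ` set ps)" unfolding line_ends_eq by simp
    show "(\<Sum>(I, L, ps)\<leftarrow>?cl. L) + 30 = 3 * n\<^sup>2 + 5 * n"
      unfolding n by (simp add: algebra_simps power2_eq_square)
    show "(\<Sum>(s', c) \<leftarrow> quadratic_table n. if s' = s then c else 0) =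
      (\<Sum>(I, L, ps)\<leftarrow>?cl. if of_nat L = s then 1 else 0)" for s
      unfolding table by (simp only: list.map sum_list.Cons sum_list.Nil prod.case sizes; simp)
  qed
qed

section \<open>The theorem\<close>

lemma large_orbits:
  assumes "5 \<le> n"
  shows large_table
proof -
  define k where "k = (n - 5) div 6"
  have "n = 6 * k + 5 \<or> n = 6 * k + 6 \<or> n = 6 * k + 7 \<or> n = 6 * k + 8 \<or> n = 6 * k + 9 \<or> n = 6 * k + 10"
    using assms unfolding k_def by presburger
  then show ?thesis
    using quadratic_orbits_5 quadratic_orbits_0 quadratic_orbits_1 quadratic_orbits_2
      quadratic_orbits_3 quadratic_orbits_4 by (elim disjE)
qed

section \<open>The posets with n at most 4\<close>

lemma card_tops_wide_small: "n \<le> 6 \<Longrightarrow> card tops_wide = 0"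
  using card_tops_wide_eq by simp

lemma tops_narrowE:
  assumes "I \<in> tops_narrow"
  obtains c k where "I = top_state c k" "1 \<le> c" "c + k \<le> n" "c < n"
proof -
  obtain c k where "I = top_state c k" "1 \<le> c" "c + k \<le> n" "c \<noteq> n"
    using assms unfolding tops_narrow_def by blast
  then show ?thesis by (intro that[of c k]) simp_all
qed

lemma tops_narrowI: "1 \<le> c \<Longrightarrow> c + k \<le> n \<Longrightarrow> k < 3 \<or> n < c + k + 3 \<Longrightarrow> c < n \<Longrightarrow> top_state c k \<in> tops_narrow"
  unfolding tops_narrow_def by blast

text \<open>The counts of gap and pair states hold from n = 2 on and \<open>tops_wide\<close> is
  empty, so only the narrow top states remain. Their returns are listed by the pairs
  \<open>(c, k)\<close>, because the exits of the lines are stated for n \<ge> 5.\<close>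

lemma small_orbits_2:
  assumes n: "n = 2"
  shows "has_sizes (rowmotion_orbits (two_by n) xs) (small_table n)"
proof -
  have n2: "2 \<le> n" using n by simp
  have s10: "steps 4 (top_state 1 0) (top_state 1 1)"
    by (rule steps_eq[OF top_end_1[of 1 0]]) (use n in \<open>simp_all add: top_state_eq_iff\<close>)
  have s11: "steps 2 (top_state 1 1) (top_state 1 0)"
    by (rule steps_eq[OF top_full_row]) (use n in \<open>simp_all add: top_state_eq_iff\<close>)
  let ?cl = "[(top_state 1 0, 6, [(4, top_state 1 1), (2, top_state 1 0)])]"
  let ?rl = "[(top_state 1 0, 6)] :: ((nat \<times> nat) set \<times> nat) list"
  have tours: "tours ?cl"
    by (simp only: tours_def list.pred_inject prod.case tour.simps fst_conv snd_conv simp_thms list.distinct s10 s11; simp)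
  have rl: "map (\<lambda>(I, L, ps). (I, L)) ?cl = ?rl" by simp
  have dist: "distinct (map fst ?rl)" by (simp add: top_state_eq_iff)
  have fst_rl: "fst ` set ?rl = {top_state 1 0}" by simp
  have narrow: "fst ` set ?rl \<subseteq> tops_narrow"
    unfolding fst_rl insert_subset by (intro conjI empty_subsetI tops_narrowI) (use n in simp_all)
  have cover: "reaches I (fst ` set ?rl)" if I: "I \<in> tops_narrow" for I
  proof -
    obtain c k where I: "I = top_state c k" "1 \<le> c" "c + k \<le> n" "c < n" using I by (rule tops_narrowE)
    then have "c = 1 \<and> k = 0 \<or> c = 1 \<and> k = 1" using n by presburger
    then have "I \<in> (\<Union>(I, L, ps)\<in>set ?cl. snd ` set ps)"
      unfolding I(1) by (elim disjE conjE) simp_all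
    from tours_cover[OF tours this] show ?thesis unfolding rl .
  qed
  note period = tours_period[OF tours, unfolded rl]
  have wide: "card tops_wide = 0" "card tops_wide_sym = 0"
    using n card_tops_wide_small card_tops_wide_sym by simp_all
  note cards = card_gaps_big[OF n2] card_gaps_big_sym[OF n2] card_gaps_three[OF n2] card_gaps_two[OF n2]
    card_gaps_two_sym[OF n2] card_pairs[OF n2] card_pairs_sym[OF n2] wide
  have total: "of_nat (\<Sum>(I, L)\<leftarrow>?rl. L) = rest_size"
    unfolding rest_size_def card_ICS_rat cards by (simp add: n)
  show ?thesis
    unfolding has_sizes_def
    by (simp only: orbit_count[OF n2 dist narrow period cover total] cards) (simp add: n small_table_def)
qed

text \<open>Size 2 is attained twice: besides the orbit of the empty set there is the symmetric
  orbit of \<open>gaps_two_sym\<close>, with (n + 3) / 3 = 2.\<close>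

lemma small_orbits_3:
  assumes n: "n = 3"
  shows "has_sizes (rowmotion_orbits (two_by n) xs) (small_table n)"
proof -
  have n2: "2 \<le> n" using n by simp
  have s10: "steps 5 (top_state 1 0) (top_state 2 0)"
    by (rule steps_eq[OF top_end_2[of 1 0]]) (use n in \<open>simp_all add: top_state_eq_iff\<close>)
  have s20: "steps 4 (top_state 2 0) (top_state 1 1)"
    by (rule steps_eq[OF top_end_1[of 2 0]]) (use n in \<open>simp_all add: top_state_eq_iff\<close>)
  have s11: "steps 5 (top_state 1 1) (top_state 2 1)"
    by (rule steps_eq[OF top_end_1[of 1 1]]) (use n in \<open>simp_all add: top_state_eq_iff\<close>)
  have s21: "steps 4 (top_state 2 1) (top_state 1 2)"
    by (rule steps_eq[OF top_end_0[of 2 1]]) (use n in \<open>simp_all add: top_state_eq_iff\<close>)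
  have s12: "steps 2 (top_state 1 2) (top_state 1 0)"
    by (rule steps_eq[OF top_full_row]) (use n in \<open>simp_all add: top_state_eq_iff\<close>)
  let ?cl = "[(top_state 1 0, 20, [(5, top_state 2 0), (4, top_state 1 1), (5, top_state 2 1), (4, top_state 1 2), (2, top_state 1 0)])]"
  let ?rl = "[(top_state 1 0, 20)] :: ((nat \<times> nat) set \<times> nat) list"
  have tours: "tours ?cl"
    by (simp only: tours_def list.pred_inject prod.case tour.simps fst_conv snd_conv simp_thms list.distinct s10 s20 s11 s21 s12; simp)
  have rl: "map (\<lambda>(I, L, ps). (I, L)) ?cl = ?rl" by simp
  have dist: "distinct (map fst ?rl)" by (simp add: top_state_eq_iff)
  have fst_rl: "fst ` set ?rl = {top_state 1 0}" by simp
  have narrow: "fst ` set ?rl \<subseteq> tops_narrow"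
    unfolding fst_rl insert_subset by (intro conjI empty_subsetI tops_narrowI) (use n in simp_all)
  have cover: "reaches I (fst ` set ?rl)" if I: "I \<in> tops_narrow" for I
  proof -
    obtain c k where I: "I = top_state c k" "1 \<le> c" "c + k \<le> n" "c < n" using I by (rule tops_narrowE)
    then have "c = 1 \<and> k = 0 \<or> c = 1 \<and> k = 1 \<or> c = 1 \<and> k = 2 \<or>
      c = 2 \<and> k = 0 \<or> c = 2 \<and> k = 1" using n by presburger
    then have "I \<in> (\<Union>(I, L, ps)\<in>set ?cl. snd ` set ps)"
      unfolding I(1) by (elim disjE conjE) simp_all
    from tours_cover[OF tours this] show ?thesis unfolding rl .
  qed
  note period = tours_period[OF tours, unfolded rl]
  have wide: "card tops_wide = 0" "card tops_wide_sym = 0"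
    using n card_tops_wide_small card_tops_wide_sym by simp_all
  note cards = card_gaps_big[OF n2] card_gaps_big_sym[OF n2] card_gaps_three[OF n2] card_gaps_two[OF n2]
    card_gaps_two_sym[OF n2] card_pairs[OF n2] card_pairs_sym[OF n2] wide
  have total: "of_nat (\<Sum>(I, L)\<leftarrow>?rl. L) = rest_size"
    unfolding rest_size_def card_ICS_rat cards by (simp add: n)
  show ?thesis
    unfolding has_sizes_def
    by (simp only: orbit_count[OF n2 dist narrow period cover total] cards) (simp add: n small_table_def)
qed

lemma small_orbits_4:
  assumes n: "n = 4"
  shows "has_sizes (rowmotion_orbits (two_by n) xs) (small_table n)"
proof -
  have n2: "2 \<le> n" using n by simp
  have s10: "steps 4 (top_state 1 0) (top_state 1 3)"
    by (rule steps_eq[OF top_rotate[of 1 0 0]]) (use n in \<open>simp_all add: top_state_eq_iff\<close>)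
  have s13: "steps 2 (top_state 1 3) (top_state 1 0)"
    by (rule steps_eq[OF top_full_row]) (use n in \<open>simp_all add: top_state_eq_iff\<close>)
  have s20: "steps 5 (top_state 2 0) (top_state 2 0)"
    by (rule steps_eq[OF top_end_2[of 2 0]]) (use n in \<open>simp_all add: top_state_eq_iff\<close>)
  have s30: "steps 4 (top_state 3 0) (top_state 1 1)"
    by (rule steps_eq[OF top_end_1[of 3 0]]) (use n in \<open>simp_all add: top_state_eq_iff\<close>)
  have s11: "steps 6 (top_state 1 1) (top_state 3 0)"
    by (rule steps_eq[OF top_end_2[of 1 1]]) (use n in \<open>simp_all add: top_state_eq_iff\<close>)
  have s12: "steps 6 (top_state 1 2) (top_state 3 1)"
    by (rule steps_eq[OF top_end_1[of 1 2]]) (use n in \<open>simp_all add: top_state_eq_iff\<close>)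
  have s31: "steps 4 (top_state 3 1) (top_state 1 2)"
    by (rule steps_eq[OF top_end_0[of 3 1]]) (use n in \<open>simp_all add: top_state_eq_iff\<close>)
  have s21: "steps 5 (top_state 2 1) (top_state 2 1)"
    by (rule steps_eq[OF top_end_1[of 2 1]]) (use n in \<open>simp_all add: top_state_eq_iff\<close>)
  have s22: "steps 5 (top_state 2 2) (top_state 2 2)"
    by (rule steps_eq[OF top_end_0[of 2 2]]) (use n in \<open>simp_all add: top_state_eq_iff\<close>)
  let ?cl = "[(top_state 1 0, 6, [(4, top_state 1 3), (2, top_state 1 0)]),
      (top_state 2 0, 5, [(5, top_state 2 0)]),
      (top_state 3 0, 10, [(4, top_state 1 1), (6, top_state 3 0)]),
      (top_state 1 2, 10, [(6, top_state 3 1), (4, top_state 1 2)]),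
      (top_state 2 1, 5, [(5, top_state 2 1)]),
      (top_state 2 2, 5, [(5, top_state 2 2)])]"
  let ?rl = "[(top_state 1 0, 6),
      (top_state 2 0, 5),
      (top_state 3 0, 10),
      (top_state 1 2, 10),
      (top_state 2 1, 5),
      (top_state 2 2, 5)] :: ((nat \<times> nat) set \<times> nat) list"
  have tours: "tours ?cl"
    by (simp only: tours_def list.pred_inject prod.case tour.simps fst_conv snd_conv simp_thms list.distinct s10 s13 s20 s30 s11 s12 s31 s21 s22; simp)
  have rl: "map (\<lambda>(I, L, ps). (I, L)) ?cl = ?rl" by simp
  have dist: "distinct (map fst ?rl)" by (simp add: top_state_eq_iff)
  have fst_rl: "fst ` set ?rl = {top_state 1 0, top_state 2 0, top_state 3 0, top_state 1 2, top_state 2 1, top_state 2 2}" by simp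
  have narrow: "fst ` set ?rl \<subseteq> tops_narrow"
    unfolding fst_rl insert_subset by (intro conjI empty_subsetI tops_narrowI) (use n in simp_all)
  have cover: "reaches I (fst ` set ?rl)" if I: "I \<in> tops_narrow" for I
  proof -
    obtain c k where I: "I = top_state c k" "1 \<le> c" "c + k \<le> n" "c < n" using I by (rule tops_narrowE)
    then have "c = 1 \<and> k = 0 \<or> c = 1 \<and> k = 1 \<or> c = 1 \<and> k = 2 \<or>
      c = 1 \<and> k = 3 \<or> c = 2 \<and> k = 0 \<or> c = 2 \<and> k = 1 \<or>
      c = 2 \<and> k = 2 \<or> c = 3 \<and> k = 0 \<or> c = 3 \<and> k = 1" using n by presburger
    then have "I \<in> (\<Union>(I, L, ps)\<in>set ?cl. snd ` set ps)"
      unfolding I(1) by (elim disjE conjE) simp_all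
    from tours_cover[OF tours this] show ?thesis unfolding rl .
  qed
  note period = tours_period[OF tours, unfolded rl]
  have wide: "card tops_wide = 0" "card tops_wide_sym = 0"
    using n card_tops_wide_small card_tops_wide_sym by simp_all
  note cards = card_gaps_big[OF n2] card_gaps_big_sym[OF n2] card_gaps_three[OF n2] card_gaps_two[OF n2]
    card_gaps_two_sym[OF n2] card_pairs[OF n2] card_pairs_sym[OF n2] wide
  have total: "of_nat (\<Sum>(I, L)\<leftarrow>?rl. L) = rest_size"
    unfolding rest_size_def card_ICS_rat cards by (simp add: n)
  show ?thesis
    unfolding has_sizes_def
    by (simp only: orbit_count[OF n2 dist narrow period cover total] cards) (simp add: n small_table_def)
qed

text \<open>For n = 1 the state \<open>top_state n 0\<close> is the full top row and has period 2
  instead of n + 3, so the list \<open>classes\<close> does not fit. The two classes are given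
  directly.\<close>

lemma small_orbits_1:
  assumes n: "n = 1"
  shows "has_sizes (rowmotion_orbits (two_by n) xs) (small_table n)"
proof -
  let ?S = "{st 1 0 1 0, top_state 1 0}"
  let ?cl = "[({st 1 0 1 0}, {}, 1, 2), ({top_state 1 0}, {}, 1, 2)] ::
    ((nat \<times> nat) set set \<times> (nat \<times> nat) set set \<times> nat \<times> nat) list"
  have S: "(\<Union>c\<in>set ?cl. fst c) = ?S" by auto
  have neq: "st 1 0 1 0 \<noteq> top_state 1 0" using neq_empty(3) by metis
  have base: "base_states \<subseteq> ?S"
  proof
    fix I assume "I \<in> base_states"
    then consider p q r where "2 \<le> q" "p + q + r < n" | x where "2 \<le> x" "x < n"
      | c k where "I = top_state c k" "1 \<le> c" "c + k \<le> n" | "I = st 1 0 1 0"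
      unfolding base_states_def by blast
    then show "I \<in> ?S"
    proof cases
      case (3 c k)
      then have "c = 1" "k = 0" using n by simp_all
      then show ?thesis using 3 by simp
    qed (use n in simp_all)
  qed
  have valid: "?S \<subseteq> ICS (two_by n)"
    unfolding top_state_def by (simp add: st_ICS valid_def n)
  have reach: "\<exists>k. (row ^^ k) I \<in> ?S" if "I \<in> ICS (two_by n)" for I
    using reaches_base[OF that] base unfolding reaches_def by blast
  have "steps (1 + 1) (top_state 1 0) (top_state 1 0)"
  proof (rule steps_trans[of 1 _ "st 1 n 1 0"])
    show "steps 1 (top_state 1 0) (st 1 n 1 0)"
      unfolding top_state_def by (rule steps_1, rule row_no_bottom_end) (use n in auto)
    show "steps 1 (st 1 n 1 0) (top_state 1 0)"
      unfolding top_state_def by (rule steps_1, rule row_no_top_end) (use n in auto)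
  qed
  then have period: "steps 2 (top_state 1 0) (top_state 1 0)" by (rule steps_cong) simp
  have cls: "orbit_class row ?S c" if "c \<in> set ?cl" for c
  proof -
    have "orbit_class row ?S ({st 1 0 1 0}, {}, 1, 2)"
      by (rule orbit_class_single[OF _ valid]) (use steps_empty n in simp_all)
    moreover have "orbit_class row ?S ({top_state 1 0}, {}, 1, 2)"
      by (rule orbit_class_single[OF _ valid]) (use period in simp_all)
    ultimately show ?thesis using that by auto
  qed
  have total: "(\<Sum>(C, F, M, L)\<leftarrow>?cl. of_nat (card C * L) / of_nat M :: rat) = of_nat (card (ICS (two_by n)))"
    unfolding card_ICS_rat by (simp add: n)
  have sorted: "sorted_wrt (\<lambda>c c'. fst c \<inter> fst c' = {}) ?cl" using neq by simp
  have "of_nat (card {X \<in> orbit row ` ICS (two_by n). of_nat (card X) = s}) =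
      (\<Sum>(C, F, M, L)\<leftarrow>?cl. (if of_nat L = s then (of_nat (card C) - of_nat (card F)) / of_nat M else 0) +
        (if of_nat L / of_nat M = s then of_nat (card F) else 0) :: rat)" for s :: rat
    by (rule orbit_classes_count, unfold S) (use valid reach sorted cls total in blast)+
  then show ?thesis
    unfolding has_sizes_def rowmotion_orbits_def by (simp add: small_table_def n)
qed

end

theorem theorem1p2:
  fixes n :: nat and xs :: "(nat \<times> nat) list"
  assumes "n \<ge> 1"
    and "linear_extension (two_by n) xs"
  shows "(n < 5 \<longrightarrow> has_sizes (rowmotion_orbits (two_by n) xs) (small_table n)) \<and>
    (n \<ge> 5 \<longrightarrow>
      has_sizes (rowmotion_orbits (two_by n) xs)
        ((2, 1) # linear_table n @ quadratic_table n) \<and>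
      (\<exists>Z Q. Z \<in> rowmotion_orbits (two_by n) xs \<and> card Z = 2 \<and>
        Q \<subseteq> rowmotion_orbits (two_by n) xs - {Z} \<and>
        has_sizes Q (quadratic_table n) \<and>
        (\<forall>X \<in> rowmotion_orbits (two_by n) xs - {Z} - Q.
           card X dvd n + 3 \<or> card X dvd n + 5)))"
proof -
  interpret two_rows n xs by unfold_locales (rule assms(2))
  have "n = 1 \<or> n = 2 \<or> n = 3 \<or> n = 4" if "n < 5" using that assms(1) by linarith
  then show ?thesis
    using small_orbits_1 small_orbits_2 small_orbits_3 small_orbits_4 large_orbits[unfolded large_table_def] by blast
qed

end
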